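(* Let $n$ be a positive integer. When $n$ is odd, $$e_{\mathbb R}(n)=\frac{2\sqrt2}{\pi}\,\Gamma\Big(\frac{n+2}{2}\Big),$$ while when $n=2m$ is even, $$e_{\mathbb R}(n)=(-1)^m\frac{n!}{m!\,2^n}+(-1)^{m-1}\frac{4\sqrt2\,n!}{\sqrt\pi\,m!\,2^n}\sum_{k=0}^{m-1}(-1)^k\frac{\Gamma(k+3/2)}{k!}.$$ In both cases, $e_{\mathbb R}(n)$ is equivalent to $\frac{2\sqrt2}{\pi}\Gamma\big(\frac{n+2}{2}\big)$ as $n$ grows to infinity (i.e. the ratio tends to $1$).
   Context: $\mathrm{Sym}(n,\mathbb R)$ is the space of real symmetric $n\times n$ matrices with the scalar product for which the matrices $\sqrt2E_{ii}$ ($1\le i\le n$) and $E_{ij}+E_{ji}$ ($1\le i<j\le n$) form an orthonormal basis, where $E_{ij}$ are the elementary matrices; $\|\cdot\|$ is the associated norm. It is equipped with the Gaussian probability measure $d\mu_{\mathbb R}(A)=\pi^{-n(n+1)/4}e^{-\|A\|^2}dA$, with $dA$ the associated Lebesgue measure. Set $e_{\mathbb R}(n)=\int_{\mathrm{Sym}(n,\mathbb R)}|\det A|\,d\mu_{\mathbb R}(A)$. *)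

theory Defs
  imports
    "HOL-Analysis.Analysis"
    "HOL-Library.Landau_Symbols"
    "Jordan_Normal_Form.Determinant"
begin

(* Matrices are those of Jordan_Normal_Form, since the size n varies within the statement.
   Rows and columns are numbered from 0 to n - 1. *)

definition Sym :: "nat \<Rightarrow> real mat set" where
  "Sym n = {A \<in> carrier_mat n n. transpose_mat A = A}"

definition elem_mat :: "nat \<Rightarrow> nat \<Rightarrow> nat \<Rightarrow> real mat" where
  "elem_mat n i j = mat n n (\<lambda>p. if p = (i, j) then 1 else 0)"

definition sym_index :: "nat \<Rightarrow> (nat \<times> nat) set" where
  "sym_index n = {(i, j). i \<le> j \<and> j < n}"

definition sym_basis :: "nat \<Rightarrow> nat \<times> nat \<Rightarrow> real mat" where
  "sym_basis n = (\<lambda>(i, j). if i = j then sqrt 2 \<cdot>\<^sub>m elem_mat n i i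
                           else elem_mat n i j + elem_mat n j i)"

(* The linear combination of the basis matrices with coefficients x, written entrywise because
   matrices of varying size do not form a type to which the sum operator applies. *)
definition sym_of_coords :: "nat \<Rightarrow> (nat \<times> nat \<Rightarrow> real) \<Rightarrow> real mat" where
  "sym_of_coords n x = mat n n (\<lambda>q. \<Sum>p\<in>sym_index n. x p * sym_basis n p $$ q)"

(* Half the trace of A * B on symmetric matrices; by sym_basis_orthonormal and bij_sym_of_coords
   below it is the scalar product on Sym n for which sym_basis n is an orthonormal basis. *)
definition sym_inner :: "nat \<Rightarrow> real mat \<Rightarrow> real mat \<Rightarrow> real" where
  "sym_inner n A B = (\<Sum>i<n. \<Sum>j<n. A $$ (i, j) * B $$ (i, j)) / 2"

definition sym_norm :: "nat \<Rightarrow> real mat \<Rightarrow> real" where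
  "sym_norm n A = sqrt (sym_inner n A A)"

(* Product Lebesgue measure transported along the coordinates in the orthonormal basis. *)
definition sym_lebesgue :: "nat \<Rightarrow> real mat measure" where
  "sym_lebesgue n = embed_measure (\<Pi>\<^sub>M p\<in>sym_index n. lborel) (sym_of_coords n)"

definition gauss_sym :: "nat \<Rightarrow> real mat measure" where
  "gauss_sym n = density (sym_lebesgue n)
     (\<lambda>A. ennreal (pi powr (- (real n * (real n + 1) / 4)) * exp (- (sym_norm n A)\<^sup>2)))"

definition e_R :: "nat \<Rightarrow> real" where
  "e_R n = (\<integral>A. \<bar>Determinant.det A\<bar> \<partial>gauss_sym n)"

lemma finite_sym_index [simp]: "finite (sym_index n)"
  by (rule finite_subset[of _ "{..<n} \<times> {..<n}"]) (auto simp: sym_index_def)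

lemma card_sym_index: "2 * card (sym_index n) = n * (n + 1)"
proof (induction n)
  case 0
  then show ?case by (simp add: sym_index_def)
next
  case (Suc n)
  have "sym_index (Suc n) = sym_index n \<union> (\<lambda>i. (i, n)) ` {..n}"
    by (auto simp: sym_index_def)
  moreover have "sym_index n \<inter> (\<lambda>i. (i, n)) ` {..n} = {}"
    by (auto simp: sym_index_def)
  ultimately have "card (sym_index (Suc n)) = card (sym_index n) + Suc n"
    by (simp add: card_Un_disjoint card_image inj_on_def)
  with Suc show ?case by simp
qed

lemma dim_sym_basis [simp]:
  "dim_row (sym_basis n p) = n" "dim_col (sym_basis n p) = n"
  by (auto simp: sym_basis_def elem_mat_def split: prod.splits)

lemma sym_of_coords_index:
  assumes "i < n" "j < n"
  shows "sym_of_coords n x $$ (i, j) =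
           (if i = j then sqrt 2 * x (i, i) else x (min i j, max i j))"
proof -
  have "sym_of_coords n x $$ (i, j) =
          (\<Sum>p\<in>sym_index n. if p = (min i j, max i j)
             then (if i = j then sqrt 2 * x (i, i) else x (min i j, max i j)) else 0)"
    using assms
    by (auto simp: sym_of_coords_def sym_basis_def elem_mat_def sym_index_def min_def max_def
        intro!: sum.cong)
  moreover have "(min i j, max i j) \<in> sym_index n"
    using assms by (simp add: sym_index_def)
  ultimately show ?thesis
    by simp
qed

lemma sym_inner_sym_of_coords:
  "sym_inner n (sym_of_coords n x) (sym_of_coords n y) = (\<Sum>p\<in>sym_index n. x p * y p)"
proof -
  let ?f = "\<lambda>(i, j). sym_of_coords n x $$ (i, j) * sym_of_coords n y $$ (i, j)"
  let ?L = "{(i, j). i < j \<and> j < n}" and ?U = "{(i, j). j < i \<and> i < n}"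
    and ?D = "{(i, j). i = j \<and> j < n}"
  have fin: "finite ?L" "finite ?U" "finite ?D"
    by (rule finite_subset[of _ "{..<n} \<times> {..<n}"]; auto)+
  have split: "{..<n} \<times> {..<n} = ?L \<union> ?U \<union> ?D" and split': "sym_index n = ?L \<union> ?D"
    by (auto simp: sym_index_def)
  have disj: "?L \<inter> ?U = {}" "(?L \<union> ?U) \<inter> ?D = {}" "?L \<inter> ?D = {}"
    by auto
  have "2 * sym_inner n (sym_of_coords n x) (sym_of_coords n y) = sum ?f ({..<n} \<times> {..<n})"
    by (simp add: sym_inner_def sum.cartesian_product)
  also have "\<dots> = sum ?f ?L + sum ?f ?U + sum ?f ?D"
    unfolding split using fin disj by (simp add: sum.union_disjoint)
  also have "sum ?f ?U = sum ?f ?L"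
    by (rule sum.reindex_bij_witness[of _ prod.swap prod.swap])
       (auto simp: sym_of_coords_index min.commute max.commute)
  also have "sum ?f ?L = (\<Sum>p\<in>?L. x p * y p)"
    by (rule sum.cong) (auto simp: sym_of_coords_index min_def max_def)
  also have "sum ?f ?D = (\<Sum>p\<in>?D. 2 * (x p * y p))"
    by (rule sum.cong) (auto simp: sym_of_coords_index)
  finally show ?thesis
    unfolding split' using fin disj by (simp add: sum.union_disjoint flip: sum_distrib_left)
qed

lemma sym_basis_eq_sym_of_coords:
  assumes "p \<in> sym_index n"
  shows "sym_basis n p = sym_of_coords n (\<lambda>r. if r = p then 1 else 0)"
proof (rule eq_matI)
  fix i j
  assume "i < dim_row (sym_of_coords n (\<lambda>r. if r = p then 1 else 0))"
    and "j < dim_col (sym_of_coords n (\<lambda>r. if r = p then 1 else 0))"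
  then show "sym_basis n p $$ (i, j) = sym_of_coords n (\<lambda>r. if r = p then 1 else 0) $$ (i, j)"
    using assms by (simp add: sym_of_coords_def if_distrib[of "\<lambda>c. c * _"] sum.delta cong: if_cong)
qed (simp_all add: sym_of_coords_def)

lemma sym_basis_orthonormal:
  assumes "p \<in> sym_index n" "q \<in> sym_index n"
  shows "sym_inner n (sym_basis n p) (sym_basis n q) = (if p = q then 1 else 0)"
  using assms
  by (simp add: sym_basis_eq_sym_of_coords sym_inner_sym_of_coords
      if_distrib[of "\<lambda>c. c * _"] sum.delta cong: if_cong)

lemma bij_sym_of_coords: "bij_betw (sym_of_coords n) (sym_index n \<rightarrow>\<^sub>E UNIV) (Sym n)"
proof (rule bij_betw_imageI)
  show "inj_on (sym_of_coords n) (sym_index n \<rightarrow>\<^sub>E UNIV)"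
  proof (rule inj_onI)
    fix x y
    assume x: "x \<in> sym_index n \<rightarrow>\<^sub>E (UNIV :: real set)" and y: "y \<in> sym_index n \<rightarrow>\<^sub>E UNIV"
      and eq: "sym_of_coords n x = sym_of_coords n y"
    show "x = y"
    proof (rule PiE_ext[OF x y])
      fix p
      assume "p \<in> sym_index n"
      then obtain i j where p: "p = (i, j)" "i \<le> j" "j < n"
        by (auto simp: sym_index_def)
      have "sym_of_coords n x $$ (i, j) = sym_of_coords n y $$ (i, j)"
        using eq by simp
      then show "x p = y p"
        using p by (simp add: sym_of_coords_index min_def max_def split: if_splits)
    qed
  qed
  show "sym_of_coords n ` (sym_index n \<rightarrow>\<^sub>E UNIV) = Sym n"
  proof (intro equalityI subsetI)
    fix A
    assume "A \<in> sym_of_coords n ` (sym_index n \<rightarrow>\<^sub>E UNIV)"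
    then obtain x where A: "A = sym_of_coords n x"
      by blast
    have d: "dim_row A = n" "dim_col A = n"
      by (simp_all add: A sym_of_coords_def)
    then show "A \<in> Sym n"
      by (auto simp: Sym_def A sym_of_coords_index min.commute max.commute intro!: eq_matI)
  next
    fix A
    assume "A \<in> Sym n"
    then have d: "dim_row A = n" "dim_col A = n" and t: "transpose_mat A = A"
      by (auto simp: Sym_def)
    have s: "A $$ (i, j) = A $$ (j, i)" if "i < n" "j < n" for i j
      using that d t by (metis index_transpose_mat(1))
    define x where
      "x = restrict (\<lambda>(i, j). if i = j then A $$ (i, i) / sqrt 2 else A $$ (i, j)) (sym_index n)"
    have "A = sym_of_coords n x"
    proof (rule eq_matI)
      fix i j
      assume "i < dim_row (sym_of_coords n x)" "j < dim_col (sym_of_coords n x)"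
      then have "i < n" "j < n"
        by (simp_all add: sym_of_coords_def)
      then show "A $$ (i, j) = sym_of_coords n x $$ (i, j)"
        using s by (auto simp: sym_of_coords_index x_def sym_index_def min_def max_def)
    qed (simp_all add: d sym_of_coords_def)
    moreover have "x \<in> sym_index n \<rightarrow>\<^sub>E UNIV"
      by (simp add: x_def)
    ultimately show "A \<in> sym_of_coords n ` (sym_index n \<rightarrow>\<^sub>E UNIV)"
      by blast
  qed
qed

lemma space_gauss_sym: "space (gauss_sym n) = Sym n"
  using bij_sym_of_coords[of n]
  by (simp add: gauss_sym_def sym_lebesgue_def space_embed_measure space_PiM bij_betw_def)

end

theory Submission
  imports Defs "HOL-Probability.Distributions" "HOL-Real_Asymp.Real_Asymp"
begin

text \<open>
Write \<open>S\<close> for a random matrix with law \<^const>\<open>gauss_sym\<close>, of size \<open>n\<close>. Its entries on and above the diagonal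
are independent centred Gaussians, of variance 1 on the diagonal and 1/2 off it, and its law is
invariant under conjugation by orthogonal matrices. The idea is to express \<open>E |det S|\<close> by weighted
second moments of the determinant, which orthogonal invariance makes computable.

\<^bold>\<open>Removing the absolute value.\<close> For invertible \<open>S\<close> the integral of \<open>exp (- |S y|\<^sup>2)\<close> over \<open>y\<close> in
\<open>n\<close>-space is \<open>pi^(n/2) / |det S|\<close>, so \<open>|det S|\<close> is, up to a constant, the integral over \<open>y\<close> of
\<open>(det S)\<^sup>2 exp (- |S y|\<^sup>2)\<close>. After exchanging the integrals, orthogonal invariance allows \<open>y\<close> to be
replaced by \<open>|y|\<close> times the last basis vector, so that \<open>|S y|\<^sup>2\<close> becomes \<open>|y|\<^sup>2 T\<close>, where \<open>T\<close> is the
squared norm of the last column of \<open>S\<close>. Integrating over \<open>y\<close> again gives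
\<open>E |det S| = E ((det S)\<^sup>2 / T^(n/2))\<close> (\<open>nn_integral_abs_det_eq\<close>), and the Gamma integral turns
\<open>T^(- n/2)\<close> into a superposition of the functions \<open>exp (- u T)\<close>.

\<^bold>\<open>Second moments.\<close> Split off the last row and column of \<open>S\<close>: let \<open>B\<close> be the leading block, \<open>v\<close> the rest
of the last column and \<open>a\<close> the corner entry. Then \<open>det S = a det B + W\<close>, where \<open>W\<close> is the determinant
with the corner replaced by 0, and \<open>T = a\<^sup>2 + |v|\<^sup>2\<close>. The cross term \<open>a det B * W\<close> disappears by
symmetry in \<open>a\<close>. Rotating \<open>v\<close> into the last axis shows that for fixed \<open>v\<close> the mean of \<open>W\<^sup>2\<close> is
\<open>|v|\<^sup>4\<close> times the second moment \<open>p (n - 2)\<close> of the determinant in size \<open>n - 2\<close>. What is left are moments of \<open>a\<close> and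
\<open>|v|\<^sup>2\<close> (\<open>nn_integral_det_sq_exp_border\<close>); at \<open>u = 0\<close> they give the recurrence
\<open>p n = p (n - 1) + (n\<^sup>2 - 1)/4 * p (n - 2)\<close>.

\<^bold>\<open>The integral over u.\<close> Everything is now expressed through the numbers \<open>kern_int n\<close>, which satisfy
\<open>n * kern_int n + (n - 1) * kern_int (n + 2) = sqrt 2\<close> because the corresponding combination of
integrands has an explicit primitive. Eliminating the larger indices leaves
\<open>e_R n * Gamma (n/2) = kern_int n * (p n - n (n + 2)/4 * p (n - 2)) + 3 sqrt 2/4 * p (n - 2)\<close>
(\<open>e_R_reduced\<close>). For odd \<open>n\<close> the coefficient of \<open>kern_int n\<close> vanishes, which is why the value is a
single Gamma factor. For even \<open>n\<close> it does not; the recurrence for \<open>kern_int\<close> then turns into a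
two-step recurrence for \<open>e_R\<close>, whose solution is the alternating sum. In this case the term with
\<open>kern_int n\<close> is smaller than the other one by a factor of order \<open>1/n\<close> at most, and log-convexity of the Gamma
function bounds what remains, so that the quotient in the asymptotic statement lies between
\<open>1 - 1/n\<close> and \<open>n/(n - 1)\<close>.
\<close>

section \<open>Products of Gaussian measures and their invariance under isometries\<close>

text \<open>
The law of a coefficient with respect to \<^const>\<open>sym_basis\<close>: the centred normal law of variance 1/2.
\<close>
definition gauss :: "real measure" where
  "gauss = density lborel (\<lambda>x. ennreal (exp (- x\<^sup>2) / sqrt pi))"

definition gauss_PiM :: "'i set \<Rightarrow> ('i \<Rightarrow> real) measure" where
  "gauss_PiM I = (\<Pi>\<^sub>M i\<in>I. gauss)"

lemma sets_gauss [measurable_cong, simp]: "sets gauss = sets borel"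
  by (simp add: gauss_def)

lemma space_gauss [simp]: "space gauss = UNIV"
  by (simp add: gauss_def)

lemma gauss_eq_normal: "gauss = density lborel (\<lambda>x. ennreal (normal_density 0 (sqrt (1/2)) x))"
  by (simp add: gauss_def normal_density_def real_sqrt_divide field_simps)

lemma prob_space_gauss: "prob_space gauss"
  unfolding gauss_eq_normal by (rule prob_space_normal_density) simp

interpretation gauss: prob_space gauss
  by (rule prob_space_gauss)

interpretation gauss_prod: product_sigma_finite "\<lambda>_. gauss"
  by standard

interpretation lborel_prod: product_sigma_finite "\<lambda>_. lborel :: real measure"
  by standard

lemma sets_gauss_PiM [measurable_cong]: "sets (gauss_PiM I) = sets (\<Pi>\<^sub>M i\<in>I. borel)"
  unfolding gauss_PiM_def by (intro sets_PiM_cong) auto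

lemma prob_space_gauss_PiM: "prob_space (gauss_PiM I)"
  unfolding gauss_PiM_def by (rule prob_space_PiM) (rule prob_space_gauss)

text \<open>
The product form expresses independence of the coordinates; the density form exhibits the dependence on
the norm alone, from which invariance under isometries follows.
\<close>
lemma gauss_PiM_density:
  assumes "finite I"
  shows "gauss_PiM I = density (\<Pi>\<^sub>M i\<in>I. lborel)
           (\<lambda>x. ennreal (exp (- (\<Sum>i\<in>I. (x i)\<^sup>2)) / sqrt pi ^ card I))" (is "_ = ?D")
  unfolding gauss_PiM_def
proof (rule gauss_prod.PiM_eqI[symmetric])
  show "finite I" by fact
  show "sets ?D = sets (\<Pi>\<^sub>M i\<in>I. gauss)"
    unfolding sets_density by (intro sets_PiM_cong) auto
next
  fix A assume "\<And>i. i \<in> I \<Longrightarrow> A i \<in> sets gauss"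
  then have [measurable]: "\<And>i. i \<in> I \<Longrightarrow> A i \<in> sets borel" by simp
  have box: "Pi\<^sub>E I A \<in> sets (\<Pi>\<^sub>M i\<in>I. lborel)"
    using assms by (intro sets_PiM_I_finite) auto
  have "emeasure ?D (Pi\<^sub>E I A) =
          (\<integral>\<^sup>+x. ennreal (exp (- (\<Sum>i\<in>I. (x i)\<^sup>2)) / sqrt pi ^ card I) * indicator (Pi\<^sub>E I A) x \<partial>(\<Pi>\<^sub>M i\<in>I. lborel))"
    using box by (subst emeasure_density) auto
  also have "\<dots> = (\<integral>\<^sup>+x. (\<Prod>i\<in>I. ennreal (exp (- (x i)\<^sup>2) / sqrt pi) * indicator (A i) (x i)) \<partial>(\<Pi>\<^sub>M i\<in>I. lborel))"
  proof (rule nn_integral_cong)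
    fix x assume "x \<in> space (\<Pi>\<^sub>M i\<in>I. lborel :: real measure)"
    then have "indicator (Pi\<^sub>E I A) x = (\<Prod>i\<in>I. indicator (A i) (x i) :: ennreal)"
      using assms by (auto simp: indicator_def space_PiM PiE_def Pi_iff prod_zero_iff)
    moreover have "exp (- (\<Sum>i\<in>I. (x i)\<^sup>2)) / sqrt pi ^ card I = (\<Prod>i\<in>I. exp (- (x i)\<^sup>2) / sqrt pi)"
      using assms by (simp add: prod_dividef exp_sum sum_negf[symmetric])
    ultimately show "ennreal (exp (- (\<Sum>i\<in>I. (x i)\<^sup>2)) / sqrt pi ^ card I) * indicator (Pi\<^sub>E I A) x
        = (\<Prod>i\<in>I. ennreal (exp (- (x i)\<^sup>2) / sqrt pi) * indicator (A i) (x i))"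
      by (simp add: prod.distrib prod_ennreal)
  qed
  also have "\<dots> = (\<Prod>i\<in>I. \<integral>\<^sup>+x. ennreal (exp (- x\<^sup>2) / sqrt pi) * indicator (A i) x \<partial>lborel)"
    using assms by (intro lborel_prod.product_nn_integral_prod) auto
  also have "\<dots> = (\<Prod>i\<in>I. emeasure gauss (A i))"
    unfolding gauss_def by (intro prod.cong refl) (subst emeasure_density; auto)
  finally show "emeasure ?D (Pi\<^sub>E I A) = (\<Prod>i\<in>I. emeasure gauss (A i))" .
qed

lemma nn_integral_gauss_PiM:
  assumes "finite I" and [measurable]: "f \<in> borel_measurable (\<Pi>\<^sub>M i\<in>I. borel)"
  shows "(\<integral>\<^sup>+x. f x \<partial>gauss_PiM I) =
    (\<integral>\<^sup>+x. ennreal (exp (- (\<Sum>i\<in>I. (x i)\<^sup>2)) / sqrt pi ^ card I) * f x \<partial>(\<Pi>\<^sub>M i\<in>I. lborel))"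
  unfolding gauss_PiM_density[OF assms(1)] 
  by (subst nn_integral_density) (auto cong: measurable_cong_sets sets_PiM_cong)

lemma nn_integral_PiM_lborel_translate:
  assumes "finite I" and f [measurable]: "f \<in> borel_measurable (\<Pi>\<^sub>M i\<in>I. borel)"
  shows "(\<integral>\<^sup>+x. f (\<lambda>i\<in>I. x i + a i) \<partial>(\<Pi>\<^sub>M i\<in>I. lborel)) = (\<integral>\<^sup>+x. f x \<partial>(\<Pi>\<^sub>M i\<in>I. (lborel :: real measure)))"
proof -
  let ?L = "\<Pi>\<^sub>M i\<in>I. (lborel :: real measure)" and ?t = "\<lambda>x. \<lambda>i\<in>I. x i + a i"
  have s: "sets ?L = sets (\<Pi>\<^sub>M i\<in>I. borel)" by (intro sets_PiM_cong) auto
  have t [measurable]: "?t \<in> measurable ?L ?L" by measurable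
  have "distr ?L ?L ?t = ?L"
  proof (rule lborel_prod.PiM_eqI)
    fix A assume A: "\<And>i. i \<in> I \<Longrightarrow> A i \<in> sets (lborel :: real measure)"
    have A': "(\<lambda>y. y + a i) -` A i \<in> sets borel" if "i \<in> I" for i
      using A[OF that] measurable_sets[of "\<lambda>y. y + a i" borel borel "A i"] by simp
    have "?t -` Pi\<^sub>E I A \<inter> space ?L = Pi\<^sub>E I (\<lambda>i. (\<lambda>y. y + a i) -` A i)"
      by (auto simp: space_PiM PiE_def Pi_iff)
    then have "emeasure (distr ?L ?L ?t) (Pi\<^sub>E I A) = emeasure ?L (Pi\<^sub>E I (\<lambda>i. (\<lambda>y. y + a i) -` A i))"
      using A assms(1) by (subst emeasure_distr) (auto intro!: sets_PiM_I_finite)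
    also have "\<dots> = (\<Prod>i\<in>I. emeasure lborel ((\<lambda>y. y + a i) -` A i))"
      using A' assms(1) by (intro lborel_prod.emeasure_PiM) auto
    also have "\<dots> = (\<Prod>i\<in>I. emeasure lborel (A i))"
    proof (intro prod.cong refl)
      fix i assume i: "i \<in> I"
      have "emeasure lborel (A i) = emeasure (distr lborel borel ((+) (a i))) (A i)"
        by (simp only: lborel_distr_plus)
      also have "\<dots> = emeasure lborel ((+) (a i) -` A i)"
        using A[OF i] by (subst emeasure_distr) auto
      finally show "emeasure lborel ((\<lambda>y. y + a i) -` A i) = emeasure lborel (A i)"
        by (simp add: add.commute vimage_def)
    qed
    finally show "emeasure (distr ?L ?L ?t) (Pi\<^sub>E I A) = (\<Prod>i\<in>I. emeasure lborel (A i))" .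
  qed (use assms in auto)
  then have "(\<integral>\<^sup>+x. f x \<partial>?L) = (\<integral>\<^sup>+x. f x \<partial>distr ?L ?L ?t)" by simp
  also have "\<dots> = (\<integral>\<^sup>+x. f (?t x) \<partial>?L)"
    by (rule nn_integral_distr) (use f s in \<open>auto cong: measurable_cong_sets\<close>)
  finally show ?thesis by simp
qed

text \<open>
The uniqueness argument for Haar measure: with \<open>g x = exp (- |x|\<^sup>2)\<close>, integrate \<open>f (T x) g y\<close> over both variables. Translating \<open>x\<close>
by a preimage of \<open>y\<close> and then \<open>y\<close> by \<open>- T x\<close> moves \<open>T\<close> from \<open>f\<close> into \<open>g\<close>, where it is absorbed because
\<open>g\<close> depends only on the norm. Both sides carry the same factor, the finite positive integral of \<open>g\<close>.
\<close>
lemma nn_integral_PiM_lborel_isometry: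
  fixes T :: "('i \<Rightarrow> real) \<Rightarrow> 'i \<Rightarrow> real"
  assumes fin: "finite I"
    and T [measurable]: "T \<in> measurable (\<Pi>\<^sub>M i\<in>I. borel) (\<Pi>\<^sub>M i\<in>I. borel)"
    and add: "\<And>x y. x \<in> I \<rightarrow>\<^sub>E UNIV \<Longrightarrow> y \<in> I \<rightarrow>\<^sub>E UNIV \<Longrightarrow> T (\<lambda>i\<in>I. x i + y i) = (\<lambda>i\<in>I. T x i + T y i)"
    and onto: "\<And>y. y \<in> I \<rightarrow>\<^sub>E UNIV \<Longrightarrow> \<exists>x \<in> I \<rightarrow>\<^sub>E UNIV. T x = y"
    and norm: "\<And>x. x \<in> I \<rightarrow>\<^sub>E UNIV \<Longrightarrow> (\<Sum>i\<in>I. (T x i)\<^sup>2) = (\<Sum>i\<in>I. (x i)\<^sup>2)"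
    and f [measurable]: "f \<in> borel_measurable (\<Pi>\<^sub>M i\<in>I. borel)"
  shows "(\<integral>\<^sup>+x. f (T x) \<partial>(\<Pi>\<^sub>M i\<in>I. lborel)) = (\<integral>\<^sup>+x. f x \<partial>(\<Pi>\<^sub>M i\<in>I. lborel))"
proof -
  let ?L = "\<Pi>\<^sub>M i\<in>I. (lborel :: real measure)"
  let ?B = "\<Pi>\<^sub>M i\<in>I. (borel :: real measure)"
  have s [measurable_cong]: "sets ?L = sets ?B" by (intro sets_PiM_cong) auto
  interpret L: sigma_finite_measure ?L by (rule lborel_prod.sigma_finite[OF fin])
  interpret LL: pair_sigma_finite ?L ?L ..
  define g :: "('i \<Rightarrow> real) \<Rightarrow> ennreal" where "g x = ennreal (exp (- (\<Sum>i\<in>I. (x i)\<^sup>2)))" for x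
  have g [measurable]: "g \<in> borel_measurable ?B" unfolding g_def by measurable
  define C where "C = (\<integral>\<^sup>+x. g x \<partial>?L)"
  have spL: "space ?L = I \<rightarrow>\<^sub>E UNIV" by (simp add: space_PiM)
  have Tsp: "T x \<in> I \<rightarrow>\<^sub>E UNIV" if "x \<in> I \<rightarrow>\<^sub>E UNIV" for x
    using measurable_space[OF T, of x] that by (simp add: space_PiM)
  \<comment> \<open>finite and positive, so it can be cancelled at the end\<close>
  have C: "C = ennreal (sqrt pi ^ card I)"
  proof -
    interpret prob_space "gauss_PiM I" by (rule prob_space_gauss_PiM)
    have "1 = (\<integral>\<^sup>+x. 1 \<partial>gauss_PiM I)" by (simp add: emeasure_space_1)
    also have "\<dots> = (\<integral>\<^sup>+x. ennreal (exp (- (\<Sum>i\<in>I. (x i)\<^sup>2)) / sqrt pi ^ card I) * 1 \<partial>?L)"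
      using fin by (subst nn_integral_gauss_PiM) auto
    also have "\<dots> = (\<integral>\<^sup>+x. ennreal (1 / sqrt pi ^ card I) * g x \<partial>?L)"
      by (simp add: g_def flip: ennreal_mult)
    also have "\<dots> = ennreal (1 / sqrt pi ^ card I) * C"
      unfolding C_def by (rule nn_integral_cmult) measurable
    finally have *: "1 = ennreal (1 / sqrt pi ^ card I) * C" .
    have "C = ennreal (sqrt pi ^ card I) * (ennreal (1 / sqrt pi ^ card I) * C)"
      by (simp add: mult.assoc[symmetric] ennreal_mult[symmetric])
    then show ?thesis using * by simp
  qed
  have zero: "T (\<lambda>i\<in>I. 0) = (\<lambda>i\<in>I. 0)"
  proof
    fix i
    let ?z = "\<lambda>i\<in>I. 0 :: real"
    have "(\<lambda>i\<in>I. ?z i + ?z i) = ?z" by (auto simp: restrict_def)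
    then have "T ?z = (\<lambda>i\<in>I. T ?z i + T ?z i)" using add[of ?z ?z] by simp
    then have e: "T ?z i = (\<lambda>i\<in>I. T ?z i + T ?z i) i" by (rule fun_cong)
    have "T ?z \<in> I \<rightarrow>\<^sub>E UNIV" by (rule Tsp) auto
    then show "T ?z i = ?z i" using e by (cases "i \<in> I") (auto simp: PiE_def extensional_def)
  qed
  have neg: "T (\<lambda>i\<in>I. - x i) = (\<lambda>i\<in>I. - T x i)" if x: "x \<in> I \<rightarrow>\<^sub>E UNIV" for x
  proof
    fix i
    have "T (\<lambda>i\<in>I. x i + (\<lambda>i\<in>I. - x i) i) = (\<lambda>i\<in>I. T x i + T (\<lambda>i\<in>I. - x i) i)"
      using x by (intro add) auto
    moreover have "(\<lambda>i\<in>I. x i + (\<lambda>i\<in>I. - x i) i) = (\<lambda>i\<in>I. 0)" by (auto simp: restrict_def)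
    ultimately have e: "(\<lambda>i\<in>I. 0) = (\<lambda>i\<in>I. T x i + T (\<lambda>i\<in>I. - x i) i)" using zero by simp
    show "T (\<lambda>i\<in>I. - x i) i = (\<lambda>i\<in>I. - T x i) i"
    proof (cases "i \<in> I")
      case True
      then show ?thesis using fun_cong[OF e, of i] by simp
    next
      case False
      have "T (\<lambda>i\<in>I. - x i) \<in> I \<rightarrow>\<^sub>E UNIV" by (rule Tsp) auto
      then show ?thesis using False by (auto simp: PiE_def extensional_def)
    qed
  qed
  have "(\<integral>\<^sup>+x. f (T x) \<partial>?L) * C = (\<integral>\<^sup>+y. (\<integral>\<^sup>+x. f (T x) \<partial>?L) * g y \<partial>?L)"
    unfolding C_def by (rule nn_integral_cmult[symmetric]) measurable
  also have "\<dots> = (\<integral>\<^sup>+y. \<integral>\<^sup>+x. f (\<lambda>i\<in>I. y i + T x i) * g y \<partial>?L \<partial>?L)"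
  proof (rule nn_integral_cong)
    fix y assume "y \<in> space ?L"
    then obtain z where z: "z \<in> I \<rightarrow>\<^sub>E UNIV" "T z = y" using onto spL by blast
    have "(\<integral>\<^sup>+x. f (T x) \<partial>?L) = (\<integral>\<^sup>+x. f (T (\<lambda>i\<in>I. x i + z i)) \<partial>?L)"
      using fin by (intro nn_integral_PiM_lborel_translate[symmetric, of I "\<lambda>x. f (T x)" z]) measurable
    also have "\<dots> = (\<integral>\<^sup>+x. f (\<lambda>i\<in>I. y i + T x i) \<partial>?L)"
      using z by (intro nn_integral_cong) (simp add: add spL add.commute)
    finally show "(\<integral>\<^sup>+x. f (T x) \<partial>?L) * g y = (\<integral>\<^sup>+x. f (\<lambda>i\<in>I. y i + T x i) * g y \<partial>?L)"
      by (simp add: nn_integral_multc)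
  qed
  also have "\<dots> = (\<integral>\<^sup>+x. \<integral>\<^sup>+y. f (\<lambda>i\<in>I. y i + T x i) * g y \<partial>?L \<partial>?L)"
    by (rule LL.Fubini') measurable
  also have "\<dots> = (\<integral>\<^sup>+x. \<integral>\<^sup>+y. f y * g (\<lambda>i\<in>I. y i - T x i) \<partial>?L \<partial>?L)"
  proof (rule nn_integral_cong)
    fix x assume "x \<in> space ?L"
    have "(\<integral>\<^sup>+y. f y * g (\<lambda>i\<in>I. y i - T x i) \<partial>?L) =
       (\<integral>\<^sup>+y. f (\<lambda>i\<in>I. y i + T x i) * g (\<lambda>i\<in>I. (\<lambda>i\<in>I. y i + T x i) i - T x i) \<partial>?L)"
      using fin by (intro nn_integral_PiM_lborel_translate[symmetric, of I "\<lambda>y. f y * g (\<lambda>i\<in>I. y i - T x i)" "T x"]) measurable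
    also have "\<dots> = (\<integral>\<^sup>+y. f (\<lambda>i\<in>I. y i + T x i) * g y \<partial>?L)"
      by (simp add: g_def)
    finally show "(\<integral>\<^sup>+y. f (\<lambda>i\<in>I. y i + T x i) * g y \<partial>?L) = (\<integral>\<^sup>+y. f y * g (\<lambda>i\<in>I. y i - T x i) \<partial>?L)" by simp
  qed
  also have "\<dots> = (\<integral>\<^sup>+y. \<integral>\<^sup>+x. f y * g (\<lambda>i\<in>I. y i - T x i) \<partial>?L \<partial>?L)"
    by (rule LL.Fubini') measurable
  also have "\<dots> = (\<integral>\<^sup>+y. f y * C \<partial>?L)"
  proof (rule nn_integral_cong)
    fix y assume "y \<in> space ?L"
    then obtain z where z: "z \<in> I \<rightarrow>\<^sub>E UNIV" "T z = y" using onto spL by blast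
    have "(\<integral>\<^sup>+x. g (\<lambda>i\<in>I. y i - T x i) \<partial>?L) = (\<integral>\<^sup>+x. g (\<lambda>i\<in>I. x i + - z i) \<partial>?L)"
    proof (rule nn_integral_cong)
      fix x assume "x \<in> space ?L"
      then have x: "x \<in> I \<rightarrow>\<^sub>E UNIV" using spL by simp
      have "T (\<lambda>i\<in>I. z i + (\<lambda>i\<in>I. - x i) i) = (\<lambda>i\<in>I. T z i + T (\<lambda>i\<in>I. - x i) i)"
        using z x by (intro add) auto
      also have "\<dots> = (\<lambda>i\<in>I. y i - T x i)" unfolding neg[OF x] using z by (auto simp: fun_eq_iff)
      finally have "(\<Sum>i\<in>I. ((\<lambda>i\<in>I. y i - T x i) i)\<^sup>2) = (\<Sum>i\<in>I. ((\<lambda>i\<in>I. z i + (\<lambda>i\<in>I. - x i) i) i)\<^sup>2)"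
        using norm[of "\<lambda>i\<in>I. z i + (\<lambda>i\<in>I. - x i) i"] by simp
      also have "\<dots> = (\<Sum>i\<in>I. ((\<lambda>i\<in>I. x i + - z i) i)\<^sup>2)"
        by (intro sum.cong) (auto simp: power2_commute)
      finally show "g (\<lambda>i\<in>I. y i - T x i) = g (\<lambda>i\<in>I. x i + - z i)" unfolding g_def by simp
    qed
    also have "\<dots> = C" unfolding C_def
      using fin by (intro nn_integral_PiM_lborel_translate[of I g "\<lambda>i. - z i"]) measurable
    finally have "(\<integral>\<^sup>+x. g (\<lambda>i\<in>I. y i - T x i) \<partial>?L) = C" .
    then show "(\<integral>\<^sup>+x. f y * g (\<lambda>i\<in>I. y i - T x i) \<partial>?L) = f y * C"
      by (subst nn_integral_cmult) auto
  qed
  also have "\<dots> = (\<integral>\<^sup>+y. f y \<partial>?L) * C"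
    by (rule nn_integral_multc) measurable
  finally have e: "(\<integral>\<^sup>+x. f (T x) \<partial>?L) * C = (\<integral>\<^sup>+y. f y \<partial>?L) * C" .
  have "C \<noteq> 0" "C \<noteq> \<infinity>" by (auto simp: C)
  then have "a = a * C / C" for a by (simp add: ennreal_mult_divide_eq)
  then show ?thesis using e by metis
qed

lemma nn_integral_gauss_PiM_isometry:
  fixes T :: "('i \<Rightarrow> real) \<Rightarrow> 'i \<Rightarrow> real"
  assumes fin: "finite I"
    and T [measurable]: "T \<in> measurable (\<Pi>\<^sub>M i\<in>I. borel) (\<Pi>\<^sub>M i\<in>I. borel)"
    and add: "\<And>x y. x \<in> I \<rightarrow>\<^sub>E UNIV \<Longrightarrow> y \<in> I \<rightarrow>\<^sub>E UNIV \<Longrightarrow> T (\<lambda>i\<in>I. x i + y i) = (\<lambda>i\<in>I. T x i + T y i)"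
    and onto: "\<And>y. y \<in> I \<rightarrow>\<^sub>E UNIV \<Longrightarrow> \<exists>x \<in> I \<rightarrow>\<^sub>E UNIV. T x = y"
    and norm: "\<And>x. x \<in> I \<rightarrow>\<^sub>E UNIV \<Longrightarrow> (\<Sum>i\<in>I. (T x i)\<^sup>2) = (\<Sum>i\<in>I. (x i)\<^sup>2)"
    and f [measurable]: "f \<in> borel_measurable (\<Pi>\<^sub>M i\<in>I. borel)"
  shows "(\<integral>\<^sup>+x. f (T x) \<partial>gauss_PiM I) = (\<integral>\<^sup>+x. f x \<partial>gauss_PiM I)"
proof -
  let ?L = "\<Pi>\<^sub>M i\<in>I. (lborel :: real measure)"
  let ?w = "\<lambda>x. ennreal (exp (- (\<Sum>i\<in>I. (x i)\<^sup>2)) / sqrt pi ^ card I)"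
  have "(\<integral>\<^sup>+x. f (T x) \<partial>gauss_PiM I) = (\<integral>\<^sup>+x. ?w x * f (T x) \<partial>?L)"
    using fin by (rule nn_integral_gauss_PiM) measurable
  also have "\<dots> = (\<integral>\<^sup>+x. ?w (T x) * f (T x) \<partial>?L)"
    by (intro nn_integral_cong) (simp add: norm space_PiM)
  also have "\<dots> = (\<integral>\<^sup>+x. ?w x * f x \<partial>?L)"
    by (rule nn_integral_PiM_lborel_isometry[OF fin T add onto norm, of "\<lambda>x. ?w x * f x"]) measurable
  also have "\<dots> = (\<integral>\<^sup>+x. f x \<partial>gauss_PiM I)"
    using fin by (rule nn_integral_gauss_PiM[symmetric]) measurable
  finally show ?thesis .
qed

section \<open>Reflections and bordered symmetric matrices\<close>

\<comment> \<open>from here on these symbols denote the scalar product and the indexing of vectors of explicit dimension\<close>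
no_notation inner (infix "\<bullet>" 70)
no_notation vec_nth (infixl "$" 90)

text \<open>
Symmetric orthogonal matrices. Since they are their own inverses, conjugation of \<open>A\<close> by \<open>Q\<close> is simply
\<open>Q * A * Q\<close>.
\<close>
definition is_reflection :: "nat \<Rightarrow> real mat \<Rightarrow> bool" where
  "is_reflection n Q \<longleftrightarrow> Q \<in> carrier_mat n n \<and> Q\<^sup>T = Q \<and> Q * Q = 1\<^sub>m n"

lemma is_reflectionD:
  assumes "is_reflection n Q"
  shows "Q \<in> carrier_mat n n" "Q\<^sup>T = Q" "Q * Q = 1\<^sub>m n"
  using assms by (auto simp: is_reflection_def)

text \<open>
The Householder reflection in the hyperplane orthogonal to \<open>w = v - |v| e\<close>, where \<open>e\<close> is the axis. It
exchanges \<open>v\<close> and \<open>|v| e\<close> because these two vectors have the same norm.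
\<close>
lemma ex_reflection_to_axis:
  fixes v :: "real vec"
  assumes v: "v \<in> carrier_vec n" and k: "k < n"
  shows "\<exists>Q. is_reflection n Q \<and> Q *\<^sub>v v = sqrt (v \<bullet> v) \<cdot>\<^sub>v unit_vec n k"
proof -
  define r where "r = sqrt (v \<bullet> v)"
  define w where "w = (\<lambda>i. v $ i - (if i = k then r else 0))"
  define s where "s = (\<Sum>i<n. (w i)\<^sup>2)"
  have vv: "v \<bullet> v = (\<Sum>i<n. (v $ i)\<^sup>2)"
    using v by (simp add: scalar_prod_def power2_eq_square atLeast0LessThan)
  then have r2: "r\<^sup>2 = (\<Sum>i<n. (v $ i)\<^sup>2)"
    unfolding r_def by (simp add: sum_nonneg)
  show ?thesis
  proof (cases "s = 0")
    case True
    then have w0: "w i = 0" if "i < n" for i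
      using that by (simp add: s_def sum_nonneg_eq_0_iff)
    have "v = r \<cdot>\<^sub>v unit_vec n k"
      using v k w0 by (intro eq_vecI) (auto simp: w_def split: if_splits)
    then show ?thesis
      using v by (intro exI[of _ "1\<^sub>m n"]) (auto simp: is_reflection_def r_def)
  next
    case False
    \<comment> \<open>twice the inner product of \<open>w\<close> and \<open>v\<close> is \<open>|w|\<^sup>2\<close>, so the reflection maps \<open>v\<close> to \<open>v - w\<close>\<close>
  have wv: "2 * (\<Sum>i<n. w i * v $ i) = s"
    proof -
      have "s = (\<Sum>i<n. (v $ i)\<^sup>2 - (if i = k then 2 * r * v $ i else 0) + (if i = k then r\<^sup>2 else 0))"
        unfolding s_def w_def by (intro sum.cong) (auto simp: power2_diff)
      also have "\<dots> = r\<^sup>2 - 2 * r * v $ k + r\<^sup>2"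
        using k by (simp add: sum.distrib sum_subtractf r2)
      also have "\<dots> = 2 * (\<Sum>i<n. (v $ i)\<^sup>2 - (if i = k then r * v $ i else 0))"
        using k by (simp add: sum_subtractf r2)
      also have "\<dots> = 2 * (\<Sum>i<n. w i * v $ i)"
        unfolding w_def by (intro arg_cong[of _ _ "(*) 2"] sum.cong) (auto simp: power2_eq_square algebra_simps)
      finally show ?thesis by simp
    qed
    define Q where "Q = mat n n (\<lambda>(i, j). (if i = j then 1 else 0) - 2 / s * w i * w j)"
    have Q: "Q \<in> carrier_mat n n" by (simp add: Q_def)
    have "Q * Q = 1\<^sub>m n"
    proof (rule eq_matI)
      fix i j assume "i < dim_row (1\<^sub>m n)" "j < dim_col (1\<^sub>m n)"
      then have ij: "i < n" "j < n" by auto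
      have "(Q * Q) $$ (i, j) = (\<Sum>l<n. ((if i = l then 1 else 0) - 2 / s * w i * w l) * ((if l = j then 1 else 0) - 2 / s * w l * w j))"
        using ij by (simp add: Q_def scalar_prod_def atLeast0LessThan)
      also have "\<dots> = (\<Sum>l<n. (if i = l then (if l = j then 1 else 0) - 2 / s * w l * w j else 0)
           - (if l = j then 2 / s * w i * w l else 0) + (2 / s)\<^sup>2 * w i * w j * (w l)\<^sup>2)"
        by (intro sum.cong) (auto simp: algebra_simps power2_eq_square)
      also have "\<dots> = (if i = j then 1 else 0) - 2 / s * w i * w j - 2 / s * w i * w j + (2 / s)\<^sup>2 * w i * w j * s"
        using ij by (simp add: sum.distrib sum_subtractf s_def sum_distrib_left)
      also have "\<dots> = (if i = j then 1 else 0)"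
        using False by (simp add: power2_eq_square)
      finally show "(Q * Q) $$ (i, j) = 1\<^sub>m n $$ (i, j)" using ij by simp
    qed (use Q in auto)
    moreover have "Q\<^sup>T = Q"
      by (intro eq_matI) (auto simp: Q_def)
    moreover have "Q *\<^sub>v v = r \<cdot>\<^sub>v unit_vec n k"
    proof (rule eq_vecI)
      fix i assume "i < dim_vec (r \<cdot>\<^sub>v unit_vec n k)"
      then have i: "i < n" by simp
      have "(Q *\<^sub>v v) $ i = (\<Sum>j<n. ((if i = j then 1 else 0) - 2 / s * w i * w j) * v $ j)"
        using i v by (simp add: Q_def scalar_prod_def atLeast0LessThan)
      also have "\<dots> = (\<Sum>j<n. (if i = j then v $ j else 0) - 2 / s * w i * (w j * v $ j))"
        by (intro sum.cong) (auto simp: algebra_simps)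
      also have "\<dots> = v $ i - w i / s * (2 * (\<Sum>j<n. w j * v $ j))"
        using i by (simp add: sum_subtractf sum_distrib_left sum_divide_distrib mult_ac)
      also have "\<dots> = v $ i - w i" unfolding wv using False by simp
      finally show "(Q *\<^sub>v v) $ i = (r \<cdot>\<^sub>v unit_vec n k) $ i"
        using i k by (auto simp: w_def)
    qed (use Q in auto)
    ultimately show ?thesis
      using Q by (intro exI[of _ Q]) (auto simp: is_reflection_def r_def)
  qed
qed

lemma det_reflection_sq:
  assumes "is_reflection n Q"
  shows "(Determinant.det Q)\<^sup>2 = 1"
  using det_mult[of Q n Q] is_reflectionD[OF assms] by (simp add: power2_eq_square)

lemma det_reflection_conj:
  assumes Q: "is_reflection n Q" and A: "A \<in> carrier_mat n n"
  shows "Determinant.det (Q * A * Q) = Determinant.det A"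
proof -
  note q = is_reflectionD(1)[OF Q]
  have "Determinant.det (Q * A * Q) = Determinant.det A * (Determinant.det Q)\<^sup>2"
    using q A by (simp add: det_mult[of _ n] power2_eq_square)
  then show ?thesis using det_reflection_sq[OF Q] by simp
qed

lemma sq_norm_reflection:
  assumes Q: "is_reflection n Q" and y: "y \<in> carrier_vec n"
  shows "(Q *\<^sub>v y) \<bullet> (Q *\<^sub>v y) = y \<bullet> y"
proof -
  note q = is_reflectionD[OF Q]
  have "(Q\<^sup>T *\<^sub>v y) \<bullet> (Q *\<^sub>v y) = y \<bullet> (Q *\<^sub>v (Q *\<^sub>v y))"
    using q(1) y by (intro transpose_vec_mult_scalar) auto
  also have "Q *\<^sub>v (Q *\<^sub>v y) = (Q * Q) *\<^sub>v y" using q(1) y by simp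
  finally show ?thesis using q y by simp
qed

definition bordered :: "nat \<Rightarrow> real mat \<Rightarrow> real vec \<Rightarrow> real \<Rightarrow> real mat" where
  "bordered n B v a = four_block_mat B (mat n 1 (\<lambda>(i, _). v $ i)) (mat 1 n (\<lambda>(_, j). v $ j)) (mat 1 1 (\<lambda>_. a))"

lemma bordered_carrier [simp]:
  assumes "B \<in> carrier_mat n n"
  shows "bordered n B v a \<in> carrier_mat (Suc n) (Suc n)"
  using four_block_carrier_mat[of B n n "mat 1 1 (\<lambda>_. a)" 1 1] assms unfolding bordered_def by simp

lemma bordered_dim [simp]:
  "dim_row (bordered n B v a) = Suc (dim_row B)" "dim_col (bordered n B v a) = Suc (dim_col B)"
  by (simp_all add: bordered_def)

lemma bordered_index:
  assumes "B \<in> carrier_mat n n" "i < Suc n" "j < Suc n"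
  shows "bordered n B v a $$ (i, j) =
    (if i < n then if j < n then B $$ (i, j) else v $ i else if j < n then v $ j else a)"
  using assms by (auto simp: bordered_def)

lemma sym_of_coords_carrier [simp]: "sym_of_coords n x \<in> carrier_mat n n"
  by (simp add: sym_of_coords_def)

lemma sym_of_coords_Suc:
  "sym_of_coords (Suc n) x = bordered n (sym_of_coords n x) (vec n (\<lambda>i. x (i, n))) (sqrt 2 * x (n, n))"
proof (rule eq_matI)
  let ?R = "bordered n (sym_of_coords n x) (vec n (\<lambda>i. x (i, n))) (sqrt 2 * x (n, n))"
  have c: "?R \<in> carrier_mat (Suc n) (Suc n)" by simp
  show "dim_row (sym_of_coords (Suc n) x) = dim_row ?R" "dim_col (sym_of_coords (Suc n) x) = dim_col ?R"
    by (simp_all add: sym_of_coords_def)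
  fix i j assume "i < dim_row ?R" "j < dim_col ?R"
  then have ij: "i < Suc n" "j < Suc n" by (simp_all add: sym_of_coords_def)
  then show "sym_of_coords (Suc n) x $$ (i, j) = ?R $$ (i, j)"
    by (auto simp: bordered_index sym_of_coords_index[of _ "Suc n"] sym_of_coords_index[of _ n]
        less_Suc_eq min_def max_def)
qed

text \<open>
Conjugate by the block diagonal reflection with blocks \<open>Q\<close> and 1.
\<close>
lemma det_bordered_conj:
  assumes Q: "is_reflection n Q" and B: "B \<in> carrier_mat n n" and v: "v \<in> carrier_vec n"
  shows "Determinant.det (bordered n (Q * B * Q) (Q *\<^sub>v v) a) = Determinant.det (bordered n B v a)"
proof -
  note q = is_reflectionD[OF Q]
  let ?c = "mat n 1 (\<lambda>(i, _). v $ i)" and ?r = "mat 1 n (\<lambda>(_, j). v $ j)" and ?a = "mat 1 1 (\<lambda>_. a)"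
  let ?E = "four_block_mat Q (0\<^sub>m n 1) (0\<^sub>m 1 n) (1\<^sub>m 1)"
  have E: "?E \<in> carrier_mat (Suc n) (Suc n)"
    using four_block_carrier_mat[of Q n n "1\<^sub>m 1" 1 1] q(1) by simp
  have "?E * ?E = four_block_mat (1\<^sub>m n) (0\<^sub>m n 1) (0\<^sub>m 1 n) (1\<^sub>m 1)"
    using q by (subst mult_four_block_mat[of _ n n _ 1 _ 1 _ _ n _ 1]) auto
  also have "\<dots> = 1\<^sub>m (Suc n)"
    by (rule eq_matI) auto
  finally have EE: "?E * ?E = 1\<^sub>m (Suc n)" .
  have ET: "?E\<^sup>T = ?E"
    using q by (subst transpose_four_block_mat[of _ n n _ 1 _ 1]) (auto simp: zero_transpose_mat)
  have refl: "is_reflection (Suc n) ?E"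
    using E EE ET by (simp add: is_reflection_def)
  have sym: "Q $$ (i, j) = Q $$ (j, i)" if "i < n" "j < n" for i j
    using that q(1,2) by (metis carrier_matD index_transpose_mat(1))
  have "?E * bordered n B v a * ?E = four_block_mat (Q * B * Q) (Q * ?c) (?r * Q) ?a"
  proof -
    have "?E * bordered n B v a = four_block_mat (Q * B) (Q * ?c) ?r ?a"
      unfolding bordered_def using q B
      by (subst mult_four_block_mat[of _ n n _ 1 _ 1 _ _ n _ 1]) (auto simp: left_add_zero_mat[of _ n n] left_add_zero_mat[of _ n 1] right_add_zero_mat[of _ n n] right_add_zero_mat[of _ n 1] left_add_zero_mat[of _ 1 n] left_add_zero_mat[of _ 1 1])
    also have "\<dots> * ?E = four_block_mat (Q * B * Q) (Q * ?c) (?r * Q) ?a"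
      using q B
      by (subst mult_four_block_mat[of _ n n _ 1 _ 1 _ _ n _ 1]) (auto simp: right_add_zero_mat[of _ n n] left_add_zero_mat[of _ n 1] right_add_zero_mat[of _ 1 n] left_add_zero_mat[of _ 1 1])
    finally show ?thesis .
  qed
  also have "Q * ?c = mat n 1 (\<lambda>(i, _). (Q *\<^sub>v v) $ i)"
    using q v by (intro eq_matI) (auto simp: scalar_prod_def)
  also have "?r * Q = mat 1 n (\<lambda>(_, j). (Q *\<^sub>v v) $ j)"
    using q v by (intro eq_matI) (auto simp: scalar_prod_def sym mult.commute intro!: sum.cong)
  finally have "?E * bordered n B v a * ?E = bordered n (Q * B * Q) (Q *\<^sub>v v) a"
    unfolding bordered_def .
  then show ?thesis
    using det_reflection_conj[OF refl, of "bordered n B v a"] B by simp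
qed

text \<open>
Expansion along the last row: the corner entry enters none of the cofactors of that row.
\<close>
lemma det_bordered_affine:
  assumes B: "B \<in> carrier_mat n n"
  shows "Determinant.det (bordered n B v a) = a * Determinant.det B + Determinant.det (bordered n B v 0)"
proof -
  have exp: "Determinant.det (bordered n B v c) =
      (\<Sum>j<Suc n. bordered n B v c $$ (n, j) * cofactor (bordered n B v c) n j)" for c
    using B by (intro laplace_expansion_row) auto
  have cof: "cofactor (bordered n B v a) n j = cofactor (bordered n B v 0) n j" for j
  proof -
    have "mat_delete (bordered n B v a) n j = mat_delete (bordered n B v 0) n j"
      using B by (intro eq_matI) (auto simp: mat_delete_def bordered_def)
    then show ?thesis by (simp add: cofactor_def)
  qed
  have "mat_delete (bordered n B v a) n n = B"
    using B by (intro eq_matI) (auto simp: mat_delete_def bordered_def)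
  then have nn: "cofactor (bordered n B v a) n n = Determinant.det B"
    by (simp add: cofactor_def power_add[symmetric])
  have "(\<Sum>j<n. bordered n B v a $$ (n, j) * cofactor (bordered n B v a) n j) =
        (\<Sum>j<n. bordered n B v 0 $$ (n, j) * cofactor (bordered n B v 0) n j)"
    using B by (intro sum.cong) (auto simp: bordered_index cof)
  then show ?thesis
    using B nn unfolding exp[of a] exp[of 0] by (simp add: bordered_index)
qed

text \<open>
When the border is a multiple of the last basis vector, the last row and the last column have one
nonzero entry each, and expanding along both leaves the determinant of the inner block.
\<close>
lemma det_bordered_axis:
  assumes C: "C \<in> carrier_mat k k"
  shows "Determinant.det (bordered (Suc k) (bordered k C u b) (t \<cdot>\<^sub>v unit_vec (Suc k) k) 0) = - (t\<^sup>2 * Determinant.det C)"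
proof -
  let ?A = "bordered (Suc k) (bordered k C u b) (t \<cdot>\<^sub>v unit_vec (Suc k) k) 0"
  have A: "?A \<in> carrier_mat (Suc (Suc k)) (Suc (Suc k))" using C by simp
  have "Determinant.det ?A = (\<Sum>j<Suc (Suc k). ?A $$ (Suc k, j) * cofactor ?A (Suc k) j)"
    using A by (intro laplace_expansion_row) auto
  also have "\<dots> = (\<Sum>j<Suc (Suc k). if j = k then t * cofactor ?A (Suc k) k else 0)"
    using C by (intro sum.cong) (auto simp: bordered_index)
  also have "\<dots> = t * cofactor ?A (Suc k) k" by simp
  also have "cofactor ?A (Suc k) k = - Determinant.det (mat_delete ?A (Suc k) k)"
    by (simp add: cofactor_def power_add[symmetric])
  also have "mat_delete ?A (Suc k) k = four_block_mat C (0\<^sub>m k 1) (mat 1 k (\<lambda>(_, j). u $ j)) (mat 1 1 (\<lambda>_. t))"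
    using C A by (intro eq_matI) (auto simp: mat_delete_def bordered_index)
  also have "Determinant.det \<dots> = Determinant.det C * Determinant.det (mat 1 1 (\<lambda>_. t))"
    using C by (intro det_four_block_mat_upper_right_zero_col[of _ k]) auto
  also have "Determinant.det (mat 1 1 (\<lambda>_. t)) = t"
    by (subst det_single) auto
  finally show ?thesis by (simp add: power2_eq_square)
qed

section \<open>Gaussian integrals of quadratic forms\<close>

lemma nn_integral_exp_sq: "(\<integral>\<^sup>+x. ennreal (exp (- x\<^sup>2)) \<partial>lborel) = ennreal (sqrt pi)"
proof -
  have "1 = (\<integral>\<^sup>+x. 1 \<partial>gauss)"
    using gauss.emeasure_space_1 by simp
  also have "\<dots> = (\<integral>\<^sup>+x. ennreal (exp (- x\<^sup>2) / sqrt pi) \<partial>lborel)"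
    unfolding gauss_def by (subst nn_integral_density) auto
  finally have one: "(\<integral>\<^sup>+x. ennreal (exp (- x\<^sup>2) / sqrt pi) \<partial>lborel) = 1" by simp
  have "(\<integral>\<^sup>+x. ennreal (exp (- x\<^sup>2)) \<partial>lborel) = (\<integral>\<^sup>+x. ennreal (sqrt pi) * ennreal (exp (- x\<^sup>2) / sqrt pi) \<partial>lborel)"
    by (intro nn_integral_cong) (simp flip: ennreal_mult)
  also have "\<dots> = ennreal (sqrt pi)"
    by (subst nn_integral_cmult) (simp_all add: one)
  finally show ?thesis .
qed

lemma nn_integral_exp_sq_affine:
  assumes "r \<noteq> 0"
  shows "(\<integral>\<^sup>+y. ennreal (exp (- (c + r * y)\<^sup>2)) \<partial>lborel) = ennreal (sqrt pi / \<bar>r\<bar>)"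
proof -
  have "ennreal (sqrt pi) = ennreal \<bar>r\<bar> * (\<integral>\<^sup>+y. ennreal (exp (- (c + r * y)\<^sup>2)) \<partial>lborel)" (is "_ = _ * ?I")
    unfolding nn_integral_exp_sq[symmetric]
    by (rule nn_integral_real_affine) (use assms in auto)
  then have "ennreal (1 / \<bar>r\<bar>) * ennreal (sqrt pi) = ennreal (1 / \<bar>r\<bar>) * ennreal \<bar>r\<bar> * ?I"
    by (simp add: mult.assoc)
  then show ?thesis
    using assms by (simp flip: ennreal_mult)
qed

lemma nn_integral_exp_mult_sq:
  assumes "0 < t"
  shows "(\<integral>\<^sup>+y. ennreal (exp (- (t * y\<^sup>2))) \<partial>lborel) = ennreal (sqrt (pi / t))"
  using nn_integral_exp_sq_affine[of "sqrt t" 0] assms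
  by (simp add: power_mult_distrib real_sqrt_divide)

lemma sq_norm_mult_mat_vec:
  fixes A :: "real mat"
  assumes "A \<in> carrier_mat n m"
  shows "(A *\<^sub>v vec m x) \<bullet> (A *\<^sub>v vec m x) = (\<Sum>i<n. (\<Sum>j<m. A $$ (i, j) * x j)\<^sup>2)"
  using assms by (auto simp: scalar_prod_def power2_eq_square atLeast0LessThan intro!: sum.cong)

text \<open>
Instead of diagonalising, reflect the last column of \<open>A\<close> into the last axis. This changes neither the
norm of \<open>A x\<close> nor the absolute value of the determinant and makes \<open>A\<close> block triangular: the last
coordinate of \<open>x\<close> then occurs in a single square, which is integrated out by an affine substitution.
\<close>
lemma nn_integral_exp_neg_sq_norm:
  fixes A :: "real mat"
  assumes "A \<in> carrier_mat n n" and "Determinant.det A \<noteq> 0"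
  shows "(\<integral>\<^sup>+x. ennreal (exp (- ((A *\<^sub>v vec n x) \<bullet> (A *\<^sub>v vec n x)))) \<partial>(\<Pi>\<^sub>M i\<in>{..<n}. lborel))
    = ennreal (sqrt pi ^ n / \<bar>Determinant.det A\<bar>)"
  using assms
proof (induction n arbitrary: A)
  case 0
  then show ?case
    by (simp add: scalar_prod_def lborel_prod.nn_integral_empty del: nn_integral_const)
next
  case (Suc n)
  note A = Suc.prems(1)
  obtain Q where Q: "is_reflection (Suc n) Q"
    and Qc: "Q *\<^sub>v col A n = sqrt (col A n \<bullet> col A n) \<cdot>\<^sub>v unit_vec (Suc n) n"
    using ex_reflection_to_axis[of "col A n" "Suc n" n] A by auto
  note q = is_reflectionD(1)[OF Q]
  define R where "R = Q * A"
  have R: "R \<in> carrier_mat (Suc n) (Suc n)" using q A by (simp add: R_def)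
  define r where "r = R $$ (n, n)"
  define B where "B = mat n n (\<lambda>p. R $$ p)"
  define u where "u = (\<lambda>j. R $$ (n, j))"
  have col0: "R $$ (i, n) = 0" if "i < n" for i
  proof -
    have "R $$ (i, n) = (Q *\<^sub>v col A n) $ i"
      using q A that by (simp add: R_def)
    then show ?thesis using Qc that by simp
  qed
  have R_block: "R = four_block_mat B (0\<^sub>m n 1) (mat 1 n (\<lambda>(_, j). u j)) (mat 1 1 (\<lambda>_. r))"
    using R by (intro eq_matI) (auto simp: B_def u_def r_def col0 less_Suc_eq)
  have "Determinant.det R = Determinant.det B * Determinant.det (mat 1 1 (\<lambda>_. r))"
    unfolding R_block by (rule det_four_block_mat_upper_right_zero_col[of _ n]) (auto simp: B_def)
  also have "Determinant.det (mat 1 1 (\<lambda>_. r)) = r" by (subst det_single) auto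
  finally have detR: "Determinant.det R = Determinant.det B * r" .
  have "(Determinant.det R)\<^sup>2 = (Determinant.det A)\<^sup>2"
    using det_reflection_sq[OF Q] q A by (simp add: R_def det_mult[of _ "Suc n"] power_mult_distrib)
  then have absdet: "\<bar>Determinant.det A\<bar> = \<bar>Determinant.det B\<bar> * \<bar>r\<bar>"
    by (metis detR abs_mult power2_eq_iff abs_minus_cancel)
  then have nz: "Determinant.det B \<noteq> 0" "r \<noteq> 0" using Suc.prems(2) by auto
  have B: "B \<in> carrier_mat n n" by (simp add: B_def)
  let ?q = "\<lambda>x. (B *\<^sub>v vec n x) \<bullet> (B *\<^sub>v vec n x)"
  have split: "(A *\<^sub>v vec (Suc n) x) \<bullet> (A *\<^sub>v vec (Suc n) x) = ?q x + ((\<Sum>j<n. u j * x j) + r * x n)\<^sup>2" for x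
  proof -
    have "(A *\<^sub>v vec (Suc n) x) \<bullet> (A *\<^sub>v vec (Suc n) x) = (R *\<^sub>v vec (Suc n) x) \<bullet> (R *\<^sub>v vec (Suc n) x)"
      using sq_norm_reflection[OF Q, of "A *\<^sub>v vec (Suc n) x"] A q by (simp add: R_def)
    also have "\<dots> = (\<Sum>i<Suc n. (\<Sum>j<Suc n. R $$ (i, j) * x j)\<^sup>2)"
      using R by (rule sq_norm_mult_mat_vec)
    also have "\<dots> = (\<Sum>i<n. (\<Sum>j<n. R $$ (i, j) * x j)\<^sup>2) + ((\<Sum>j<n. u j * x j) + r * x n)\<^sup>2"
      by (simp add: col0 u_def r_def)
    also have "(\<Sum>i<n. (\<Sum>j<n. R $$ (i, j) * x j)\<^sup>2) = (\<Sum>i<n. (\<Sum>j<n. B $$ (i, j) * x j)\<^sup>2)"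
      by (intro sum.cong) (auto simp: B_def)
    also have "\<dots> = ?q x" using B by (rule sq_norm_mult_mat_vec[symmetric])
    finally show ?thesis .
  qed
  have q_upd: "?q (x(n := y)) = ?q x" for x y
  proof -
    have "vec n (x(n := y)) = vec n x" by (intro eq_vecI) auto
    then show ?thesis by simp
  qed
  have q_eq: "?q = (\<lambda>x. \<Sum>i<n. (\<Sum>j<n. B $$ (i, j) * x j)\<^sup>2)"
    using sq_norm_mult_mat_vec[OF B] by blast
  have q_meas: "?q \<in> borel_measurable (\<Pi>\<^sub>M i\<in>J. lborel)" if "{..<n} \<subseteq> J" for J
    unfolding q_eq using that
    by (auto intro!: borel_measurable_sum borel_measurable_power borel_measurable_times measurable_component_singleton)
  note [measurable] = q_meas[OF subset_refl]
  have f_meas: "(\<lambda>x. ennreal (exp (- (?q x + ((\<Sum>j<n. u j * x j) + r * x n)\<^sup>2))))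
      \<in> borel_measurable (\<Pi>\<^sub>M i\<in>insert n {..<n}. lborel)"
    by (intro measurable_compose[OF _ measurable_ennreal] measurable_compose[OF _ borel_measurable_exp]
        borel_measurable_uminus borel_measurable_add q_meas borel_measurable_power borel_measurable_sum
        borel_measurable_times borel_measurable_const) auto
  have "(\<integral>\<^sup>+x. ennreal (exp (- ((A *\<^sub>v vec (Suc n) x) \<bullet> (A *\<^sub>v vec (Suc n) x)))) \<partial>(\<Pi>\<^sub>M i\<in>{..<Suc n}. lborel))
    = (\<integral>\<^sup>+x. ennreal (exp (- (?q x + ((\<Sum>j<n. u j * x j) + r * x n)\<^sup>2))) \<partial>(\<Pi>\<^sub>M i\<in>insert n {..<n}. lborel))"
    unfolding split lessThan_Suc ..
  also have "\<dots> = (\<integral>\<^sup>+x. \<integral>\<^sup>+y. ennreal (exp (- (?q (x(n := y)) + ((\<Sum>j<n. u j * (x(n := y)) j) + r * (x(n := y)) n)\<^sup>2))) \<partial>lborel \<partial>(\<Pi>\<^sub>M i\<in>{..<n}. lborel))"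
    by (rule lborel_prod.product_nn_integral_insert) (simp, simp, rule f_meas)
  also have "\<dots> = (\<integral>\<^sup>+x. ennreal (sqrt pi / \<bar>r\<bar>) * ennreal (exp (- ?q x)) \<partial>(\<Pi>\<^sub>M i\<in>{..<n}. lborel))"
  proof (rule nn_integral_cong)
    fix x
    have "(\<integral>\<^sup>+y. ennreal (exp (- (?q (x(n := y)) + ((\<Sum>j<n. u j * (x(n := y)) j) + r * (x(n := y)) n)\<^sup>2))) \<partial>lborel)
      = (\<integral>\<^sup>+y. ennreal (exp (- ?q x)) * ennreal (exp (- ((\<Sum>j<n. u j * x j) + r * y)\<^sup>2)) \<partial>lborel)"
      unfolding q_upd by (intro nn_integral_cong) (simp add: exp_add[symmetric] ennreal_mult[symmetric])
    also have "\<dots> = ennreal (exp (- ?q x)) * ennreal (sqrt pi / \<bar>r\<bar>)"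
      by (subst nn_integral_cmult) (simp_all add: nn_integral_exp_sq_affine nz(2))
    finally show "(\<integral>\<^sup>+y. ennreal (exp (- (?q (x(n := y)) + ((\<Sum>j<n. u j * (x(n := y)) j) + r * (x(n := y)) n)\<^sup>2))) \<partial>lborel)
      = ennreal (sqrt pi / \<bar>r\<bar>) * ennreal (exp (- ?q x))" by (simp add: mult.commute)
  qed
  also have "\<dots> = ennreal (sqrt pi / \<bar>r\<bar>) * ennreal (sqrt pi ^ n / \<bar>Determinant.det B\<bar>)"
    by (subst nn_integral_cmult) (simp_all add: Suc.IH[OF B nz(1)])
  also have "\<dots> = ennreal (sqrt pi ^ Suc n / \<bar>Determinant.det A\<bar>)"
    by (simp add: absdet mult.commute flip: ennreal_mult)
  finally show ?case .
qed

section \<open>The Gaussian measure in coordinates and its orthogonal invariance\<close>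

lemma measurable_sym_of_coords_index:
  assumes "sym_index n \<subseteq> J" "i < n" "j < n"
  shows "(\<lambda>x. sym_of_coords n x $$ (i, j)) \<in> borel_measurable (\<Pi>\<^sub>M p\<in>J. borel)"
proof -
  have "(min i j, max i j) \<in> J"
    using assms by (auto simp: sym_index_def min_def max_def)
  moreover have "(\<lambda>x. sym_of_coords n x $$ (i, j)) = (\<lambda>x. (if i = j then sqrt 2 else 1) * x (min i j, max i j))"
    using assms(2,3) by (auto simp: sym_of_coords_index)
  ultimately show ?thesis by (auto intro!: borel_measurable_times measurable_component_singleton)
qed

lemma measurable_det_sym:
  assumes "sym_index n \<subseteq> J"
  shows "(\<lambda>x. Determinant.det (sym_of_coords n x)) \<in> borel_measurable (\<Pi>\<^sub>M p\<in>J. borel)"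
proof -
  have "(\<lambda>x. Determinant.det (sym_of_coords n x)) =
    (\<lambda>x. \<Sum>p | p permutes {0..<n}. signof p * (\<Prod>i = 0..<n. sym_of_coords n x $$ (i, p i)))"
    by (subst det_def'[OF sym_of_coords_carrier]) simp
  also have "\<dots> \<in> borel_measurable (\<Pi>\<^sub>M p\<in>J. borel)"
    using assms
    by (intro borel_measurable_sum borel_measurable_times borel_measurable_const borel_measurable_prod measurable_sym_of_coords_index)
       (auto simp: permutes_in_image)
  finally show ?thesis .
qed

lemma sym_of_coords_dim [simp]: "dim_row (sym_of_coords n x) = n" "dim_col (sym_of_coords n x) = n"
  by (simp_all add: sym_of_coords_def)

lemma inj_sym_of_coords: "inj_on (sym_of_coords n) (sym_index n \<rightarrow>\<^sub>E UNIV)"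
  using bij_sym_of_coords[of n] by (simp add: bij_betw_def)

abbreviation gauss_coords :: "nat \<Rightarrow> (nat \<times> nat \<Rightarrow> real) measure" where
  "gauss_coords n \<equiv> gauss_PiM (sym_index n)"

text \<open>
In coordinates with respect to \<^const>\<open>sym_basis\<close> the measure \<^const>\<open>gauss_sym\<close> is a product of
one-dimensional Gaussian measures: the exponent splits since the basis is orthonormal, and the
normalising constant splits since there are \<open>n (n + 1)/2\<close> coordinates.
\<close>
lemma e_R_eq_nn_integral:
  "e_R n = enn2real (\<integral>\<^sup>+x. ennreal \<bar>Determinant.det (sym_of_coords n x)\<bar> \<partial>gauss_coords n)"
proof -
  let ?L = "\<Pi>\<^sub>M p\<in>sym_index n. (lborel :: real measure)"
  have s: "sets ?L = sets (\<Pi>\<^sub>M p\<in>sym_index n. (borel :: real measure))" by (intro sets_PiM_cong) auto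
  let ?w = "\<lambda>A. ennreal (pi powr (- (real n * (real n + 1) / 4)) * exp (- (sym_norm n A)\<^sup>2))"
  have inj: "inj_on (sym_of_coords n) (space ?L)"
    using inj_sym_of_coords by (simp add: space_PiM)
  have norm: "(sym_norm n (sym_of_coords n x))\<^sup>2 = (\<Sum>p\<in>sym_index n. (x p)\<^sup>2)" for x
    by (simp add: sym_norm_def sym_inner_sym_of_coords power2_eq_square[symmetric] sum_nonneg)
  have const: "pi powr (- (real n * (real n + 1) / 4)) = 1 / sqrt pi ^ card (sym_index n)"
  proof -
    have "real n * (real n + 1) / 4 = 1 / 2 * real (card (sym_index n))"
      using arg_cong[OF card_sym_index[of n], of real] by (simp add: algebra_simps)
    then have "pi powr (- (real n * (real n + 1) / 4)) = 1 / (pi powr (1 / 2)) powr real (card (sym_index n))"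
      by (simp only: powr_minus_divide powr_powr)
    then show ?thesis
      by (simp add: powr_half_sqrt powr_realpow)
  qed
  have w: "?w (sym_of_coords n x) = ennreal (exp (- (\<Sum>p\<in>sym_index n. (x p)\<^sup>2)) / sqrt pi ^ card (sym_index n))" for x
    unfolding norm const by simp
  note [measurable] = measurable_det_sym[OF subset_refl, of n]
  have detL [measurable]: "(\<lambda>x. Determinant.det (sym_of_coords n x)) \<in> borel_measurable ?L"
    by (subst measurable_cong_sets[OF s refl]) (rule measurable_det_sym[OF subset_refl])
  have wL: "?w \<in> borel_measurable (sym_lebesgue n)"
    unfolding sym_lebesgue_def by (rule measurable_embed_measure1) (unfold w, measurable)
  have dm: "Determinant.det \<in> borel_measurable (sym_lebesgue n)"
    unfolding sym_lebesgue_def by (rule measurable_embed_measure1) measurable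
  have absdet: "(\<lambda>A. ennreal \<bar>Determinant.det A\<bar>) \<in> borel_measurable (sym_lebesgue n)"
    by (rule measurable_compose[OF borel_measurable_abs[OF dm] measurable_ennreal])
  have "e_R n = enn2real (\<integral>\<^sup>+A. ennreal \<bar>Determinant.det A\<bar> \<partial>gauss_sym n)"
    unfolding e_R_def
  proof (rule integral_eq_nn_integral)
    have "Determinant.det \<in> borel_measurable (gauss_sym n)"
      unfolding gauss_sym_def using dm by (subst measurable_cong_sets[OF sets_density refl])
    then show "(\<lambda>A. \<bar>Determinant.det A\<bar>) \<in> borel_measurable (gauss_sym n)"
      by (rule borel_measurable_abs)
  qed (rule AE_I2, rule abs_ge_zero)
  also have "(\<integral>\<^sup>+A. ennreal \<bar>Determinant.det A\<bar> \<partial>gauss_sym n)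
      = (\<integral>\<^sup>+A. ?w A * ennreal \<bar>Determinant.det A\<bar> \<partial>sym_lebesgue n)"
    unfolding gauss_sym_def by (rule nn_integral_density[OF wL absdet])
  also have "\<dots> = (\<integral>\<^sup>+x. ?w (sym_of_coords n x) * ennreal \<bar>Determinant.det (sym_of_coords n x)\<bar> \<partial>?L)"
    unfolding sym_lebesgue_def
    by (rule nn_integral_embed_measure'[OF inj, of "\<lambda>A. ?w A * ennreal \<bar>Determinant.det A\<bar>"])
       (fold sym_lebesgue_def, rule borel_measurable_times_ennreal[OF wL absdet])
  also have "\<dots> = (\<integral>\<^sup>+x. ennreal \<bar>Determinant.det (sym_of_coords n x)\<bar> \<partial>gauss_coords n)"
    unfolding w by (rule nn_integral_gauss_PiM[symmetric]) (simp, measurable)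
  finally show ?thesis .
qed

lemma sym_of_coords_surj:
  assumes "A \<in> carrier_mat n n" "A\<^sup>T = A"
  obtains x where "x \<in> sym_index n \<rightarrow>\<^sub>E UNIV" "sym_of_coords n x = A"
proof -
  have "A \<in> sym_of_coords n ` (sym_index n \<rightarrow>\<^sub>E UNIV)"
    using assms bij_betw_imp_surj_on[OF bij_sym_of_coords[of n]] by (simp add: Sym_def)
  then show thesis using that by blast
qed

definition coords_of_sym :: "nat \<Rightarrow> real mat \<Rightarrow> nat \<times> nat \<Rightarrow> real" where
  "coords_of_sym n A = (\<lambda>p\<in>sym_index n. (if fst p = snd p then 1 / sqrt 2 else 1) * A $$ p)"

lemma coords_of_sym_of_coords:
  assumes "x \<in> sym_index n \<rightarrow>\<^sub>E UNIV"
  shows "coords_of_sym n (sym_of_coords n x) = x"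
proof (rule PiE_ext[OF _ assms])
  show "coords_of_sym n (sym_of_coords n x) \<in> sym_index n \<rightarrow>\<^sub>E UNIV"
    by (simp add: coords_of_sym_def)
  show "coords_of_sym n (sym_of_coords n x) p = x p" if "p \<in> sym_index n" for p
    using that by (auto simp: coords_of_sym_def sym_index_def sym_of_coords_index min_def max_def)
qed

lemma sym_of_coords_of_sym:
  assumes "A \<in> carrier_mat n n" "A\<^sup>T = A"
  shows "sym_of_coords n (coords_of_sym n A) = A"
  by (metis assms sym_of_coords_surj coords_of_sym_of_coords)

text \<open>
The scalar product of a matrix with itself is half the sum of the squared norms of its columns, and
likewise of its rows; a reflection acting on either side preserves these norms.
\<close>
lemma sym_inner_reflection:
  assumes Q: "is_reflection n Q" and A: "A \<in> carrier_mat n n"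
  shows "sym_inner n (Q * A * Q) (Q * A * Q) = sym_inner n A A"
proof -
  note q = is_reflectionD[OF Q]
  define frob where "frob B = (\<Sum>j<n. col B j \<bullet> col B j)" for B :: "real mat"
  have frob: "2 * sym_inner n B B = frob B" if "B \<in> carrier_mat n n" for B
    using that unfolding sym_inner_def frob_def
    by (subst sum.swap) (auto simp: scalar_prod_def atLeast0LessThan intro!: sum.cong)
  have left: "frob (Q * B) = frob B" if "B \<in> carrier_mat n n" for B
    unfolding frob_def using that q(1) sq_norm_reflection[OF Q]
    by (intro sum.cong) (auto simp: col_mult2[of Q n n B n])
  have trans: "frob B\<^sup>T = frob B" if "B \<in> carrier_mat n n" for B
    using that unfolding frob_def
    by (subst sum.swap[of "\<lambda>i j. B $$ (i, j) * B $$ (i, j)" "{..<n}" "{..<n}", THEN trans[rotated]])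
       (auto simp: scalar_prod_def atLeast0LessThan intro!: sum.cong)
  have "frob (Q * A * Q) = frob ((Q * A * Q)\<^sup>T)" using q A by (simp add: trans)
  also have "(Q * A * Q)\<^sup>T = Q * (Q * A)\<^sup>T"
    using q A by (subst transpose_mult[of _ n n _ n]) auto
  also have "frob \<dots> = frob A" using q A by (simp add: left trans)
  finally show ?thesis using frob[of A] frob[of "Q * A * Q"] q A by simp
qed

lemma sym_of_coords_add:
  "sym_of_coords n (\<lambda>p\<in>sym_index n. x p + y p) = sym_of_coords n x + sym_of_coords n y"
proof (rule eq_matI)
  let ?S = "sym_of_coords n"
  fix i j assume "i < dim_row (?S x + ?S y)" "j < dim_col (?S x + ?S y)"
  then have ij: "i < n" "j < n" by simp_all
  then have "(min i j, max i j) \<in> sym_index n" "(i, i) \<in> sym_index n" "(j, j) \<in> sym_index n" by (auto simp: sym_index_def)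
  with ij show "?S (\<lambda>p\<in>sym_index n. x p + y p) $$ (i, j) = (?S x + ?S y) $$ (i, j)"
    by (simp add: sym_of_coords_index distrib_left)
qed simp_all

text \<open>
In coordinates, conjugation by a reflection is a linear isometry.
\<close>
lemma nn_integral_gauss_coords_reflection:
  assumes Q: "is_reflection n Q"
    and F: "(\<lambda>x. F (sym_of_coords n x)) \<in> borel_measurable (\<Pi>\<^sub>M p\<in>sym_index n. borel)"
  shows "(\<integral>\<^sup>+x. F (Q * sym_of_coords n x * Q) \<partial>gauss_coords n) = (\<integral>\<^sup>+x. F (sym_of_coords n x) \<partial>gauss_coords n)"
proof -
  note q = is_reflectionD[OF Q]
  let ?S = "sym_of_coords n" and ?I = "sym_index n"
  define T where "T x = coords_of_sym n (Q * ?S x * Q)" for x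
  have symS: "(?S x)\<^sup>T = ?S x" for x
  proof (rule eq_matI)
    fix i j assume "i < dim_row (?S x)" "j < dim_col (?S x)"
    then have "i < n" "j < n" by simp_all
    then show "(?S x)\<^sup>T $$ (i, j) = ?S x $$ (i, j)"
      using sym_of_coords_index[of i n j x] sym_of_coords_index[of j n i x]
      by (auto simp: min.commute[of j i] max.commute[of j i])
  qed simp_all
  have "(Q * ?S x * Q)\<^sup>T = Q * ?S x * Q" for x
  proof -
    have "(Q * ?S x * Q)\<^sup>T = Q * (?S x * Q)"
      using q symS by (simp add: transpose_mult[of _ n n _ n])
    then show ?thesis using q by (simp add: assoc_mult_mat[of _ n n _ n _ n])
  qed
  then have ST: "?S (T x) = Q * ?S x * Q" for x
    unfolding T_def using q by (intro sym_of_coords_of_sym) auto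
  have Tsp: "T x \<in> ?I \<rightarrow>\<^sub>E UNIV" for x by (simp add: T_def coords_of_sym_def)
  have inj: "x = y" if "?S x = ?S y" "x \<in> ?I \<rightarrow>\<^sub>E UNIV" "y \<in> ?I \<rightarrow>\<^sub>E UNIV" for x y
    using inj_sym_of_coords that by (auto dest: inj_onD)
  \<comment> \<open>each coordinate of \<open>T x\<close> is a linear combination of coordinates of \<open>x\<close>\<close>
  have meas: "T \<in> measurable (\<Pi>\<^sub>M p\<in>?I. borel) (\<Pi>\<^sub>M p\<in>?I. borel)"
    unfolding T_def coords_of_sym_def
  proof (rule measurable_restrict)
    fix p assume "p \<in> ?I"
    then obtain i j where p: "p = (i, j)" "i < n" "j < n" by (auto simp: sym_index_def)
    have entry: "(Q * ?S x * Q) $$ p = (\<Sum>l<n. (\<Sum>k<n. Q $$ (i, k) * ?S x $$ (k, l)) * Q $$ (l, j))" for x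
    proof -
      have mult: "(A * B) $$ (a, b) = (\<Sum>l<n. A $$ (a, l) * B $$ (l, b))"
        if "A \<in> carrier_mat n n" "B \<in> carrier_mat n n" "a < n" "b < n" for A B :: "real mat" and a b
        using that by (simp add: scalar_prod_def atLeast0LessThan)
      have "(Q * ?S x * Q) $$ p = (\<Sum>l<n. (Q * ?S x) $$ (i, l) * Q $$ (l, j))"
        unfolding p(1) using q(1) p by (intro mult) auto
      also have "\<dots> = (\<Sum>l<n. (\<Sum>k<n. Q $$ (i, k) * ?S x $$ (k, l)) * Q $$ (l, j))"
        using q(1) p by (intro sum.cong refl) (subst mult, auto)
      finally show ?thesis .
    qed
    show "(\<lambda>x. (if fst p = snd p then 1 / sqrt 2 else 1) * (Q * ?S x * Q) $$ p) \<in> borel_measurable (\<Pi>\<^sub>M p\<in>?I. borel)"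
      unfolding entry
      by (intro borel_measurable_times borel_measurable_const borel_measurable_sum measurable_sym_of_coords_index) auto
  qed
  have "(\<integral>\<^sup>+x. F (?S (T x)) \<partial>gauss_coords n) = (\<integral>\<^sup>+x. F (?S x) \<partial>gauss_coords n)"
  proof (rule nn_integral_gauss_PiM_isometry[OF finite_sym_index meas _ _ _ F])
    fix x y
    show "T (\<lambda>i\<in>?I. x i + y i) = (\<lambda>i\<in>?I. T x i + T y i)"
    proof (rule inj)
      show "?S (T (\<lambda>i\<in>?I. x i + y i)) = ?S (\<lambda>i\<in>?I. T x i + T y i)"
        unfolding sym_of_coords_add ST using q(1)
        by (simp add: mult_add_distrib_mat[of _ n n _ n] add_mult_distrib_mat[of _ n n _ _ n])
    qed (use Tsp in auto)
  next
    fix y assume y: "y \<in> ?I \<rightarrow>\<^sub>E (UNIV :: real set)"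
    have "?S (T (T y)) = Q * (Q * ?S y * Q) * Q" unfolding ST ..
    also have "Q * (Q * ?S y * Q) = ?S y * Q"
    proof -
      have "Q * (Q * ?S y * Q) = Q * (Q * (?S y * Q))"
        using q(1) by (subst assoc_mult_mat[of Q n n "?S y" n Q n]) auto
      also have "\<dots> = (Q * Q) * (?S y * Q)"
        using q(1) by (intro assoc_mult_mat[symmetric, of _ n n _ n _ n]) auto
      finally show ?thesis using q(1,3) by simp
    qed
    also have "?S y * Q * Q = ?S y * (Q * Q)"
      using q(1) by (intro assoc_mult_mat[of _ n n _ n _ n]) auto
    finally have "?S (T (T y)) = ?S y" using q(3) by simp
    then have "T (T y) = y" using y Tsp by (intro inj)
    then show "\<exists>x\<in>?I \<rightarrow>\<^sub>E UNIV. T x = y" using Tsp by blast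
  next
    fix x
    show "(\<Sum>i\<in>?I. (T x i)\<^sup>2) = (\<Sum>i\<in>?I. (x i)\<^sup>2)"
      using sym_inner_reflection[OF Q sym_of_coords_carrier, of x]
      unfolding ST[symmetric] sym_inner_sym_of_coords by (simp add: power2_eq_square)
  qed
  then show ?thesis unfolding ST .
qed

section \<open>Moments of Gaussian vectors\<close>

text \<open>
The factor \<open>exp (- u x\<^sup>2)\<close> turns the Gaussian law of variance \<open>1/2\<close> into a multiple of the one of variance
\<open>1 / (2 (1 + u))\<close>, so these are the ordinary even moments.
\<close>
lemma gauss_moment:
  assumes u: "u \<ge> 0"
  shows "(\<integral>\<^sup>+x. ennreal (x ^ (2 * k) * exp (- (u * x\<^sup>2))) \<partial>gauss)
    = ennreal (fact (2 * k) / (4 ^ k * fact k) * (1 + u) powr (- (real k + 1 / 2)))"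
proof -
  define s where "s = sqrt (1 / (2 * (1 + u)))"
  have s: "s > 0" and s2: "s\<^sup>2 = 1 / (2 * (1 + u))" using u by (simp_all add: s_def)
  have dens: "exp (- x\<^sup>2) / sqrt pi * exp (- (u * x\<^sup>2)) = (1 + u) powr (- 1 / 2) * normal_density 0 s x" for x
  proof -
    have "normal_density 0 s x = sqrt (1 + u) / sqrt pi * exp (- ((1 + u) * x\<^sup>2))"
    proof -
      have "2 * pi * s\<^sup>2 = pi / (1 + u)" "(x - 0)\<^sup>2 / (2 * s\<^sup>2) = (1 + u) * x\<^sup>2"
        unfolding s2 using u by (simp_all add: field_simps)
      then show ?thesis
        unfolding normal_density_def using u by (simp add: real_sqrt_divide)
    qed
    moreover have "(1 + u) powr (- 1 / 2) = 1 / sqrt (1 + u)"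
      using u by (simp add: powr_minus_divide powr_half_sqrt)
    ultimately show ?thesis using u by (simp add: exp_add[symmetric] algebra_simps)
  qed
  have mom: "(\<integral>\<^sup>+x. ennreal (normal_density 0 s x * x ^ (2 * k)) \<partial>lborel)
      = ennreal (fact (2 * k) / ((4 * (1 + u)) ^ k * fact k))"
  proof -
    have "2 / s\<^sup>2 = 4 * (1 + u)" unfolding s2 using u by simp
    then have hb: "has_bochner_integral lborel (\<lambda>x. normal_density 0 s x * x ^ (2 * k)) (fact (2 * k) / ((4 * (1 + u)) ^ k * fact k))"
      using normal_moment_even[OF s, of 0 k] by simp
    show ?thesis
      using nn_integral_eq_integral[OF integrable.intros[OF hb]] has_bochner_integral_integral_eq[OF hb]
      by (simp add: zero_le_even_power')
  qed
  have "(\<integral>\<^sup>+x. ennreal (x ^ (2 * k) * exp (- (u * x\<^sup>2))) \<partial>gauss)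
      = (\<integral>\<^sup>+x. ennreal (exp (- x\<^sup>2) / sqrt pi) * ennreal (x ^ (2 * k) * exp (- (u * x\<^sup>2))) \<partial>lborel)"
    unfolding gauss_def by (rule nn_integral_density) measurable
  also have "\<dots> = (\<integral>\<^sup>+x. ennreal ((1 + u) powr (- 1 / 2)) * ennreal (normal_density 0 s x * x ^ (2 * k)) \<partial>lborel)"
  proof (rule nn_integral_cong)
    fix x
    have "exp (- x\<^sup>2) / sqrt pi * (x ^ (2 * k) * exp (- (u * x\<^sup>2))) = (1 + u) powr (- 1 / 2) * (normal_density 0 s x * x ^ (2 * k))"
      using arg_cong[OF dens[of x], of "\<lambda>z. z * x ^ (2 * k)"] by (simp add: mult_ac)
    then show "ennreal (exp (- x\<^sup>2) / sqrt pi) * ennreal (x ^ (2 * k) * exp (- (u * x\<^sup>2)))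
        = ennreal ((1 + u) powr (- 1 / 2)) * ennreal (normal_density 0 s x * x ^ (2 * k))"
      by (simp flip: ennreal_mult)
  qed
  also have "\<dots> = ennreal ((1 + u) powr (- 1 / 2)) * ennreal (fact (2 * k) / ((4 * (1 + u)) ^ k * fact k))"
    by (subst nn_integral_cmult) (simp_all add: mom)
  also have "\<dots> = ennreal (fact (2 * k) / (4 ^ k * fact k) * (1 + u) powr (- (real k + 1 / 2)))"
  proof -
    have "(1 + u) powr (- (real k + 1 / 2)) = (1 + u) powr (- 1 / 2) / (1 + u) ^ k"
    proof -
      have "(1 + u) powr (- (real k + 1 / 2)) = (1 + u) powr (- 1 / 2) * (1 + u) powr (- real k)"
        unfolding powr_add[symmetric] by (rule arg_cong[of _ _ "(powr) (1 + u)"]) simp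
      then show ?thesis using u by (simp add: powr_minus_divide[of _ "real k"] powr_realpow)
    qed
    then show ?thesis
      unfolding power_mult_distrib using u by (simp add: mult_ac flip: ennreal_mult)
  qed
  finally show ?thesis .
qed

text \<open>
The squared norm has a Gamma law, but the three moments follow directly by adding one coordinate
at a time. The first moment is there to make the induction for the second one work.
\<close>
lemma gauss_PiM_sq_norm_moments:
  assumes u: "u \<ge> 0" and "finite I"
  shows "(\<integral>\<^sup>+x. ennreal (exp (- (u * (\<Sum>i\<in>I. (x i)\<^sup>2)))) \<partial>gauss_PiM I)
      = ennreal ((1 + u) powr (- real (card I) / 2))" (is ?P0)
    and "(\<integral>\<^sup>+x. ennreal ((\<Sum>i\<in>I. (x i)\<^sup>2) * exp (- (u * (\<Sum>i\<in>I. (x i)\<^sup>2)))) \<partial>gauss_PiM I)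
      = ennreal (real (card I) / 2 * (1 + u) powr (- real (card I) / 2 - 1))" (is ?P1)
    and "(\<integral>\<^sup>+x. ennreal ((\<Sum>i\<in>I. (x i)\<^sup>2)\<^sup>2 * exp (- (u * (\<Sum>i\<in>I. (x i)\<^sup>2)))) \<partial>gauss_PiM I)
      = ennreal (real (card I) * (real (card I) + 2) / 4 * (1 + u) powr (- real (card I) / 2 - 2))" (is ?P2)
proof -
  have g0: "(\<integral>\<^sup>+x. ennreal (exp (- (u * x\<^sup>2))) \<partial>gauss) = ennreal ((1 + u) powr (- 1 / 2))"
    and g1: "(\<integral>\<^sup>+x. ennreal (x\<^sup>2 * exp (- (u * x\<^sup>2))) \<partial>gauss) = ennreal (1 / 2 * (1 + u) powr (- 3 / 2))"
    and g2: "(\<integral>\<^sup>+x. ennreal ((x\<^sup>2)\<^sup>2 * exp (- (u * x\<^sup>2))) \<partial>gauss) = ennreal (3 / 4 * (1 + u) powr (- 5 / 2))"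
    using gauss_moment[OF u, of 0] gauss_moment[OF u, of 1] gauss_moment[OF u, of 2]
    by (simp_all add: fact_numeral flip: power_mult)
  have "?P0 \<and> ?P1 \<and> ?P2"
    using \<open>finite I\<close>
  proof (induction I)
    case empty
    show ?case
      using u by (simp add: gauss_PiM_def gauss_prod.nn_integral_empty del: nn_integral_const)
  next
    case (insert i I)
    let ?r = "\<lambda>x. \<Sum>i\<in>I. (x i)\<^sup>2" and ?d = "real (card I)"
    let ?v = "\<lambda>a. (1 + u) powr a"
    note IH0 = insert.IH[THEN conjunct1] and IH1 = insert.IH[THEN conjunct2, THEN conjunct1]
      and IH2 = insert.IH[THEN conjunct2, THEN conjunct2]
    have [measurable]: "?r \<in> borel_measurable (gauss_PiM I)"
      unfolding measurable_cong_sets[OF sets_gauss_PiM refl] by measurable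
    have step: "(\<integral>\<^sup>+x. f (\<Sum>j\<in>insert i I. (x j)\<^sup>2) \<partial>gauss_PiM (insert i I))
        = (\<integral>\<^sup>+x. \<integral>\<^sup>+y. f (?r x + y\<^sup>2) \<partial>gauss \<partial>gauss_PiM I)" if [measurable]: "f \<in> borel_measurable borel" for f :: "real \<Rightarrow> ennreal"
    proof -
      have upd: "(\<Sum>j\<in>insert i I. ((x(i := y)) j)\<^sup>2) = ?r x + y\<^sup>2" for x y
      proof -
        have "(\<Sum>j\<in>I. ((x(i := y)) j)\<^sup>2) = ?r x" using insert.hyps by (intro sum.cong) auto
        then show ?thesis using insert.hyps by (simp add: add.commute)
      qed
      have "(\<integral>\<^sup>+x. f (\<Sum>j\<in>insert i I. (x j)\<^sup>2) \<partial>gauss_PiM (insert i I))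
        = (\<integral>\<^sup>+x. \<integral>\<^sup>+y. f (\<Sum>j\<in>insert i I. ((x(i := y)) j)\<^sup>2) \<partial>gauss \<partial>gauss_PiM I)"
        unfolding gauss_PiM_def using insert.hyps
        by (intro gauss_prod.product_nn_integral_insert) (auto simp del: sum.insert)
      then show ?thesis unfolding upd .
    qed
    have c: "real (card (insert i I)) = ?d + 1" using insert.hyps by simp
    have pw: "?v a * ?v b = ?v (a + b)" for a b using u by (simp add: powr_add)
    have ex: "exp (- (u * (a + b))) = exp (- (u * a)) * exp (- (u * b))" for a b
      by (simp add: distrib_left exp_diff exp_minus divide_inverse)
    have 0: "(\<integral>\<^sup>+x. ennreal (exp (- (u * (\<Sum>j\<in>insert i I. (x j)\<^sup>2)))) \<partial>gauss_PiM (insert i I))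
      = ennreal (?v (- (?d + 1) / 2))"
    proof -
      have "(\<integral>\<^sup>+x. ennreal (exp (- (u * (\<Sum>j\<in>insert i I. (x j)\<^sup>2)))) \<partial>gauss_PiM (insert i I))
        = (\<integral>\<^sup>+x. \<integral>\<^sup>+y. ennreal (exp (- (u * (?r x + y\<^sup>2)))) \<partial>gauss \<partial>gauss_PiM I)"
        by (rule step[of "\<lambda>t. ennreal (exp (- (u * t)))"]) measurable
      also have "\<dots> = (\<integral>\<^sup>+x. \<integral>\<^sup>+y. ennreal (exp (- (u * ?r x))) * ennreal (exp (- (u * y\<^sup>2))) \<partial>gauss \<partial>gauss_PiM I)"
        unfolding ex by (intro nn_integral_cong) (simp flip: ennreal_mult)
      also have "\<dots> = (\<integral>\<^sup>+x. ennreal (exp (- (u * ?r x))) * ennreal (?v (- 1 / 2)) \<partial>gauss_PiM I)"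
        by (subst nn_integral_cmult) (simp_all add: g0)
      also have "\<dots> = ennreal (?v (- ?d / 2) * ?v (- 1 / 2))"
        by (subst nn_integral_multc) (simp_all add: IH0 ennreal_mult)
      finally show ?thesis by (simp add: pw field_simps)
    qed
    have 1: "(\<integral>\<^sup>+x. ennreal ((\<Sum>j\<in>insert i I. (x j)\<^sup>2) * exp (- (u * (\<Sum>j\<in>insert i I. (x j)\<^sup>2)))) \<partial>gauss_PiM (insert i I))
      = ennreal ((?d + 1) / 2 * ?v (- (?d + 1) / 2 - 1))"
    proof -
      have "(\<integral>\<^sup>+x. ennreal ((\<Sum>j\<in>insert i I. (x j)\<^sup>2) * exp (- (u * (\<Sum>j\<in>insert i I. (x j)\<^sup>2)))) \<partial>gauss_PiM (insert i I))
        = (\<integral>\<^sup>+x. \<integral>\<^sup>+y. ennreal ((?r x + y\<^sup>2) * exp (- (u * (?r x + y\<^sup>2)))) \<partial>gauss \<partial>gauss_PiM I)"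
        by (rule step[of "\<lambda>t. ennreal (t * exp (- (u * t)))"]) measurable
      also have "\<dots> = (\<integral>\<^sup>+x. \<integral>\<^sup>+y. ennreal (?r x * exp (- (u * ?r x))) * ennreal (exp (- (u * y\<^sup>2)))
          + ennreal (exp (- (u * ?r x))) * ennreal (y\<^sup>2 * exp (- (u * y\<^sup>2))) \<partial>gauss \<partial>gauss_PiM I)"
        unfolding ex by (intro nn_integral_cong) (simp add: sum_nonneg distrib_left distrib_right mult_ac flip: ennreal_mult ennreal_plus)
      also have "\<dots> = (\<integral>\<^sup>+x. ennreal (?r x * exp (- (u * ?r x))) * ennreal (?v (- 1 / 2))
          + ennreal (exp (- (u * ?r x))) * ennreal (1 / 2 * ?v (- 3 / 2)) \<partial>gauss_PiM I)"
        by (subst nn_integral_add, simp, simp, subst (1 2) nn_integral_cmult) (simp_all only: g0 g1, auto)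
      also have "\<dots> = ennreal (?d / 2 * ?v (- ?d / 2 - 1)) * ennreal (?v (- 1 / 2)) + ennreal (?v (- ?d / 2)) * ennreal (1 / 2 * ?v (- 3 / 2))"
        by (subst nn_integral_add, simp, simp, subst (1 2) nn_integral_multc) (simp_all only: IH0 IH1, auto)
      also have "\<dots> = ennreal (?d / 2 * (?v (- ?d / 2 - 1) * ?v (- 1 / 2)) + 1 / 2 * (?v (- ?d / 2) * ?v (- 3 / 2)))"
        by (simp add: mult_ac flip: ennreal_mult ennreal_plus)
      also have "?v (- ?d / 2 - 1) * ?v (- 1 / 2) = ?v (- (?d + 1) / 2 - 1)" unfolding pw by (rule arg_cong[of _ _ ?v]) (simp add: field_simps)
      also have "?v (- ?d / 2) * ?v (- 3 / 2) = ?v (- (?d + 1) / 2 - 1)" unfolding pw by (rule arg_cong[of _ _ ?v]) (simp add: field_simps)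
      finally show ?thesis by (simp add: field_simps)
    qed
    have 2: "(\<integral>\<^sup>+x. ennreal ((\<Sum>j\<in>insert i I. (x j)\<^sup>2)\<^sup>2 * exp (- (u * (\<Sum>j\<in>insert i I. (x j)\<^sup>2)))) \<partial>gauss_PiM (insert i I))
      = ennreal ((?d + 1) * (?d + 3) / 4 * ?v (- (?d + 1) / 2 - 2))"
    proof -
      have "(\<integral>\<^sup>+x. ennreal ((\<Sum>j\<in>insert i I. (x j)\<^sup>2)\<^sup>2 * exp (- (u * (\<Sum>j\<in>insert i I. (x j)\<^sup>2)))) \<partial>gauss_PiM (insert i I))
        = (\<integral>\<^sup>+x. \<integral>\<^sup>+y. ennreal ((?r x + y\<^sup>2)\<^sup>2 * exp (- (u * (?r x + y\<^sup>2)))) \<partial>gauss \<partial>gauss_PiM I)"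
        by (rule step[of "\<lambda>t. ennreal (t\<^sup>2 * exp (- (u * t)))"]) measurable
      also have "\<dots> = (\<integral>\<^sup>+x. \<integral>\<^sup>+y. ennreal ((?r x)\<^sup>2 * exp (- (u * ?r x))) * ennreal (exp (- (u * y\<^sup>2)))
          + (ennreal (2 * (?r x * exp (- (u * ?r x)))) * ennreal (y\<^sup>2 * exp (- (u * y\<^sup>2)))
          + ennreal (exp (- (u * ?r x))) * ennreal ((y\<^sup>2)\<^sup>2 * exp (- (u * y\<^sup>2)))) \<partial>gauss \<partial>gauss_PiM I)"
        unfolding ex by (intro nn_integral_cong)
           (simp add: sum_nonneg power2_sum power2_eq_square[of "_ * _"] distrib_left distrib_right mult_ac add_ac flip: ennreal_mult ennreal_plus)
      also have "\<dots> = (\<integral>\<^sup>+x. ennreal ((?r x)\<^sup>2 * exp (- (u * ?r x))) * ennreal (?v (- 1 / 2))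
          + (ennreal 2 * (ennreal (?r x * exp (- (u * ?r x))) * ennreal (1 / 2 * ?v (- 3 / 2)))
          + ennreal (exp (- (u * ?r x))) * ennreal (3 / 4 * ?v (- 5 / 2))) \<partial>gauss_PiM I)"
        by (subst nn_integral_add, simp, simp, subst nn_integral_add, simp, simp, subst (1 2 3) nn_integral_cmult)
           (simp_all only: g0 g1 g2, auto simp: ennreal_mult sum_nonneg mult_ac)
      also have "\<dots> = ennreal (?d * (?d + 2) / 4 * ?v (- ?d / 2 - 2)) * ennreal (?v (- 1 / 2))
          + (ennreal 2 * (ennreal (?d / 2 * ?v (- ?d / 2 - 1)) * ennreal (1 / 2 * ?v (- 3 / 2)))
          + ennreal (?v (- ?d / 2)) * ennreal (3 / 4 * ?v (- 5 / 2)))"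
        by (subst nn_integral_add, simp, simp, subst nn_integral_add, simp, simp, subst nn_integral_cmult, simp, subst (1 2 3) nn_integral_multc)
           (simp_all only: IH0 IH1 IH2, auto)
      also have "\<dots> = ennreal (?d * (?d + 2) / 4 * (?v (- ?d / 2 - 2) * ?v (- 1 / 2))
          + (?d / 2 * (?v (- ?d / 2 - 1) * ?v (- 3 / 2)) + 3 / 4 * (?v (- ?d / 2) * ?v (- 5 / 2))))"
        by (simp add: mult_ac del: ennreal_numeral flip: ennreal_mult ennreal_plus)
      also have "?v (- ?d / 2 - 2) * ?v (- 1 / 2) = ?v (- (?d + 1) / 2 - 2)" unfolding pw by (rule arg_cong[of _ _ ?v]) (simp add: field_simps)
      also have "?v (- ?d / 2 - 1) * ?v (- 3 / 2) = ?v (- (?d + 1) / 2 - 2)" unfolding pw by (rule arg_cong[of _ _ ?v]) (simp add: field_simps)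
      also have "?v (- ?d / 2) * ?v (- 5 / 2) = ?v (- (?d + 1) / 2 - 2)" unfolding pw by (rule arg_cong[of _ _ ?v]) (simp add: field_simps)
      finally show ?thesis by (simp add: field_simps)
    qed
    show ?case using 0 1 2 unfolding c by (simp add: add.commute add.assoc)
  qed
  then show ?P0 ?P1 ?P2 by auto
qed

section \<open>The second moment of the determinant\<close>

definition border_index :: "nat \<Rightarrow> (nat \<times> nat) set" where
  "border_index n = (\<lambda>i. (i, n)) ` {..<n}"

lemma finite_border_index [simp]: "finite (border_index n)"
  by (simp add: border_index_def)

lemma card_border_index [simp]: "card (border_index n) = n"
  unfolding border_index_def by (subst card_image) (auto simp: inj_on_def)

lemma sum_border_index: "(\<Sum>p\<in>border_index n. f p) = (\<Sum>i<n. f (i, n))"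
  unfolding border_index_def by (subst sum.reindex) (auto simp: inj_on_def)

lemma sym_index_Suc: "sym_index (Suc n) = insert (n, n) (border_index n \<union> sym_index n)"
  by (auto simp: sym_index_def border_index_def less_Suc_eq)

lemma sym_index_mono_Suc: "sym_index n \<subseteq> sym_index (Suc n)"
  by (auto simp: sym_index_Suc)

lemma sym_of_coords_cong:
  assumes "\<And>p. p \<in> sym_index n \<Longrightarrow> x p = y p"
  shows "sym_of_coords n x = sym_of_coords n y"
  unfolding sym_of_coords_def using assms by (intro arg_cong[of _ _ "mat n n"] ext sum.cong) auto

text \<open>
Independence of the leading block, the rest of the last column and the corner entry. The integrand is
passed as a function of these three pieces so that the lemma applies without unfolding the product
space.
\<close>
lemma nn_integral_gauss_coords_Suc:
  fixes g :: "real mat \<Rightarrow> real vec \<Rightarrow> real \<Rightarrow> ennreal"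
  assumes g: "(\<lambda>x. g (sym_of_coords n x) (vec n (\<lambda>i. x (i, n))) (x (n, n)))
    \<in> borel_measurable (\<Pi>\<^sub>M p\<in>sym_index (Suc n). borel)"
  shows "(\<integral>\<^sup>+x. g (sym_of_coords n x) (vec n (\<lambda>i. x (i, n))) (x (n, n)) \<partial>gauss_coords (Suc n))
    = (\<integral>\<^sup>+z. \<integral>\<^sup>+y. \<integral>\<^sup>+x. g (sym_of_coords n x) (vec n (\<lambda>i. y (i, n))) z
        \<partial>gauss_coords n \<partial>gauss_PiM (border_index n) \<partial>gauss)"
proof -
  let ?f = "\<lambda>x. g (sym_of_coords n x) (vec n (\<lambda>i. x (i, n))) (x (n, n))"
  let ?J = "border_index n \<union> sym_index n"
  have disj: "border_index n \<inter> sym_index n = {}" "(n, n) \<notin> ?J"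
    by (auto simp: border_index_def sym_index_def)
  have s: "sets (\<Pi>\<^sub>M p\<in>I. gauss) = sets (\<Pi>\<^sub>M p\<in>I. (borel :: real measure))" for I :: "(nat \<times> nat) set"
    by (intro sets_PiM_cong) auto
  have f: "?f \<in> borel_measurable (\<Pi>\<^sub>M p\<in>insert (n, n) ?J. gauss)"
    using g unfolding sym_index_Suc by (subst measurable_cong_sets[OF s refl])
  have f': "(\<lambda>x. ?f (x((n, n) := z))) \<in> borel_measurable (\<Pi>\<^sub>M p\<in>?J. gauss)" for z
    by (rule measurable_compose[OF _ f]) (rule measurable_fun_upd[where J = ?J]; simp)
  have red: "?f ((merge (border_index n) (sym_index n) (y, x))((n, n) := z))
      = g (sym_of_coords n x) (vec n (\<lambda>i. y (i, n))) z" for x y z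
  proof -
    let ?m = "(merge (border_index n) (sym_index n) (y, x))((n, n) := z)"
    have "sym_of_coords n ?m = sym_of_coords n x"
      using disj by (intro sym_of_coords_cong) (auto simp: merge_def)
    moreover have "vec n (\<lambda>i. ?m (i, n)) = vec n (\<lambda>i. y (i, n))"
      by (intro eq_vecI) (auto simp: merge_def border_index_def)
    ultimately show ?thesis by simp
  qed
  have "(\<integral>\<^sup>+x. ?f x \<partial>gauss_coords (Suc n)) = (\<integral>\<^sup>+z. \<integral>\<^sup>+x. ?f (x((n, n) := z)) \<partial>(\<Pi>\<^sub>M p\<in>?J. gauss) \<partial>gauss)"
    unfolding gauss_PiM_def sym_index_Suc using disj
    by (intro gauss_prod.product_nn_integral_insert_rev f) auto
  also have "\<dots> = (\<integral>\<^sup>+z. \<integral>\<^sup>+y. \<integral>\<^sup>+x. ?f ((merge (border_index n) (sym_index n) (y, x))((n, n) := z))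
      \<partial>gauss_coords n \<partial>gauss_PiM (border_index n) \<partial>gauss)"
    unfolding gauss_PiM_def using disj
    by (intro nn_integral_cong gauss_prod.product_nn_integral_fold f') auto
  also have "\<dots> = (\<integral>\<^sup>+z. \<integral>\<^sup>+y. \<integral>\<^sup>+x. g (sym_of_coords n x) (vec n (\<lambda>i. y (i, n))) z
        \<partial>gauss_coords n \<partial>gauss_PiM (border_index n) \<partial>gauss)"
    unfolding red ..
  finally show ?thesis .
qed

text \<open>
Sections at a fixed border, obtained by extending coordinates of the leading block by the constants
\<open>v\<close> and \<open>z\<close>.
\<close>
lemma measurable_border_section:
  fixes g :: "real mat \<Rightarrow> real vec \<Rightarrow> real \<Rightarrow> ennreal"
  assumes g: "(\<lambda>x. g (sym_of_coords n x) (vec n (\<lambda>i. x (i, n))) (x (n, n)))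
    \<in> borel_measurable (\<Pi>\<^sub>M p\<in>sym_index (Suc n). borel)"
    and v: "v \<in> carrier_vec n"
  shows "(\<lambda>x. g (sym_of_coords n x) v z) \<in> borel_measurable (\<Pi>\<^sub>M p\<in>sym_index n. borel)"
proof -
  define ext where "ext x = (\<lambda>p\<in>sym_index (Suc n). if p = (n, n) then z else if snd p = n then v $ fst p else x p)"
    for x :: "nat \<times> nat \<Rightarrow> real"
  have "ext \<in> measurable (\<Pi>\<^sub>M p\<in>sym_index n. borel) (\<Pi>\<^sub>M p\<in>sym_index (Suc n). borel)"
    unfolding ext_def
  proof (rule measurable_restrict)
    fix p assume p: "p \<in> sym_index (Suc n)"
    show "(\<lambda>x. if p = (n, n) then z else if snd p = n then v $ fst p else x p) \<in> borel_measurable (\<Pi>\<^sub>M p\<in>sym_index n. borel)"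
    proof (cases "snd p = n")
      case True
      then show ?thesis by (cases "p = (n, n)") auto
    next
      case False
      then have "p \<in> sym_index n" using p by (auto simp: sym_index_Suc border_index_def)
      then show ?thesis using False by (auto intro!: measurable_component_singleton)
    qed
  qed
  then have "(\<lambda>x. g (sym_of_coords n (ext x)) (vec n (\<lambda>i. ext x (i, n))) (ext x (n, n)))
      \<in> borel_measurable (\<Pi>\<^sub>M p\<in>sym_index n. borel)"
    by (rule measurable_compose[OF _ g])
  moreover have "sym_of_coords n (ext x) = sym_of_coords n x" for x
    by (intro sym_of_coords_cong) (auto simp: ext_def sym_index_def)
  moreover have "vec n (\<lambda>i. ext x (i, n)) = v" for x
    using v by (intro eq_vecI) (auto simp: ext_def sym_index_def)
  moreover have "ext x (n, n) = z" for x by (simp add: ext_def sym_index_def)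
  ultimately show ?thesis by simp
qed

definition det_sq_mean :: "nat \<Rightarrow> ennreal" where
  "det_sq_mean n = (\<integral>\<^sup>+x. ennreal ((Determinant.det (sym_of_coords n x))\<^sup>2) \<partial>gauss_coords n)"

lemma det_sym_of_coords_Suc:
  "Determinant.det (sym_of_coords (Suc n) x) = sqrt 2 * x (n, n) * Determinant.det (sym_of_coords n x)
     + Determinant.det (bordered n (sym_of_coords n x) (vec n (\<lambda>i. x (i, n))) 0)"
  unfolding sym_of_coords_Suc by (rule det_bordered_affine) simp

lemma measurable_det_border:
  "(\<lambda>x. Determinant.det (bordered n (sym_of_coords n x) (vec n (\<lambda>i. x (i, n))) 0))
     \<in> borel_measurable (\<Pi>\<^sub>M p\<in>sym_index (Suc n). borel)"
proof -
  have "(\<lambda>x. Determinant.det (bordered n (sym_of_coords n x) (vec n (\<lambda>i. x (i, n))) 0))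
    = (\<lambda>x. Determinant.det (sym_of_coords (Suc n) x) - sqrt 2 * x (n, n) * Determinant.det (sym_of_coords n x))"
    unfolding det_sym_of_coords_Suc by simp
  also have "\<dots> \<in> borel_measurable (\<Pi>\<^sub>M p\<in>sym_index (Suc n). borel)"
    by (intro borel_measurable_diff borel_measurable_times borel_measurable_const measurable_det_sym
        measurable_component_singleton sym_index_mono_Suc order_refl) (simp add: sym_index_Suc)
  finally show ?thesis .
qed

lemma nn_integral_minor_det_sq:
  "(\<integral>\<^sup>+x. ennreal ((Determinant.det (sym_of_coords n x))\<^sup>2) \<partial>gauss_coords (Suc n)) = det_sq_mean n"
proof -
  interpret B: prob_space "gauss_PiM (border_index n)" by (rule prob_space_gauss_PiM)
  have "(\<lambda>x. ennreal ((Determinant.det (sym_of_coords n x))\<^sup>2)) \<in> borel_measurable (\<Pi>\<^sub>M p\<in>sym_index (Suc n). borel)"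
    by (intro measurable_compose[OF _ measurable_ennreal] borel_measurable_power measurable_det_sym sym_index_mono_Suc)
  from nn_integral_gauss_coords_Suc[of "\<lambda>B v z. ennreal ((Determinant.det B)\<^sup>2)", OF this]
  show ?thesis
    by (simp add: B.emeasure_space_1 gauss.emeasure_space_1[simplified] flip: det_sq_mean_def)
qed

text \<open>
The law of the leading block is invariant under reflections, so the border \<open>v\<close> may be moved into the
last axis, where \<open>det_bordered_axis\<close> evaluates the determinant. For \<open>n = 0\<close> both sides vanish, since
then \<open>v \<bullet> v = 0\<close>.
\<close>
lemma nn_integral_det_bordered_sq:
  assumes v: "v \<in> carrier_vec n"
  shows "(\<integral>\<^sup>+x. ennreal ((Determinant.det (bordered n (sym_of_coords n x) v 0))\<^sup>2) \<partial>gauss_coords n)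
    = ennreal ((v \<bullet> v)\<^sup>2) * det_sq_mean (n - 1)"
proof (cases n)
  case 0
  have "Determinant.det (bordered n (sym_of_coords n x) v 0) = 0" for x
    using det_single[of "bordered 0 (sym_of_coords 0 x) v 0"] bordered_carrier[of "sym_of_coords 0 x" 0 v 0]
    by (simp add: 0 bordered_index)
  then show ?thesis using 0 v by (simp add: scalar_prod_def)
next
  case (Suc k)
  obtain Q where Q: "is_reflection n Q" and Qv: "Q *\<^sub>v v = sqrt (v \<bullet> v) \<cdot>\<^sub>v unit_vec n k"
    using ex_reflection_to_axis[OF v, of k] Suc by auto
  note q = is_reflectionD[OF Q]
  have vv: "v \<bullet> v \<ge> 0" using v by (simp add: scalar_prod_def sum_nonneg)
  let ?F = "\<lambda>B. ennreal ((Determinant.det (bordered n B v 0))\<^sup>2)"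
  have F: "(\<lambda>x. ?F (sym_of_coords n x)) \<in> borel_measurable (\<Pi>\<^sub>M p\<in>sym_index n. borel)"
    by (rule measurable_border_section[of "\<lambda>B v z. ennreal ((Determinant.det (bordered n B v 0))\<^sup>2)" n, OF _ v])
       (intro measurable_compose[OF _ measurable_ennreal] borel_measurable_power measurable_det_border)
  have "(\<integral>\<^sup>+x. ?F (sym_of_coords n x) \<partial>gauss_coords n) = (\<integral>\<^sup>+x. ?F (Q * sym_of_coords n x * Q) \<partial>gauss_coords n)"
    by (rule nn_integral_gauss_coords_reflection[OF Q F, symmetric])
  also have "\<dots> = (\<integral>\<^sup>+x. ennreal ((v \<bullet> v)\<^sup>2) * ennreal ((Determinant.det (sym_of_coords k x))\<^sup>2) \<partial>gauss_coords n)"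
  proof (rule nn_integral_cong)
    fix x
    have "v = Q *\<^sub>v (Q *\<^sub>v v)" using q v by (simp flip: assoc_mult_mat_vec[of Q n n Q n v])
    then have "Determinant.det (bordered n (Q * sym_of_coords n x * Q) v 0)
      = Determinant.det (bordered n (Q * sym_of_coords n x * Q) (Q *\<^sub>v (Q *\<^sub>v v)) 0)" by simp
    also have "\<dots> = Determinant.det (bordered n (sym_of_coords n x) (Q *\<^sub>v v) 0)"
      using q v by (intro det_bordered_conj[OF Q]) auto
    also have "\<dots> = - ((v \<bullet> v) * Determinant.det (sym_of_coords k x))"
      unfolding Qv unfolding Suc sym_of_coords_Suc using vv by (simp add: det_bordered_axis)
    finally show "?F (Q * sym_of_coords n x * Q) = ennreal ((v \<bullet> v)\<^sup>2) * ennreal ((Determinant.det (sym_of_coords k x))\<^sup>2)"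
      by (simp add: power_mult_distrib ennreal_mult)
  qed
  also have "\<dots> = ennreal ((v \<bullet> v)\<^sup>2) * (\<integral>\<^sup>+x. ennreal ((Determinant.det (sym_of_coords k x))\<^sup>2) \<partial>gauss_coords n)"
  proof (rule nn_integral_cmult)
    have "(\<lambda>x. ennreal ((Determinant.det (sym_of_coords k x))\<^sup>2)) \<in> borel_measurable (\<Pi>\<^sub>M p\<in>sym_index n. borel)"
      unfolding Suc by (intro measurable_compose[OF _ measurable_ennreal] borel_measurable_power measurable_det_sym sym_index_mono_Suc)
    then show "(\<lambda>x. ennreal ((Determinant.det (sym_of_coords k x))\<^sup>2)) \<in> borel_measurable (gauss_coords n)"
      by (subst measurable_cong_sets[OF sets_gauss_PiM refl])
  qed
  finally show ?thesis unfolding Suc by (simp add: nn_integral_minor_det_sq)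
qed

text \<open>
Changing the sign of the corner entry preserves the measure and the exponential and changes the sign of
the cross term in the square of \<open>a det B + W\<close>. Averaging over the two signs before integrating
removes that term and keeps all integrands nonnegative.
\<close>
lemma nn_integral_det_sq_sign_average:
  shows "(\<integral>\<^sup>+x. ennreal ((Determinant.det (sym_of_coords (Suc n) x))\<^sup>2
            * exp (- (u * ((\<Sum>i<n. (x (i, n))\<^sup>2) + 2 * (x (n, n))\<^sup>2)))) \<partial>gauss_coords (Suc n))
    = (\<integral>\<^sup>+x. ennreal ((2 * (x (n, n))\<^sup>2 * (Determinant.det (sym_of_coords n x))\<^sup>2
            + (Determinant.det (bordered n (sym_of_coords n x) (vec n (\<lambda>i. x (i, n))) 0))\<^sup>2)
            * exp (- (u * ((\<Sum>i<n. (x (i, n))\<^sup>2) + 2 * (x (n, n))\<^sup>2)))) \<partial>gauss_coords (Suc n))"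
    (is "(\<integral>\<^sup>+x. ?f x \<partial>?M) = (\<integral>\<^sup>+x. ?h x \<partial>?M)")
proof -
  let ?I = "sym_index (Suc n)"
  define D where "D x = Determinant.det (sym_of_coords n x)" for x
  define W where "W x = Determinant.det (bordered n (sym_of_coords n x) (vec n (\<lambda>i. x (i, n))) 0)" for x
  define e where "e x = exp (- (u * ((\<Sum>i<n. (x (i, n))\<^sup>2) + 2 * (x (n, n))\<^sup>2)))" for x :: "nat \<times> nat \<Rightarrow> real"
  have nn: "(n, n) \<in> ?I" and inn: "i < n \<Longrightarrow> (i, n) \<in> ?I" for i
    by (auto simp: sym_index_def)
  have nn': "p \<noteq> (n, n)" if "p \<in> sym_index n" for p
    using that by (auto simp: sym_index_def)
  have D [measurable]: "D \<in> borel_measurable (\<Pi>\<^sub>M p\<in>?I. borel)"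
    unfolding D_def by (rule measurable_det_sym[OF sym_index_mono_Suc])
  have W [measurable]: "W \<in> borel_measurable (\<Pi>\<^sub>M p\<in>?I. borel)"
    unfolding W_def by (rule measurable_det_border)
  have x [measurable]: "(\<lambda>x. x (n, n) :: real) \<in> borel_measurable (\<Pi>\<^sub>M p\<in>?I. borel)"
    using nn by (rule measurable_component_singleton)
  have e [measurable]: "e \<in> borel_measurable (\<Pi>\<^sub>M p\<in>?I. borel)"
    unfolding e_def
    by (intro measurable_compose[OF _ borel_measurable_exp] borel_measurable_uminus borel_measurable_times
        borel_measurable_add borel_measurable_sum borel_measurable_power borel_measurable_const
        measurable_component_singleton inn nn) simp
  have f_eq: "?f x = ennreal ((sqrt 2 * x (n, n) * D x + W x)\<^sup>2 * e x)" for x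
    unfolding det_sym_of_coords_Suc D_def W_def e_def ..
  have h_eq: "?h x = ennreal ((2 * (x (n, n))\<^sup>2 * (D x)\<^sup>2 + (W x)\<^sup>2) * e x)" for x
    unfolding D_def W_def e_def ..
  have f: "?f \<in> borel_measurable (\<Pi>\<^sub>M p\<in>?I. borel)" unfolding f_eq by measurable
  have h: "?h \<in> borel_measurable (\<Pi>\<^sub>M p\<in>?I. borel)" unfolding h_eq by measurable
  define T where "T x = (\<lambda>p\<in>?I. if p = (n, n) then - x p else x p)" for x :: "nat \<times> nat \<Rightarrow> real"
  have T: "T \<in> measurable (\<Pi>\<^sub>M p\<in>?I. borel) (\<Pi>\<^sub>M p\<in>?I. borel)"
    unfolding T_def
  proof (rule measurable_restrict)
    fix p assume p: "p \<in> ?I"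
    then have xp: "(\<lambda>x. x p :: real) \<in> borel_measurable (\<Pi>\<^sub>M p\<in>?I. borel)"
      by (rule measurable_component_singleton)
    show "(\<lambda>x. if p = (n, n) then - x p else x p :: real) \<in> borel_measurable (\<Pi>\<^sub>M p\<in>?I. borel)"
    proof (cases "p = (n, n)")
      case True
      show ?thesis using borel_measurable_uminus[OF x] by (simp only: True refl if_True)
    next
      case False
      show ?thesis using xp by (simp only: False if_False)
    qed
  qed
  \<comment> \<open>flipping the sign of the corner coordinate is an isometry\<close>
  have fT: "(\<integral>\<^sup>+x. ?f (T x) \<partial>?M) = (\<integral>\<^sup>+x. ?f x \<partial>?M)"
  proof (rule nn_integral_gauss_PiM_isometry[OF finite_sym_index T _ _ _ f])
    fix x y :: "nat \<times> nat \<Rightarrow> real"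
    show "T (\<lambda>i\<in>?I. x i + y i) = (\<lambda>i\<in>?I. T x i + T y i)"
      by (auto simp: T_def fun_eq_iff)
  next
    fix y assume y: "y \<in> ?I \<rightarrow>\<^sub>E (UNIV :: real set)"
    have "T (T y) = y"
    proof (rule PiE_ext[OF _ y])
      show "T (T y) \<in> ?I \<rightarrow>\<^sub>E UNIV" by (simp add: T_def)
      show "T (T y) i = y i" if "i \<in> ?I" for i using that by (auto simp: T_def)
    qed
    moreover have "T y \<in> ?I \<rightarrow>\<^sub>E UNIV" by (simp add: T_def)
    ultimately show "\<exists>x\<in>?I \<rightarrow>\<^sub>E UNIV. T x = y" by blast
  next
    fix x
    show "(\<Sum>i\<in>?I. (T x i)\<^sup>2) = (\<Sum>i\<in>?I. (x i)\<^sup>2)"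
      by (intro sum.cong) (auto simp: T_def)
  qed
  have flip: "D (T x) = D x" "W (T x) = W x" "e (T x) = e x" "T x (n, n) = - x (n, n)" for x
  proof -
    have S: "sym_of_coords n (T x) = sym_of_coords n x"
      using sym_index_mono_Suc[of n] nn' by (intro sym_of_coords_cong) (auto simp: T_def)
    have v: "T x (i, n) = x (i, n)" if "i < n" for i
      using that inn[OF that] by (simp add: T_def)
    have "vec n (\<lambda>i. T x (i, n)) = vec n (\<lambda>i. x (i, n))"
      by (intro eq_vecI) (auto simp: v)
    with S show "D (T x) = D x" "W (T x) = W x" by (simp_all add: D_def W_def)
    show tn: "T x (n, n) = - x (n, n)" using nn by (simp add: T_def)
    show "e (T x) = e x" unfolding e_def tn by (simp add: v)
  qed
  have [measurable_cong]: "sets ?M = sets (\<Pi>\<^sub>M p\<in>?I. borel)" by (rule sets_gauss_PiM)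
  have fM: "?f \<in> borel_measurable ?M" "(\<lambda>x. ?f (T x)) \<in> borel_measurable ?M" "?h \<in> borel_measurable ?M"
    using f h measurable_compose[OF T f] by (simp_all only: measurable_cong_sets[OF sets_gauss_PiM refl])
  have "2 * (\<integral>\<^sup>+x. ?f x \<partial>?M) = (\<integral>\<^sup>+x. ?f x \<partial>?M) + (\<integral>\<^sup>+x. ?f (T x) \<partial>?M)"
    unfolding fT by (rule mult_2)
  also have "\<dots> = (\<integral>\<^sup>+x. ?f x + ?f (T x) \<partial>?M)"
    using fM by (intro nn_integral_add[symmetric])
  also have "\<dots> = (\<integral>\<^sup>+x. 2 * ?h x \<partial>?M)"
  proof (rule nn_integral_cong)
    fix x
    have e0: "e x \<ge> 0" by (simp add: e_def)
    have "?f x + ?f (T x) = ennreal ((sqrt 2 * x (n, n) * D x + W x)\<^sup>2 * e x + (sqrt 2 * - x (n, n) * D x + W x)\<^sup>2 * e x)"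
      unfolding f_eq unfolding flip using e0 by (simp add: ennreal_plus[symmetric] del: ennreal_plus)
    also have "(sqrt 2 * x (n, n) * D x + W x)\<^sup>2 * e x + (sqrt 2 * - x (n, n) * D x + W x)\<^sup>2 * e x
      = 2 * ((2 * (x (n, n))\<^sup>2 * (D x)\<^sup>2 + (W x)\<^sup>2) * e x)"
    proof -
      have *: "(a + w)\<^sup>2 * k + (- a + w)\<^sup>2 * k = 2 * ((a\<^sup>2 + w\<^sup>2) * k)" for a w k :: real
        by (simp add: power2_eq_square algebra_simps)
      show ?thesis
        using *[of "sqrt 2 * x (n, n) * D x" "W x" "e x"] by (simp add: power_mult_distrib)
    qed
    also have "ennreal \<dots> = 2 * ?h x"
      unfolding h_eq using e0 by (simp add: ennreal_mult)
    finally show "?f x + ?f (T x) = 2 * ?h x" .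
  qed
  also have "\<dots> = 2 * (\<integral>\<^sup>+x. ?h x \<partial>?M)"
    using fM by (intro nn_integral_cmult)
  finally show ?thesis by (simp add: ennreal_mult_cancel_left)
qed

text \<open>
The weight \<open>exp (- u T)\<close>, with \<open>T\<close> the squared norm of the last column, factors over the corner entry
and the rest of the column, so the integral is a sum of two products of Gaussian moments. The corner
entry is \<open>sqrt 2\<close> times a coordinate; hence \<open>1 + 2 u\<close> in place of \<open>1 + u\<close>.
\<close>
lemma nn_integral_det_sq_exp_border:
  assumes u: "u \<ge> 0"
  shows "(\<integral>\<^sup>+x. ennreal ((Determinant.det (sym_of_coords (Suc n) x))\<^sup>2
            * exp (- (u * ((\<Sum>i<n. (x (i, n))\<^sup>2) + 2 * (x (n, n))\<^sup>2)))) \<partial>gauss_coords (Suc n))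
    = ennreal ((1 + 2 * u) powr (- 3 / 2) * (1 + u) powr (- real n / 2)) * det_sq_mean n
    + ennreal (real n * (real n + 2) / 4 * ((1 + 2 * u) powr (- 1 / 2) * (1 + u) powr (- real n / 2 - 2))) * det_sq_mean (n - 1)"
proof -
  let ?B = "border_index n"
  define g where "g B v z = ennreal ((2 * z\<^sup>2 * (Determinant.det B)\<^sup>2 + (Determinant.det (bordered n B v 0))\<^sup>2)
      * exp (- (u * (v \<bullet> v + 2 * z\<^sup>2))))" for B :: "real mat" and v :: "real vec" and z :: real
  have vv: "vec n (\<lambda>i. x (i, n)) \<bullet> vec n (\<lambda>i. x (i, n)) = (\<Sum>i<n. (x (i, n))\<^sup>2)" for x :: "nat \<times> nat \<Rightarrow> real"
    by (simp add: scalar_prod_def power2_eq_square atLeast0LessThan)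
  have g_eq: "ennreal ((2 * (x (n, n))\<^sup>2 * (Determinant.det (sym_of_coords n x))\<^sup>2
            + (Determinant.det (bordered n (sym_of_coords n x) (vec n (\<lambda>i. x (i, n))) 0))\<^sup>2)
            * exp (- (u * ((\<Sum>i<n. (x (i, n))\<^sup>2) + 2 * (x (n, n))\<^sup>2))))
       = g (sym_of_coords n x) (vec n (\<lambda>i. x (i, n))) (x (n, n))" for x
    unfolding g_def vv ..
  have nn: "(n, n) \<in> sym_index (Suc n)" and inn: "i < n \<Longrightarrow> (i, n) \<in> sym_index (Suc n)" for i
    by (auto simp: sym_index_def)
  have meas: "(\<lambda>x. g (sym_of_coords n x) (vec n (\<lambda>i. x (i, n))) (x (n, n))) \<in> borel_measurable (\<Pi>\<^sub>M p\<in>sym_index (Suc n). borel)"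
    unfolding g_def vv
    by (intro measurable_compose[OF _ measurable_ennreal] measurable_compose[OF _ borel_measurable_exp]
        borel_measurable_uminus borel_measurable_times borel_measurable_add borel_measurable_sum
        borel_measurable_power borel_measurable_const measurable_component_singleton inn nn
        measurable_det_border measurable_det_sym sym_index_mono_Suc) simp
  have Dm: "(\<lambda>x. ennreal ((Determinant.det (sym_of_coords n x))\<^sup>2)) \<in> borel_measurable (gauss_coords n)"
    unfolding measurable_cong_sets[OF sets_gauss_PiM refl]
    by (intro measurable_compose[OF _ measurable_ennreal] borel_measurable_power measurable_det_sym order_refl)
  have Wm: "(\<lambda>x. ennreal ((Determinant.det (bordered n (sym_of_coords n x) v 0))\<^sup>2)) \<in> borel_measurable (gauss_coords n)"
    if v: "v \<in> carrier_vec n" for v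
    unfolding measurable_cong_sets[OF sets_gauss_PiM refl]
    by (rule measurable_border_section[of "\<lambda>B v z. ennreal ((Determinant.det (bordered n B v 0))\<^sup>2)" n, OF _ v])
       (intro measurable_compose[OF _ measurable_ennreal] borel_measurable_power measurable_det_border)
  define P where "P = det_sq_mean n"
  define P' where "P' = det_sq_mean (n - 1)"
  let ?r = "\<lambda>y. \<Sum>p\<in>?B. (y p)\<^sup>2"
  have inner: "(\<integral>\<^sup>+x. g (sym_of_coords n x) (vec n (\<lambda>i. y (i, n))) z \<partial>gauss_coords n)
     = ennreal (2 * (z\<^sup>2 * exp (- (2 * u * z\<^sup>2)))) * P * ennreal (exp (- (u * ?r y)))
     + ennreal (exp (- (2 * u * z\<^sup>2))) * P' * ennreal ((?r y)\<^sup>2 * exp (- (u * ?r y)))" for y z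
  proof -
    let ?v = "vec n (\<lambda>i. y (i, n))"
    let ?c = "ennreal (2 * (z\<^sup>2 * exp (- (2 * u * z\<^sup>2)))) * ennreal (exp (- (u * ?r y)))"
    let ?d = "ennreal (exp (- (2 * u * z\<^sup>2))) * ennreal (exp (- (u * ?r y)))"
    have ex: "exp (- (u * (?r y + 2 * z\<^sup>2))) = exp (- (2 * u * z\<^sup>2)) * exp (- (u * ?r y))"
      by (simp add: exp_add[symmetric] distrib_left)
    have "(\<integral>\<^sup>+x. g (sym_of_coords n x) ?v z \<partial>gauss_coords n)
      = (\<integral>\<^sup>+x. ?c * ennreal ((Determinant.det (sym_of_coords n x))\<^sup>2)
           + ?d * ennreal ((Determinant.det (bordered n (sym_of_coords n x) ?v 0))\<^sup>2) \<partial>gauss_coords n)"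
      unfolding g_def vv sum_border_index[of "\<lambda>p. (y p)\<^sup>2", symmetric] ex
      by (intro nn_integral_cong) (simp add: distrib_left distrib_right mult_ac flip: ennreal_mult ennreal_plus)
    also have "\<dots> = ?c * P + ?d * (ennreal ((?v \<bullet> ?v)\<^sup>2) * P')"
      unfolding P_def P'_def
      using nn_integral_add[OF borel_measurable_times_ennreal[OF measurable_const Dm] borel_measurable_times_ennreal[OF measurable_const Wm[of ?v]]]
        nn_integral_cmult[OF Dm] nn_integral_cmult[OF Wm[of ?v]]
      by (simp add: det_sq_mean_def[symmetric] nn_integral_det_bordered_sq)
    also have "ennreal ((?v \<bullet> ?v)\<^sup>2) = ennreal ((?r y)\<^sup>2)"
      unfolding vv sum_border_index ..
    finally show ?thesis by (simp add: ennreal_mult mult_ac)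
  qed
  have rm [measurable]: "?r \<in> borel_measurable (gauss_PiM ?B)"
    unfolding measurable_cong_sets[OF sets_gauss_PiM refl] by measurable
  let ?m0 = "ennreal ((1 + u) powr (- real n / 2))"
  let ?m2 = "ennreal (real n * (real n + 2) / 4 * (1 + u) powr (- real n / 2 - 2))"
  have mid: "(\<integral>\<^sup>+y. \<integral>\<^sup>+x. g (sym_of_coords n x) (vec n (\<lambda>i. y (i, n))) z \<partial>gauss_coords n \<partial>gauss_PiM ?B)
     = 2 * P * ?m0 * ennreal (z\<^sup>2 * exp (- (2 * u * z\<^sup>2))) + P' * ?m2 * ennreal (exp (- (2 * u * z\<^sup>2)))" for z
    unfolding inner using gauss_PiM_sq_norm_moments[OF u finite_border_index[of n]]
    by (subst nn_integral_add, simp, simp, subst (1 2) nn_integral_cmult, simp, simp) (simp add: ennreal_mult mult_ac)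
  have u2: "2 * u \<ge> 0" using u by simp
  have "(\<integral>\<^sup>+x. ennreal ((Determinant.det (sym_of_coords (Suc n) x))\<^sup>2
            * exp (- (u * ((\<Sum>i<n. (x (i, n))\<^sup>2) + 2 * (x (n, n))\<^sup>2)))) \<partial>gauss_coords (Suc n))
    = (\<integral>\<^sup>+z. \<integral>\<^sup>+y. \<integral>\<^sup>+x. g (sym_of_coords n x) (vec n (\<lambda>i. y (i, n))) z \<partial>gauss_coords n \<partial>gauss_PiM ?B \<partial>gauss)"
    unfolding nn_integral_det_sq_sign_average g_eq by (rule nn_integral_gauss_coords_Suc[OF meas])
  also have "\<dots> = 2 * P * ?m0 * ennreal (1 / 2 * (1 + 2 * u) powr (- 3 / 2)) + P' * ?m2 * ennreal ((1 + 2 * u) powr (- 1 / 2))"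
    unfolding mid using gauss_moment[OF u2, of 0] gauss_moment[OF u2, of 1]
    by (subst nn_integral_add, simp, simp, subst (1 2) nn_integral_cmult, simp, simp) simp
  also have "2 * P * ?m0 * ennreal (1 / 2 * (1 + 2 * u) powr (- 3 / 2)) = P * ?m0 * ennreal ((1 + 2 * u) powr (- 3 / 2))"
  proof -
    have "2 * P * ?m0 * ennreal (1 / 2 * (1 + 2 * u) powr (- 3 / 2)) = P * ?m0 * (2 * ennreal (1 / 2 * (1 + 2 * u) powr (- 3 / 2)))"
      by (simp only: mult_ac)
    also have "2 * ennreal (1 / 2 * (1 + 2 * u) powr (- 3 / 2)) = ennreal ((1 + 2 * u) powr (- 3 / 2))"
      using ennreal_mult[of 2 "1 / 2 * (1 + 2 * u) powr (- 3 / 2)"] by simp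
    finally show ?thesis .
  qed
  also have "P * ?m0 * ennreal ((1 + 2 * u) powr (- 3 / 2))
      = ennreal ((1 + 2 * u) powr (- 3 / 2) * (1 + u) powr (- real n / 2)) * P"
    by (subst ennreal_mult) (simp_all only: powr_ge_zero mult_ac)
  also have "P' * ?m2 * ennreal ((1 + 2 * u) powr (- 1 / 2))
      = (?m2 * ennreal ((1 + 2 * u) powr (- 1 / 2))) * P'"
    by (simp only: mult_ac)
  also have "?m2 * ennreal ((1 + 2 * u) powr (- 1 / 2))
      = ennreal (real n * (real n + 2) / 4 * (1 + u) powr (- real n / 2 - 2) * (1 + 2 * u) powr (- 1 / 2))"
    by (rule ennreal_mult[symmetric]) simp_all
  finally show ?thesis unfolding P_def P'_def by (simp only: mult_ac)
qed

lemma det_sq_mean_Suc: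
  "det_sq_mean (Suc n) = det_sq_mean n + ennreal (real n * (real n + 2) / 4) * det_sq_mean (n - 1)"
  using nn_integral_det_sq_exp_border[of 0 n] by (simp add: det_sq_mean_def)

lemma det_sq_mean_0: "det_sq_mean 0 = 1"
proof -
  interpret prob_space "gauss_coords 0" by (rule prob_space_gauss_PiM)
  show ?thesis using emeasure_space_1 by (simp add: det_sq_mean_def)
qed

section \<open>From the absolute value of the determinant to its square\<close>

text \<open>
The factor \<open>(det A)\<^sup>2\<close> extends the identity to singular \<open>A\<close>, where the integral may be infinite,
because zero times infinity is zero in the extended nonnegative reals.
\<close>
lemma det_sq_mult_nn_integral_exp_neg_sq_norm:
  fixes A :: "real mat"
  assumes A: "A \<in> carrier_mat n n"
  shows "ennreal ((Determinant.det A)\<^sup>2) * (\<integral>\<^sup>+y. ennreal (exp (- ((A *\<^sub>v vec n y) \<bullet> (A *\<^sub>v vec n y)))) \<partial>(\<Pi>\<^sub>M i\<in>{..<n}. lborel))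
    = ennreal (sqrt pi ^ n) * ennreal \<bar>Determinant.det A\<bar>"
proof (cases "Determinant.det A = 0")
  case True
  then show ?thesis by simp
next
  case False
  have "ennreal ((Determinant.det A)\<^sup>2) * ennreal (sqrt pi ^ n / \<bar>Determinant.det A\<bar>)
      = ennreal ((Determinant.det A)\<^sup>2 * (sqrt pi ^ n / \<bar>Determinant.det A\<bar>))"
    by (rule ennreal_mult[symmetric]) simp_all
  also have "(Determinant.det A)\<^sup>2 * (sqrt pi ^ n / \<bar>Determinant.det A\<bar>) = sqrt pi ^ n * \<bar>Determinant.det A\<bar>"
    using False by (simp add: power2_eq_square field_simps abs_mult_self_eq)
  also have "ennreal \<dots> = ennreal (sqrt pi ^ n) * ennreal \<bar>Determinant.det A\<bar>"
    by (rule ennreal_mult) simp_all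
  finally show ?thesis
    unfolding nn_integral_exp_neg_sq_norm[OF A False] .
qed

lemma nn_integral_PiM_exp_neg_sq:
  assumes "finite I" "t > 0"
  shows "(\<integral>\<^sup>+y. ennreal (exp (- ((\<Sum>i\<in>I. (y i)\<^sup>2) * t))) \<partial>(\<Pi>\<^sub>M i\<in>I. lborel))
    = ennreal (sqrt pi ^ card I) * ennreal (t powr (- real (card I) / 2))"
proof -
  have "(\<integral>\<^sup>+y. ennreal (exp (- ((\<Sum>i\<in>I. (y i)\<^sup>2) * t))) \<partial>(\<Pi>\<^sub>M i\<in>I. lborel))
     = (\<integral>\<^sup>+y. (\<Prod>i\<in>I. ennreal (exp (- (t * (y i)\<^sup>2)))) \<partial>(\<Pi>\<^sub>M i\<in>I. lborel))"
    using assms by (intro nn_integral_cong)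
      (simp add: prod_ennreal exp_sum[symmetric] sum_negf sum_distrib_left mult.commute)
  also have "\<dots> = (\<Prod>i\<in>I. \<integral>\<^sup>+y. ennreal (exp (- (t * y\<^sup>2))) \<partial>lborel)"
    using assms by (intro lborel_prod.product_nn_integral_prod) auto
  also have "\<dots> = ennreal (sqrt (pi / t) ^ card I)"
    unfolding nn_integral_exp_mult_sq[OF assms(2)] using assms(2) by (simp add: ennreal_power)
  also have "sqrt (pi / t) ^ card I = sqrt pi ^ card I * t powr (- real (card I) / 2)"
  proof -
    have "t powr (- real (card I) / 2) = (t powr (- (1 / 2))) powr real (card I)"
      by (simp add: powr_powr)
    also have "\<dots> = (1 / sqrt t) ^ card I"
      using assms(2) by (simp add: powr_minus_divide powr_half_sqrt powr_realpow)
    finally show ?thesis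
      by (simp add: real_sqrt_divide power_divide)
  qed
  also have "ennreal \<dots> = ennreal (sqrt pi ^ card I) * ennreal (t powr (- real (card I) / 2))"
    by (rule ennreal_mult) simp_all
  finally show ?thesis .
qed

text \<open>
The squared norm of the last column of the symmetric matrix of size \<open>n + 1\<close> with coordinates \<open>x\<close>; the
factor 2 comes from the diagonal basis elements, which carry the factor \<open>sqrt 2\<close>.
\<close>
definition last_col_sq :: "nat \<Rightarrow> (nat \<times> nat \<Rightarrow> real) \<Rightarrow> real" where
  "last_col_sq n x = (\<Sum>i<n. (x (i, n))\<^sup>2) + 2 * (x (n, n))\<^sup>2"

lemma last_col_sq_nonneg: "last_col_sq n x \<ge> 0"
  by (simp add: last_col_sq_def sum_nonneg)

lemma last_col_sq_eq:
  "last_col_sq n x = (\<Sum>i<Suc n. (sym_of_coords (Suc n) x $$ (i, n))\<^sup>2)"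
  by (simp add: last_col_sq_def sym_of_coords_index power_mult_distrib)

lemma det_eq_0_of_last_col_sq:
  assumes "last_col_sq n x = 0"
  shows "Determinant.det (sym_of_coords (Suc n) x) = 0"
proof -
  have "(\<Sum>i<Suc n. (sym_of_coords (Suc n) x $$ (i, n))\<^sup>2) = 0"
    using assms by (simp only: last_col_sq_eq)
  then have "sym_of_coords (Suc n) x $$ (i, n) = 0" if "i < Suc n" for i
    using that by (subst (asm) sum_nonneg_eq_0_iff) auto
  then show ?thesis
    by (subst laplace_expansion_column[of _ "Suc n" n]) auto
qed

lemma measurable_last_col_sq: "last_col_sq n \<in> borel_measurable (gauss_coords (Suc n))"
proof -
  have "(i, n) \<in> sym_index (Suc n)" if "i \<le> n" for i using that by (auto simp: sym_index_def)
  then show ?thesis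
    unfolding last_col_sq_def measurable_cong_sets[OF sets_gauss_PiM refl]
    by (intro borel_measurable_add borel_measurable_sum borel_measurable_power borel_measurable_times
        borel_measurable_const measurable_component_singleton) auto
qed

lemma measurable_det_gauss_coords:
  "(\<lambda>x. Determinant.det (sym_of_coords n x)) \<in> borel_measurable (gauss_coords n)"
  unfolding measurable_cong_sets[OF sets_gauss_PiM refl] by (rule measurable_det_sym) simp

text \<open>
Conjugate by a reflection that maps \<open>y\<close> to \<open>|y|\<close> times the last basis vector.
\<close>
lemma nn_integral_det_sq_exp_rotate:
  fixes y :: "nat \<Rightarrow> real"
  shows "(\<integral>\<^sup>+x. ennreal ((Determinant.det (sym_of_coords (Suc n) x))\<^sup>2
            * exp (- (\<Sum>i<Suc n. (\<Sum>j<Suc n. sym_of_coords (Suc n) x $$ (i, j) * y j)\<^sup>2))) \<partial>gauss_coords (Suc n))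
    = (\<integral>\<^sup>+x. ennreal ((Determinant.det (sym_of_coords (Suc n) x))\<^sup>2
            * exp (- ((\<Sum>i<Suc n. (y i)\<^sup>2) * last_col_sq n x))) \<partial>gauss_coords (Suc n))"
proof -
  let ?N = "Suc n"
  let ?S = "sym_of_coords ?N"
  define w where "w = vec ?N y"
  have w: "w \<in> carrier_vec ?N" by (simp add: w_def)
  have ww: "w \<bullet> w = (\<Sum>i<?N. (y i)\<^sup>2)"
    by (simp add: w_def scalar_prod_def power2_eq_square atLeast0LessThan)
  have ww0: "w \<bullet> w \<ge> 0" unfolding ww by (rule sum_nonneg) simp
  obtain Q where Q: "is_reflection ?N Q" and Qw: "Q *\<^sub>v w = sqrt (w \<bullet> w) \<cdot>\<^sub>v unit_vec ?N n"
    using ex_reflection_to_axis[OF w, of n] by auto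
  note q = is_reflectionD[OF Q]
  define F where "F A = ennreal ((Determinant.det A)\<^sup>2 * exp (- ((A *\<^sub>v w) \<bullet> (A *\<^sub>v w))))" for A
  have smult_sq: "(a \<cdot>\<^sub>v vec m f) \<bullet> (a \<cdot>\<^sub>v vec m f) = a\<^sup>2 * (\<Sum>i<m. (f i)\<^sup>2)"
    for a :: real and m :: nat and f :: "nat \<Rightarrow> real"
    by (simp add: scalar_prod_def atLeast0LessThan sum_distrib_left power2_eq_square mult_ac)
  have F_S: "F (?S x) = ennreal ((Determinant.det (?S x))\<^sup>2
            * exp (- (\<Sum>i<?N. (\<Sum>j<?N. ?S x $$ (i, j) * y j)\<^sup>2)))" for x
    unfolding F_def w_def sq_norm_mult_mat_vec[OF sym_of_coords_carrier] ..
  have meas: "(\<lambda>x. F (?S x)) \<in> borel_measurable (\<Pi>\<^sub>M p\<in>sym_index ?N. borel)"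
    unfolding F_S
    by (intro measurable_compose[OF _ measurable_ennreal] measurable_compose[OF _ borel_measurable_exp]
        borel_measurable_uminus borel_measurable_times borel_measurable_sum borel_measurable_power
        borel_measurable_const measurable_det_sym measurable_sym_of_coords_index) auto
  have "(\<integral>\<^sup>+x. F (?S x) \<partial>gauss_coords ?N) = (\<integral>\<^sup>+x. F (Q * ?S x * Q) \<partial>gauss_coords ?N)"
    by (rule nn_integral_gauss_coords_reflection[OF Q meas, symmetric])
  also have "\<dots> = (\<integral>\<^sup>+x. ennreal ((Determinant.det (?S x))\<^sup>2
            * exp (- ((\<Sum>i<?N. (y i)\<^sup>2) * last_col_sq n x))) \<partial>gauss_coords ?N)"
  proof (rule nn_integral_cong)
    fix x
    \<comment> \<open>after the rotation only the last column of the matrix enters the exponent\<close>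
    have col: "?S x *\<^sub>v unit_vec ?N n = vec ?N (\<lambda>i. ?S x $$ (i, n))"
      by (intro eq_vecI) simp_all
    have "(Q * ?S x * Q) *\<^sub>v w = Q *\<^sub>v (?S x *\<^sub>v (Q *\<^sub>v w))"
      using assoc_mult_mat_vec[of "Q * ?S x" ?N ?N Q ?N w] assoc_mult_mat_vec[of Q ?N ?N "?S x" ?N "Q *\<^sub>v w"] q(1) w
      by (simp del: assoc_mult_mat_vec)
    then have "((Q * ?S x * Q) *\<^sub>v w) \<bullet> ((Q * ?S x * Q) *\<^sub>v w)
        = (?S x *\<^sub>v (Q *\<^sub>v w)) \<bullet> (?S x *\<^sub>v (Q *\<^sub>v w))"
      using sq_norm_reflection[OF Q mult_mat_vec_carrier[OF sym_of_coords_carrier mult_mat_vec_carrier[OF q(1) w]]]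
      by (simp only:)
    also have "?S x *\<^sub>v (Q *\<^sub>v w) = sqrt (w \<bullet> w) \<cdot>\<^sub>v vec ?N (\<lambda>i. ?S x $$ (i, n))"
      unfolding Qw col[symmetric] by (rule mult_mat_vec[of _ ?N ?N]) auto
    finally have nq: "((Q * ?S x * Q) *\<^sub>v w) \<bullet> ((Q * ?S x * Q) *\<^sub>v w) = (w \<bullet> w) * last_col_sq n x"
      unfolding smult_sq last_col_sq_eq[symmetric] real_sqrt_pow2[OF ww0] .
    show "F (Q * ?S x * Q) = ennreal ((Determinant.det (?S x))\<^sup>2
            * exp (- ((\<Sum>i<?N. (y i)\<^sup>2) * last_col_sq n x)))"
      unfolding F_def det_reflection_conj[OF Q sym_of_coords_carrier] nq ww ..
  qed
  finally show ?thesis unfolding F_S .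
qed

text \<open>
The key identity \<open>E |det S| = E ((det S)\<^sup>2 / T^(N/2))\<close> for size \<open>N\<close>: expand \<open>|det S|\<close> into an integral
over \<open>y\<close>, rotate \<open>S\<close> for each fixed \<open>y\<close>, and integrate over \<open>y\<close> again. Where \<open>T = 0\<close> the determinant
vanishes too, and both integrands are zero.
\<close>
lemma nn_integral_abs_det_eq:
  "(\<integral>\<^sup>+x. ennreal \<bar>Determinant.det (sym_of_coords (Suc n) x)\<bar> \<partial>gauss_coords (Suc n))
    = (\<integral>\<^sup>+x. ennreal ((Determinant.det (sym_of_coords (Suc n) x))\<^sup>2 * last_col_sq n x powr (- real (Suc n) / 2)) \<partial>gauss_coords (Suc n))"
proof -
  let ?N = "Suc n"
  let ?S = "sym_of_coords ?N" and ?M = "gauss_coords ?N" and ?L = "\<Pi>\<^sub>M i\<in>{..<?N}. (lborel :: real measure)"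
  let ?d = "\<lambda>x. Determinant.det (?S x)"
  let ?q = "\<lambda>x y. \<Sum>i<?N. (\<Sum>j<?N. ?S x $$ (i, j) * y j)\<^sup>2"
  let ?c = "ennreal (sqrt pi ^ ?N)"
  interpret M: prob_space ?M by (rule prob_space_gauss_PiM)
  interpret L: sigma_finite_measure ?L by (rule lborel_prod.sigma_finite) simp
  interpret P: pair_sigma_finite ?M ?L ..
  have S: "(\<lambda>x. ?S x $$ (i, j)) \<in> borel_measurable ?M" if "i < ?N" "j < ?N" for i j
    unfolding measurable_cong_sets[OF sets_gauss_PiM refl] by (rule measurable_sym_of_coords_index[OF order_refl that])
  have y: "(\<lambda>y. y j) \<in> borel_measurable ?L" if "j < ?N" for j
    using that measurable_component_singleton[of j "{..<?N}" "\<lambda>_. lborel :: real measure"] by simp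
  have S2: "(\<lambda>p. ?S (fst p) $$ (i, j)) \<in> borel_measurable (?M \<Otimes>\<^sub>M ?L)" if "i < ?N" "j < ?N" for i j
    by (rule measurable_compose[OF measurable_fst S[OF that]])
  have y2: "(\<lambda>p. snd p j) \<in> borel_measurable (?M \<Otimes>\<^sub>M ?L)" if "j < ?N" for j
    by (rule measurable_compose[OF measurable_snd y[OF that]])
  have d2: "(\<lambda>p. ?d (fst p)) \<in> borel_measurable (?M \<Otimes>\<^sub>M ?L)"
    by (rule measurable_compose[OF measurable_fst measurable_det_gauss_coords])
  have t2: "(\<lambda>p. last_col_sq n (fst p)) \<in> borel_measurable (?M \<Otimes>\<^sub>M ?L)"
    by (rule measurable_compose[OF measurable_fst measurable_last_col_sq])
  have m1: "(\<lambda>(x, y). ennreal ((?d x)\<^sup>2 * exp (- ?q x y))) \<in> borel_measurable (?M \<Otimes>\<^sub>M ?L)"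
    unfolding case_prod_beta
    by (intro measurable_compose[OF _ measurable_ennreal] measurable_compose[OF _ borel_measurable_exp]
        borel_measurable_uminus borel_measurable_times borel_measurable_sum borel_measurable_power d2 S2 y2) auto
  have m2: "(\<lambda>(x, y). ennreal ((?d x)\<^sup>2 * exp (- ((\<Sum>i<?N. (y i)\<^sup>2) * last_col_sq n x)))) \<in> borel_measurable (?M \<Otimes>\<^sub>M ?L)"
    unfolding case_prod_beta
    by (intro measurable_compose[OF _ measurable_ennreal] measurable_compose[OF _ borel_measurable_exp]
        borel_measurable_uminus borel_measurable_times borel_measurable_sum borel_measurable_power d2 t2 y2) auto
  have e1: "(\<lambda>y. ennreal (exp (- ?q x y))) \<in> borel_measurable ?L" for x
    by (intro measurable_compose[OF _ measurable_ennreal] measurable_compose[OF _ borel_measurable_exp]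
        borel_measurable_uminus borel_measurable_times borel_measurable_sum borel_measurable_power y borel_measurable_const) auto
  have e2: "(\<lambda>y. ennreal (exp (- ((\<Sum>i<?N. (y i)\<^sup>2) * last_col_sq n x)))) \<in> borel_measurable ?L" for x
    by (intro measurable_compose[OF _ measurable_ennreal] measurable_compose[OF _ borel_measurable_exp]
        borel_measurable_uminus borel_measurable_times borel_measurable_sum borel_measurable_power y borel_measurable_const) auto
  have absd: "(\<lambda>x. ennreal \<bar>?d x\<bar>) \<in> borel_measurable ?M"
    by (rule measurable_compose[OF borel_measurable_abs[OF measurable_det_gauss_coords] measurable_ennreal])
  have powd: "(\<lambda>x. ennreal ((?d x)\<^sup>2 * last_col_sq n x powr (- real ?N / 2))) \<in> borel_measurable ?M"
    by (intro measurable_compose[OF _ measurable_ennreal] borel_measurable_times borel_measurable_power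
        measurable_det_gauss_coords powr_real_measurable measurable_last_col_sq borel_measurable_const)
  have "?c * (\<integral>\<^sup>+x. ennreal \<bar>?d x\<bar> \<partial>?M) = (\<integral>\<^sup>+x. ?c * ennreal \<bar>?d x\<bar> \<partial>?M)"
    by (rule nn_integral_cmult[symmetric, OF absd])
  also have "\<dots> = (\<integral>\<^sup>+x. \<integral>\<^sup>+y. ennreal ((?d x)\<^sup>2 * exp (- ?q x y)) \<partial>?L \<partial>?M)"
  proof (rule nn_integral_cong)
    fix x
    have "?c * ennreal \<bar>?d x\<bar> = ennreal ((?d x)\<^sup>2) * (\<integral>\<^sup>+y. ennreal (exp (- ?q x y)) \<partial>?L)"
      using det_sq_mult_nn_integral_exp_neg_sq_norm[OF sym_of_coords_carrier, of ?N x]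
      unfolding sq_norm_mult_mat_vec[OF sym_of_coords_carrier] by simp
    also have "\<dots> = (\<integral>\<^sup>+y. ennreal ((?d x)\<^sup>2) * ennreal (exp (- ?q x y)) \<partial>?L)"
      by (rule nn_integral_cmult[symmetric, OF e1])
    finally show "?c * ennreal \<bar>?d x\<bar> = (\<integral>\<^sup>+y. ennreal ((?d x)\<^sup>2 * exp (- ?q x y)) \<partial>?L)"
      by (simp only: ennreal_mult[OF zero_le_power2 exp_ge_zero])
  qed
  also have "\<dots> = (\<integral>\<^sup>+y. \<integral>\<^sup>+x. ennreal ((?d x)\<^sup>2 * exp (- ?q x y)) \<partial>?M \<partial>?L)"
    by (rule P.Fubini'[OF m1, symmetric])
  also have "\<dots> = (\<integral>\<^sup>+y. \<integral>\<^sup>+x. ennreal ((?d x)\<^sup>2 * exp (- ((\<Sum>i<?N. (y i)\<^sup>2) * last_col_sq n x))) \<partial>?M \<partial>?L)"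
    unfolding nn_integral_det_sq_exp_rotate ..
  also have "\<dots> = (\<integral>\<^sup>+x. \<integral>\<^sup>+y. ennreal ((?d x)\<^sup>2 * exp (- ((\<Sum>i<?N. (y i)\<^sup>2) * last_col_sq n x))) \<partial>?L \<partial>?M)"
    by (rule P.Fubini'[OF m2])
  also have "\<dots> = (\<integral>\<^sup>+x. ?c * ennreal ((?d x)\<^sup>2 * last_col_sq n x powr (- real ?N / 2)) \<partial>?M)"
  proof (rule nn_integral_cong)
    fix x
    show "(\<integral>\<^sup>+y. ennreal ((?d x)\<^sup>2 * exp (- ((\<Sum>i<?N. (y i)\<^sup>2) * last_col_sq n x))) \<partial>?L)
      = ?c * ennreal ((?d x)\<^sup>2 * last_col_sq n x powr (- real ?N / 2))"
    proof (cases "last_col_sq n x = 0")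
      case True
      then show ?thesis by (simp add: det_eq_0_of_last_col_sq)
    next
      case False
      then have t: "last_col_sq n x > 0" using last_col_sq_nonneg[of n x] by simp
      have "(\<integral>\<^sup>+y. ennreal ((?d x)\<^sup>2 * exp (- ((\<Sum>i<?N. (y i)\<^sup>2) * last_col_sq n x))) \<partial>?L)
        = ennreal ((?d x)\<^sup>2) * (\<integral>\<^sup>+y. ennreal (exp (- ((\<Sum>i<?N. (y i)\<^sup>2) * last_col_sq n x))) \<partial>?L)"
        unfolding ennreal_mult[OF zero_le_power2 exp_ge_zero] by (rule nn_integral_cmult[OF e2])
      also have "\<dots> = ennreal ((?d x)\<^sup>2) * (?c * ennreal (last_col_sq n x powr (- real ?N / 2)))"
        using nn_integral_PiM_exp_neg_sq[of "{..<?N}", OF _ t] by simp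
      finally show ?thesis
        unfolding ennreal_mult[OF zero_le_power2 powr_ge_zero] by (simp only: mult_ac)
    qed
  qed
  also have "\<dots> = ?c * (\<integral>\<^sup>+x. ennreal ((?d x)\<^sup>2 * last_col_sq n x powr (- real ?N / 2)) \<partial>?M)"
    by (rule nn_integral_cmult[OF powd])
  finally have "?c * (\<integral>\<^sup>+x. ennreal \<bar>?d x\<bar> \<partial>?M)
     = ?c * (\<integral>\<^sup>+x. ennreal ((?d x)\<^sup>2 * last_col_sq n x powr (- real ?N / 2)) \<partial>?M)" .
  moreover have "?c \<noteq> 0" "?c \<noteq> \<infinity>" by (simp_all del: power_Suc)
  ultimately show ?thesis by (subst (asm) ennreal_mult_cancel_left) auto
qed

lemma nn_integral_Gamma_scaled:
  assumes s: "s > 0" and t: "t > 0"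
  shows "(\<integral>\<^sup>+u. ennreal (indicator {0<..} u * u powr (s - 1) * exp (- (u * t))) \<partial>lborel)
    = ennreal (Gamma s) * ennreal (t powr (- s))"
proof -
  let ?f = "\<lambda>u. ennreal (indicator {0..} u * u powr (s - 1) / exp u)"
  let ?g = "\<lambda>u. ennreal (indicator {0<..} u * u powr (s - 1) * exp (- (u * t)))"
  have "ennreal (Gamma s) = (\<integral>\<^sup>+u. ?f u \<partial>lborel)"
    using Gamma_conv_nn_integral_real[OF s] .
  also have "\<dots> = ennreal \<bar>t\<bar> * (\<integral>\<^sup>+u. ?f (0 + t * u) \<partial>lborel)"
    using t by (intro nn_integral_real_affine) auto
  also have "(\<integral>\<^sup>+u. ?f (0 + t * u) \<partial>lborel) = (\<integral>\<^sup>+u. ennreal (t powr (s - 1)) * ?g u \<partial>lborel)"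
  proof (rule nn_integral_cong)
    fix u :: real
    have "indicator {0..} (t * u) * (t * u) powr (s - 1) / exp (t * u)
      = t powr (s - 1) * (indicator {0<..} u * u powr (s - 1) * exp (- (u * t)))"
      using t by (cases "u > 0"; cases "u = 0")
        (auto simp: indicator_def powr_mult exp_minus field_simps zero_le_mult_iff)
    then show "?f (0 + t * u) = ennreal (t powr (s - 1)) * ?g u"
      by (simp add: ennreal_mult[symmetric])
  qed
  also have "\<dots> = ennreal (t powr (s - 1)) * (\<integral>\<^sup>+u. ?g u \<partial>lborel)"
    by (rule nn_integral_cmult) measurable
  finally have "ennreal (t powr (- s)) * ennreal (Gamma s) = ennreal (t powr (- s)) * ennreal (\<bar>t\<bar>) * ennreal (t powr (s - 1)) * (\<integral>\<^sup>+u. ?g u \<partial>lborel)"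
    by (simp add: mult.assoc)
  also have "ennreal (t powr (- s)) * ennreal (\<bar>t\<bar>) * ennreal (t powr (s - 1)) = ennreal (t powr (- s) * t * t powr (s - 1))"
    using t by (simp add: ennreal_mult)
  also have "t powr (- s) * t * t powr (s - 1) = 1"
    using t by (simp add: powr_diff powr_minus field_simps)
  finally show ?thesis by (simp add: mult.commute)
qed

text \<open>
Writing the power of \<open>T\<close> as a Gamma integral makes the second moments with weight \<open>exp (- u T)\<close>
applicable for each \<open>u\<close>.
\<close>
lemma Gamma_mult_nn_integral_abs_det:
  "ennreal (Gamma (real (Suc n) / 2)) * (\<integral>\<^sup>+x. ennreal \<bar>Determinant.det (sym_of_coords (Suc n) x)\<bar> \<partial>gauss_coords (Suc n))
    = (\<integral>\<^sup>+u. ennreal (indicator {0<..} u * u powr (real (Suc n) / 2 - 1))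
        * (ennreal ((1 + 2 * u) powr (- 3 / 2) * (1 + u) powr (- real n / 2)) * det_sq_mean n
    + ennreal (real n * (real n + 2) / 4 * ((1 + 2 * u) powr (- 1 / 2) * (1 + u) powr (- real n / 2 - 2))) * det_sq_mean (n - 1)) \<partial>lborel)"
proof -
  let ?N = "Suc n" and ?s = "real (Suc n) / 2"
  let ?S = "sym_of_coords ?N" and ?M = "gauss_coords ?N"
  let ?d = "\<lambda>x. Determinant.det (?S x)"
  let ?i = "\<lambda>u::real. indicator {0<..} u * u powr (?s - 1)"
  interpret M: prob_space ?M by (rule prob_space_gauss_PiM)
  interpret P: pair_sigma_finite ?M "lborel :: real measure" ..
  note d = measurable_det_gauss_coords[of ?N] and t = measurable_last_col_sq[of n]
  have im: "?i \<in> borel_measurable lborel" by measurable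
  have um: "(\<lambda>u. u :: real) \<in> borel_measurable lborel" by simp
  have d2: "(\<lambda>p. ?d (fst p)) \<in> borel_measurable (?M \<Otimes>\<^sub>M lborel)"
    by (rule measurable_compose[OF measurable_fst d])
  have t2: "(\<lambda>p. last_col_sq n (fst p)) \<in> borel_measurable (?M \<Otimes>\<^sub>M lborel)"
    by (rule measurable_compose[OF measurable_fst t])
  have i2: "(\<lambda>p. ?i (snd p)) \<in> borel_measurable (?M \<Otimes>\<^sub>M lborel)"
    by (rule measurable_compose[OF measurable_snd im])
  have u2: "(\<lambda>p. snd p :: real) \<in> borel_measurable (?M \<Otimes>\<^sub>M lborel)"
    by (rule measurable_compose[OF measurable_snd um])
  have m: "(\<lambda>(x, u). ennreal ((?d x)\<^sup>2) * ennreal (?i u * exp (- (u * last_col_sq n x)))) \<in> borel_measurable (?M \<Otimes>\<^sub>M lborel)"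
    unfolding case_prod_beta
    by (intro borel_measurable_times_ennreal measurable_compose[OF _ measurable_ennreal] measurable_compose[OF _ borel_measurable_exp]
        borel_measurable_uminus borel_measurable_times borel_measurable_power d2 t2 u2 i2)
  have m_u: "(\<lambda>u. ennreal (?i u * exp (- (u * last_col_sq n x)))) \<in> borel_measurable lborel" for x
    by measurable
  have m_x: "(\<lambda>x. ennreal ((?d x)\<^sup>2 * exp (- (u * last_col_sq n x)))) \<in> borel_measurable ?M" for u
    by (intro measurable_compose[OF _ measurable_ennreal] measurable_compose[OF _ borel_measurable_exp]
        borel_measurable_uminus borel_measurable_times borel_measurable_power d t borel_measurable_const)
  have powd: "(\<lambda>x. ennreal ((?d x)\<^sup>2 * last_col_sq n x powr (- real ?N / 2))) \<in> borel_measurable ?M"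
    by (intro measurable_compose[OF _ measurable_ennreal] borel_measurable_times borel_measurable_power
        measurable_det_gauss_coords powr_real_measurable measurable_last_col_sq borel_measurable_const)
  have "ennreal (Gamma ?s) * (\<integral>\<^sup>+x. ennreal \<bar>?d x\<bar> \<partial>?M)
      = (\<integral>\<^sup>+x. ennreal (Gamma ?s) * ennreal ((?d x)\<^sup>2 * last_col_sq n x powr (- real ?N / 2)) \<partial>?M)"
    unfolding nn_integral_abs_det_eq by (rule nn_integral_cmult[symmetric, OF powd])
  also have "\<dots> = (\<integral>\<^sup>+x. \<integral>\<^sup>+u. ennreal ((?d x)\<^sup>2) * ennreal (?i u * exp (- (u * last_col_sq n x))) \<partial>lborel \<partial>?M)"
  proof (rule nn_integral_cong)
    fix x
    have "(\<integral>\<^sup>+u. ennreal ((?d x)\<^sup>2) * ennreal (?i u * exp (- (u * last_col_sq n x))) \<partial>lborel)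
        = ennreal ((?d x)\<^sup>2) * (\<integral>\<^sup>+u. ennreal (?i u * exp (- (u * last_col_sq n x))) \<partial>lborel)"
      by (rule nn_integral_cmult[OF m_u])
    also have "\<dots> = ennreal (Gamma ?s) * ennreal ((?d x)\<^sup>2 * last_col_sq n x powr (- real ?N / 2))"
    proof (cases "last_col_sq n x = 0")
      case True
      then show ?thesis by (simp add: det_eq_0_of_last_col_sq)
    next
      case False
      then have t: "last_col_sq n x > 0" using last_col_sq_nonneg[of n x] by simp
      have s0: "?s > 0" by simp
      have "(\<integral>\<^sup>+u. ennreal (?i u * exp (- (u * last_col_sq n x))) \<partial>lborel)
        = ennreal (Gamma ?s) * ennreal (last_col_sq n x powr (- real ?N / 2))"
        using nn_integral_Gamma_scaled[OF s0 t] unfolding minus_divide_left .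
      then show ?thesis
        unfolding ennreal_mult[OF zero_le_power2 powr_ge_zero] by (simp only: mult_ac)
    qed
    finally show "ennreal (Gamma ?s) * ennreal ((?d x)\<^sup>2 * last_col_sq n x powr (- real ?N / 2))
      = (\<integral>\<^sup>+u. ennreal ((?d x)\<^sup>2) * ennreal (?i u * exp (- (u * last_col_sq n x))) \<partial>lborel)" ..
  qed
  also have "\<dots> = (\<integral>\<^sup>+u. \<integral>\<^sup>+x. ennreal ((?d x)\<^sup>2) * ennreal (?i u * exp (- (u * last_col_sq n x))) \<partial>?M \<partial>lborel)"
    by (rule P.Fubini'[OF m, symmetric])
  also have "\<dots> = (\<integral>\<^sup>+u. ennreal (?i u)
        * (ennreal ((1 + 2 * u) powr (- 3 / 2) * (1 + u) powr (- real n / 2)) * det_sq_mean n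
    + ennreal (real n * (real n + 2) / 4 * ((1 + 2 * u) powr (- 1 / 2) * (1 + u) powr (- real n / 2 - 2))) * det_sq_mean (n - 1)) \<partial>lborel)"
  proof (rule nn_integral_cong)
    fix u :: real
    have i0: "?i u \<ge> 0" by simp
    have "(\<integral>\<^sup>+x. ennreal ((?d x)\<^sup>2) * ennreal (?i u * exp (- (u * last_col_sq n x))) \<partial>?M)
      = (\<integral>\<^sup>+x. ennreal (?i u) * ennreal ((?d x)\<^sup>2 * exp (- (u * last_col_sq n x))) \<partial>?M)"
      unfolding ennreal_mult[OF zero_le_power2 exp_ge_zero] ennreal_mult[OF i0 exp_ge_zero]
      by (simp only: mult_ac)
    also have "\<dots> = ennreal (?i u) * (\<integral>\<^sup>+x. ennreal ((?d x)\<^sup>2 * exp (- (u * last_col_sq n x))) \<partial>?M)"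
      by (rule nn_integral_cmult[OF m_x])
    finally have eq: "(\<integral>\<^sup>+x. ennreal ((?d x)\<^sup>2) * ennreal (?i u * exp (- (u * last_col_sq n x))) \<partial>?M)
      = ennreal (?i u) * (\<integral>\<^sup>+x. ennreal ((?d x)\<^sup>2 * exp (- (u * last_col_sq n x))) \<partial>?M)" .
    show "(\<integral>\<^sup>+x. ennreal ((?d x)\<^sup>2) * ennreal (?i u * exp (- (u * last_col_sq n x))) \<partial>?M) = ennreal (?i u)
        * (ennreal ((1 + 2 * u) powr (- 3 / 2) * (1 + u) powr (- real n / 2)) * det_sq_mean n
    + ennreal (real n * (real n + 2) / 4 * ((1 + 2 * u) powr (- 1 / 2) * (1 + u) powr (- real n / 2 - 2))) * det_sq_mean (n - 1))"
    proof (cases "u > 0")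
      case True
      then have "u \<ge> 0" by simp
      then show ?thesis
        unfolding eq by (subst nn_integral_det_sq_exp_border[folded last_col_sq_def]) (assumption, rule refl)
    next
      case False
      then have "?i u = 0" by simp
      then show ?thesis unfolding eq by (simp only: ennreal_0 mult_zero_left)
    qed
  qed
  finally show ?thesis .
qed

section \<open>The remaining one-dimensional integral\<close>

text \<open>
All integrands in \<open>u\<close>, and their primitives, have this shape.
\<close>
definition powr_weight :: "real \<Rightarrow> real \<Rightarrow> real \<Rightarrow> real \<Rightarrow> real" where
  "powr_weight a b c u = u powr a * (1 + u) powr b * (1 + 2 * u) powr c"

lemma powr_weight_nonneg: "powr_weight a b c u \<ge> 0"
  by (simp add: powr_weight_def)

lemma measurable_powr_weight [measurable]: "powr_weight a b c \<in> borel_measurable borel"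
  unfolding powr_weight_def by measurable

lemma powr_weight_shift:
  assumes "u > 0"
  shows "powr_weight (a - 1) b c u = powr_weight a b c u / u"
    and "powr_weight a (b - 1) c u = powr_weight a b c u / (1 + u)"
    and "powr_weight a b (c - 1) u = powr_weight a b c u / (1 + 2 * u)"
  using assms by (simp_all add: powr_weight_def powr_diff)

lemma has_real_derivative_powr_weight:
  assumes "u > 0"
  shows "(powr_weight a b c has_real_derivative powr_weight a b c u * (a / u + b / (1 + u) + 2 * c / (1 + 2 * u))) (at u)"
proof -
  have "((\<lambda>u. u powr a * (1 + u) powr b * (1 + 2 * u) powr c) has_real_derivative
      (a * u powr (a - 1) * (1 + u) powr b + u powr a * (b * (1 + u) powr (b - 1))) * (1 + 2 * u) powr c
      + u powr a * (1 + u) powr b * (c * (1 + 2 * u) powr (c - 1) * 2)) (at u)"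
    using assms by (auto intro!: derivative_eq_intros simp: algebra_simps)
  also have "(a * u powr (a - 1) * (1 + u) powr b + u powr a * (b * (1 + u) powr (b - 1))) * (1 + 2 * u) powr c
      + u powr a * (1 + u) powr b * (c * (1 + 2 * u) powr (c - 1) * 2)
      = powr_weight a b c u * (a / u + b / (1 + u) + 2 * c / (1 + 2 * u))"
    using assms by (simp add: powr_weight_def powr_diff distrib_left distrib_right mult_ac)
  finally show ?thesis unfolding powr_weight_def .
qed

lemma isCont_powr_weight: "u > 0 \<Longrightarrow> isCont (powr_weight a b c) u"
  using has_real_derivative_powr_weight DERIV_isCont by blast

lemma tendsto_powr_weight_at_right_0:
  assumes "a > 0"
  shows "(powr_weight a b c \<longlongrightarrow> 0) (at_right 0)"
proof -
  have "((\<lambda>u. u powr a * (1 + u) powr b * (1 + 2 * u) powr c) \<longlongrightarrow> 0 * (1 + 0) powr b * (1 + 2 * 0) powr c) (at_right (0 :: real))"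
  proof (intro tendsto_mult)
    show "((\<lambda>u. u powr a) \<longlongrightarrow> 0) (at_right (0 :: real))"
      using assms by (intro tendsto_zero_powrI[of _ _ _ a] tendsto_ident_at tendsto_const)
        (auto simp: eventually_at_filter)
  qed (intro tendsto_intros; simp)+
  then show ?thesis by (simp add: powr_weight_def[abs_def])
qed

lemma tendsto_powr_weight_at_top:
  assumes "a + b + c = 0"
  shows "(powr_weight a b c \<longlongrightarrow> 2 powr c) at_top"
proof -
  have inv: "((\<lambda>u::real. 1 / u) \<longlongrightarrow> 0) at_top"
    by real_asymp
  have "((\<lambda>u::real. (1 + 1 / u) powr b * (2 + 1 / u) powr c) \<longlongrightarrow> (1 + 0) powr b * (2 + 0) powr c) at_top"
    by (intro tendsto_intros inv) auto
  moreover have "eventually (\<lambda>u::real. (1 + 1 / u) powr b * (2 + 1 / u) powr c = powr_weight a b c u) at_top"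
    using eventually_gt_at_top[of "0::real"]
  proof eventually_elim
    case (elim u)
    have "1 + u = u * (1 + 1 / u)" "1 + 2 * u = u * (2 + 1 / u)"
      using elim by (simp_all add: field_simps)
    then have "(1 + u) powr b = u powr b * (1 + 1 / u) powr b" "(1 + 2 * u) powr c = u powr c * (2 + 1 / u) powr c"
      using elim by (simp_all only: powr_mult)
    then have "powr_weight a b c u = (u powr a * u powr b * u powr c) * ((1 + 1 / u) powr b * (2 + 1 / u) powr c)"
      by (simp only: powr_weight_def mult_ac)
    also have "u powr a * u powr b * u powr c = 1"
      using elim assms by (simp flip: powr_add)
    finally show ?case by simp
  qed
  ultimately show ?thesis
    by (auto intro: Lim_transform_eventually)
qed

lemma FTC_nonneg_half_line:
  fixes F f :: "real \<Rightarrow> real"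
  assumes "\<And>u. u > 0 \<Longrightarrow> (F has_real_derivative f u) (at u)"
    and "\<And>u. u > 0 \<Longrightarrow> isCont f u" and "\<And>u. u > 0 \<Longrightarrow> f u \<ge> 0"
    and "(F \<longlongrightarrow> A) (at_right 0)" and "(F \<longlongrightarrow> B) at_top"
  shows "set_integrable lborel {0<..} f" and "(LBINT u:{0<..}. f u) = B - A"
proof -
  have "set_integrable lborel (einterval (ereal 0) \<infinity>) f" "(LBINT u=ereal 0..\<infinity>. f u) = B - A"
    using assms
    by (intro interval_integral_FTC_nonneg[where F = F]; simp add: ereal_tendsto_simps)+
  then show "set_integrable lborel {0<..} f" "(LBINT u:{0<..}. f u) = B - A"
    by (simp_all add: interval_integral_to_infinity_eq)
qed

text \<open>
Under the substitution \<open>y = u / (1 + u)\<close> the integral of \<open>kern n\<close> over the half-line becomes the integral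
of \<open>y^(n/2 - 1) (1 + y)^(- 3/2)\<close> over the unit interval.
\<close>
definition kern :: "nat \<Rightarrow> real \<Rightarrow> real" where
  "kern n = powr_weight (real n / 2 - 1) ((1 - real n) / 2) (- 3 / 2)"

definition kern_int :: "nat \<Rightarrow> real" where
  "kern_int n = (LBINT u:{0<..}. kern n u)"

lemma kern_nonneg: "kern n u \<ge> 0"
  by (simp add: kern_def powr_weight_nonneg)

lemma measurable_kern [measurable]: "kern n \<in> borel_measurable borel"
  by (simp add: kern_def)

lemma kern_eq:
  assumes "u > 0"
  shows "kern n u = powr_weight (real n / 2) ((1 - real n) / 2) (- 1 / 2) u / (u * (1 + 2 * u))"
    and "kern (n + 2) u = powr_weight (real n / 2) ((1 - real n) / 2) (- 1 / 2) u / ((1 + u) * (1 + 2 * u))"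
proof -
  have e: "- 3 / 2 = - 1 / 2 - (1::real)" "real (n + 2) / 2 - 1 = real n / 2" "(1 - real (n + 2)) / 2 = (1 - real n) / 2 - 1"
    by (simp_all add: field_simps)
  show "kern n u = powr_weight (real n / 2) ((1 - real n) / 2) (- 1 / 2) u / (u * (1 + 2 * u))"
    unfolding kern_def e(1) powr_weight_shift[OF assms] by simp
  show "kern (n + 2) u = powr_weight (real n / 2) ((1 - real n) / 2) (- 1 / 2) u / ((1 + u) * (1 + 2 * u))"
    unfolding kern_def e powr_weight_shift[OF assms] by simp
qed

text \<open>
The primitive is \<open>u^(n/2) (1 + u)^((1 - n)/2) (1 + 2 u)^(- 1/2)\<close>; in the variable \<open>y = u / (1 + u)\<close> it is
\<open>y^(n/2) (1 + y)^(- 1/2)\<close>. Its limits at 0 and infinity are 0 and \<open>1 / sqrt 2\<close>.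
\<close>
lemma kern_FTC:
  assumes "n \<ge> 1"
  shows "set_integrable lborel {0<..} (\<lambda>u. (real n * kern n u + (real n - 1) * kern (n + 2) u) / 2)"
    and "(LBINT u:{0<..}. (real n * kern n u + (real n - 1) * kern (n + 2) u) / 2) = 1 / sqrt 2"
proof -
  let ?F = "powr_weight (real n / 2) ((1 - real n) / 2) (- 1 / 2)"
  have deriv: "(?F has_real_derivative (real n * kern n u + (real n - 1) * kern (n + 2) u) / 2) (at u)" if "u > 0" for u
  proof -
    have alg: "G * ((a / A + b / B) / 2) = (a * (G / A) + b * (G / B)) / 2" for G a b A B :: real
      by (simp add: distrib_left add_divide_distrib mult.commute)
    have "real n / 2 / u + (1 - real n) / 2 / (1 + u) + 2 * (- 1 / 2) / (1 + 2 * u)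
        = (real n / (u * (1 + 2 * u)) + (real n - 1) / ((1 + u) * (1 + 2 * u))) / 2"
      using that by (simp add: divide_simps) (simp add: algebra_simps)
    then have eq: "?F u * (real n / 2 / u + (1 - real n) / 2 / (1 + u) + 2 * (- 1 / 2) / (1 + 2 * u))
        = (real n * kern n u + (real n - 1) * kern (n + 2) u) / 2"
      unfolding kern_eq(1)[OF that, of n] kern_eq(2)[OF that, of n] by (simp only: alg)
    show ?thesis
      using has_real_derivative_powr_weight[OF that, of "real n / 2" "(1 - real n) / 2" "- 1 / 2"] unfolding eq .
  qed
  have cont: "isCont (\<lambda>u. (real n * kern n u + (real n - 1) * kern (n + 2) u) / 2) u" if "u > 0" for u
    unfolding kern_def by (intro continuous_intros isCont_powr_weight that) simp
  have nonneg: "(real n * kern n u + (real n - 1) * kern (n + 2) u) / 2 \<ge> 0" for u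
    using assms by (simp add: kern_nonneg)
  have l0: "(?F \<longlongrightarrow> 0) (at_right 0)"
    using assms by (intro tendsto_powr_weight_at_right_0) simp
  have sum0: "real n / 2 + (1 - real n) / 2 + - 1 / 2 = 0" by (simp add: field_simps)
  have pow2: "2 powr (- 1 / 2) = 1 / sqrt (2::real)"
    by (simp add: powr_minus_divide powr_half_sqrt)
  have l1: "(?F \<longlongrightarrow> 1 / sqrt 2) at_top"
    using tendsto_powr_weight_at_top[OF sum0] unfolding pow2 .
  show "set_integrable lborel {0<..} (\<lambda>u. (real n * kern n u + (real n - 1) * kern (n + 2) u) / 2)"
    by (rule FTC_nonneg_half_line(1)[OF deriv cont nonneg l0 l1])
  show "(LBINT u:{0<..}. (real n * kern n u + (real n - 1) * kern (n + 2) u) / 2) = 1 / sqrt 2"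
    using FTC_nonneg_half_line(2)[OF deriv cont nonneg l0 l1] by simp
qed

text \<open>
Domination by the integrand of the preceding lemma, in which the coefficient of \<open>kern n\<close> is positive.
\<close>
lemma set_integrable_kern:
  assumes "n \<ge> 1"
  shows "set_integrable lborel {0<..} (kern n)"
proof -
  let ?g = "\<lambda>u. 2 * ((real n * kern n u + (real n - 1) * kern (n + 2) u) / 2)"
  have g: "set_integrable lborel {0<..} ?g"
    using kern_FTC(1)[OF assms] by (rule set_integrable_mult_right)
  show ?thesis
  proof (rule set_integrable_bound[OF g])
    show "set_borel_measurable lborel {0<..} (kern n)"
      unfolding set_borel_measurable_def by measurable
    show "AE u in lborel. u \<in> {0<..} \<longrightarrow> norm (kern n u) \<le> norm (?g u)"
    proof (rule AE_I2, rule impI)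
      fix u :: real
      have "kern n u \<le> real n * kern n u"
        using assms mult_right_mono[of 1 "real n" "kern n u"] by (simp add: kern_nonneg)
      moreover have "0 \<le> (real n - 1) * kern (n + 2) u"
        using assms by (simp add: kern_nonneg)
      ultimately show "norm (kern n u) \<le> norm (?g u)"
        using kern_nonneg[of n u] by simp
    qed
  qed
qed

lemma kern_int_recurrence:
  assumes "n \<ge> 1"
  shows "real n * kern_int n + (real n - 1) * kern_int (n + 2) = sqrt 2"
proof -
  note i1 = set_integrable_kern[OF assms] and i2 = set_integrable_kern[of "n + 2", simplified]
  have A: "(LBINT u:{0<..}. (real n / 2 * kern n u + (real n - 1) / 2 * kern (n + 2) u))
    = real n / 2 * kern_int n + (real n - 1) / 2 * kern_int (n + 2)"
    unfolding kern_int_def using i1 i2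
    by (subst set_integral_add(2)) (auto intro!: set_integrable_mult_right)
  have "(\<lambda>u. (real n * kern n u + (real n - 1) * kern (n + 2) u) / 2)
    = (\<lambda>u. real n / 2 * kern n u + (real n - 1) / 2 * kern (n + 2) u)"
    by (simp add: fun_eq_iff add_divide_distrib)
  with kern_FTC(2)[OF assms] A have "real n / 2 * kern_int n + (real n - 1) / 2 * kern_int (n + 2) = 1 / sqrt 2"
    by metis
  moreover have "real n * kern_int n + (real n - 1) * kern_int (n + 2) = 2 * (real n / 2 * kern_int n + (real n - 1) / 2 * kern_int (n + 2))"
    by (simp add: distrib_left)
  ultimately show ?thesis by (simp add: real_div_sqrt)
qed

lemma kern_int_nonneg: "kern_int n \<ge> 0"
  unfolding kern_int_def set_lebesgue_integral_def
  by (auto intro!: Bochner_Integration.integral_nonneg simp: kern_nonneg)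

text \<open>
The starting value for even indices. The recurrence cannot supply it, because it would have to be
used at \<open>n = 0\<close>, where \<open>kern n\<close> is not integrable.
\<close>
lemma kern_int_2: "kern_int 2 = 2 - sqrt 2"
proof -
  let ?G = "powr_weight 0 (1 / 2) (- 1 / 2)"
  have deriv: "((\<lambda>u. - 2 * ?G u) has_real_derivative kern 2 u) (at u)" if "u > 0" for u
  proof -
    have "((\<lambda>u. - 2 * ?G u) has_real_derivative
        - 2 * (?G u * (0 / u + 1 / 2 / (1 + u) + 2 * (- 1 / 2) / (1 + 2 * u)))) (at u)"
      by (intro DERIV_cmult has_real_derivative_powr_weight that)
    also have "- 2 * (?G u * (0 / u + 1 / 2 / (1 + u) + 2 * (- 1 / 2) / (1 + 2 * u))) = kern 2 u"
    proof -
      have k: "kern 2 u = ?G u * (1 / ((1 + u) * (1 + 2 * u)))"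
        using kern_eq(2)[OF that, of 0] by (simp add: numeral_2_eq_2)
      have "- 2 * (0 / u + 1 / 2 / (1 + u) + 2 * (- 1 / 2) / (1 + 2 * u)) = 1 / ((1 + u) * (1 + 2 * u))"
        using that by (simp add: divide_simps)
      then show ?thesis unfolding k by (simp only: mult.left_commute[of "- 2"])
    qed
    finally show ?thesis .
  qed
  have cont: "isCont (kern 2) u" if "u > 0" for u
    unfolding kern_def by (rule isCont_powr_weight[OF that])
  have l0: "((\<lambda>u. - 2 * ?G u) \<longlongrightarrow> - 2) (at_right 0)"
  proof -
    have "((\<lambda>u. - 2 * ((1 + u) powr (1 / 2) * (1 + 2 * u) powr (- 1 / 2))) \<longlongrightarrow> - 2 * ((1 + 0) powr (1 / 2) * (1 + 2 * 0) powr (- 1 / 2))) (at_right (0::real))"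
      by (intro tendsto_intros) auto
    moreover have "eventually (\<lambda>u::real. - 2 * ((1 + u) powr (1 / 2) * (1 + 2 * u) powr (- 1 / 2)) = - 2 * ?G u) (at_right 0)"
      using eventually_at_right_less[of "0::real"] by eventually_elim (simp add: powr_weight_def)
    ultimately show ?thesis by (auto intro: Lim_transform_eventually)
  qed
  have "- 2 * 2 powr (- 1 / 2) = - sqrt (2::real)"
    by (simp add: powr_minus_divide powr_half_sqrt real_div_sqrt)
  moreover have "((\<lambda>u. - 2 * ?G u) \<longlongrightarrow> - 2 * 2 powr (- 1 / 2)) at_top"
    by (intro tendsto_mult tendsto_const tendsto_powr_weight_at_top) simp
  ultimately have l1: "((\<lambda>u. - 2 * ?G u) \<longlongrightarrow> - sqrt 2) at_top" by metis
  from FTC_nonneg_half_line(2)[OF deriv cont kern_nonneg l0 l1] show ?thesis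
    by (simp add: kern_int_def)
qed

text \<open>
This is \<open>Gamma (j + 1/2) Gamma (j + 3/2) / (2 pi)\<close>, see \<open>Gamma_half_mult\<close>. The product form serves in the
rational recurrences, the Gamma form in the final formulas.
\<close>
fun gamma_coeff :: "nat \<Rightarrow> real" where
  "gamma_coeff 0 = 1 / 4"
| "gamma_coeff (Suc j) = gamma_coeff j * ((2 * real j + 1) * (2 * real j + 3) / 4)"

text \<open>
The real number behind \<^const>\<open>det_sq_mean\<close>: the recursion is the one that \<open>det_sq_mean_Suc\<close> gives.
\<close>
fun det_sq :: "nat \<Rightarrow> real" where
  "det_sq 0 = 1"
| "det_sq (Suc 0) = 1"
| "det_sq (Suc (Suc n)) = det_sq (Suc n) + (real n + 1) * (real n + 3) / 4 * det_sq n"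

lemma det_sq_nonneg: "det_sq n \<ge> 0"
  by (induction n rule: det_sq.induct) auto

lemma det_sq_mean_eq: "det_sq_mean n = ennreal (det_sq n)"
proof (induction n rule: det_sq.induct)
  case 1
  show ?case by (simp add: det_sq_mean_0)
next
  case 2
  show ?case using det_sq_mean_Suc[of 0] by (simp add: det_sq_mean_0)
next
  case (3 n)
  have "det_sq_mean (Suc (Suc n)) = ennreal (det_sq (Suc n)) + ennreal ((real n + 1) * (real n + 3) / 4) * ennreal (det_sq n)"
    using det_sq_mean_Suc[of "Suc n"] 3 by (simp add: algebra_simps)
  also have "\<dots> = ennreal (det_sq (Suc (Suc n)))"
    by (simp add: det_sq_nonneg ennreal_mult[symmetric] ennreal_plus[symmetric] del: ennreal_plus)
  finally show ?case .
qed

text \<open>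
The recurrence has order two, but its solution is hypergeometric along each parity class.
\<close>
lemma det_sq_closed:
  "det_sq (2 * j) = 4 / 3 * (4 * real j + 3) * gamma_coeff j \<and> det_sq (2 * j + 1) = 16 / 3 * gamma_coeff (Suc j)"
proof (induction j)
  case 0
  show ?case by simp
next
  case (Suc j)
  have "det_sq (2 * Suc j) = det_sq (2 * j + 1) + (real (2 * j) + 1) * (real (2 * j) + 3) / 4 * det_sq (2 * j)"
    by simp
  also have "\<dots> = 16 / 3 * gamma_coeff (Suc j) + (2 * real j + 1) * (2 * real j + 3) / 4 * (4 / 3 * (4 * real j + 3) * gamma_coeff j)"
    unfolding conjunct1[OF Suc.IH] conjunct2[OF Suc.IH] of_nat_mult of_nat_numeral ..
  also have "\<dots> = 4 / 3 * (4 * real (Suc j) + 3) * gamma_coeff (Suc j)"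
    by (simp add: field_simps)
  finally have 1: "det_sq (2 * Suc j) = 4 / 3 * (4 * real (Suc j) + 3) * gamma_coeff (Suc j)" .
  have "det_sq (2 * Suc j + 1) = det_sq (2 * Suc j) + (real (2 * j + 1) + 1) * (real (2 * j + 1) + 3) / 4 * det_sq (2 * j + 1)"
    by simp
  also have "\<dots> = 4 / 3 * (4 * real (Suc j) + 3) * gamma_coeff (Suc j) + (2 * real j + 2) * (2 * real j + 4) / 4 * (16 / 3 * gamma_coeff (Suc j))"
  proof -
    have "real (2 * j + 1) + 1 = 2 * real j + 2" "real (2 * j + 1) + 3 = 2 * real j + 4" by simp_all
    then show ?thesis unfolding 1 conjunct2[OF Suc.IH] by (simp only:)
  qed
  also have "\<dots> = 16 / 3 * gamma_coeff (Suc (Suc j))"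
    unfolding gamma_coeff.simps(2)[of "Suc j"] by (simp only: of_nat_Suc) (simp add: algebra_simps add_divide_distrib del: gamma_coeff.simps)
  finally show ?case using 1 by blast
qed

text \<open>
The weights of the two terms of the second moment combine into \<open>kern\<close>: with \<open>N = n + 1\<close> the second
weight is \<open>kern N - kern (N + 4)\<close>, by \<open>1 + 2 u = (1 + u)\<^sup>2 - u\<^sup>2\<close>.
\<close>
lemma e_R_kernel:
  "e_R (Suc n) * Gamma (real (Suc n) / 2)
    = det_sq (Suc n) * kern_int (Suc n) - (if n = 0 then 0 else real n * (real n + 2) / 4 * det_sq (n - 1) * kern_int (n + 5))"
proof -
  let ?N = "Suc n"
  let ?c = "real n * (real n + 2) / 4 * det_sq (n - 1)"
  let ?f = "\<lambda>u. det_sq n * kern ?N u + ?c * (kern ?N u - kern (n + 5) u)"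
  have c: "?c \<ge> 0" by (simp add: det_sq_nonneg)
  have rewr: "u powr (real ?N / 2 - 1) * ((1 + 2 * u) powr (- 3 / 2) * (1 + u) powr (- real n / 2)) = kern ?N u"
    "u powr (real ?N / 2 - 1) * ((1 + 2 * u) powr (- 1 / 2) * (1 + u) powr (- real n / 2 - 2)) = kern ?N u - kern (n + 5) u"
    if u: "u > 0" for u
  proof -
    let ?a = "real ?N / 2 - 1" and ?b = "- real n / 2"
    show "u powr ?a * ((1 + 2 * u) powr (- 3 / 2) * (1 + u) powr ?b) = kern ?N u"
      by (simp add: kern_def powr_weight_def mult_ac)
    have e: "(1 - real ?N) / 2 = ?b" "real (n + 5) / 2 - 1 = ?a + 2" "(1 - real (n + 5)) / 2 = ?b - 2" "- 1 / 2 = - 3 / 2 + (1::real)"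
      by (simp_all add: field_simps)
    define p where "p = u powr ?a"
    define q where "q = (1 + u) powr ?b"
    define r where "r = (1 + 2 * u) powr (- 3 / 2)"
    have "kern ?N u = p * q * r" unfolding kern_def powr_weight_def e p_def q_def r_def ..
    moreover have "kern (n + 5) u = p * u\<^sup>2 * (q / (1 + u)\<^sup>2) * r"
      unfolding kern_def powr_weight_def e powr_add powr_diff p_def q_def r_def using u by (simp add: powr_numeral)
    moreover have "(1 + 2 * u) powr (- 1 / 2) = r * (1 + 2 * u)"
      unfolding e(4) powr_add r_def using u by simp
    moreover have "(1 + u) powr (?b - 2) = q / (1 + u)\<^sup>2"
      unfolding powr_diff q_def using u by (simp add: powr_numeral)
    moreover have "p * (r * (1 + 2 * u) * (q / (1 + u)\<^sup>2)) = p * q * r - p * u\<^sup>2 * (q / (1 + u)\<^sup>2) * r"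
    proof -
      define q' where "q' = q / (1 + u)\<^sup>2"
      have q: "q = q' * (1 + u)\<^sup>2" using u by (simp add: q'_def)
      have "p * (r * (1 + 2 * u) * q') = p * (q' * (1 + u)\<^sup>2) * r - p * u\<^sup>2 * q' * r"
        by (simp add: power2_eq_square algebra_simps)
      then show ?thesis unfolding q[symmetric] unfolding q'_def .
    qed
    ultimately show "u powr ?a * ((1 + 2 * u) powr (- 1 / 2) * (1 + u) powr (?b - 2)) = kern ?N u - kern (n + 5) u"
      by (simp only: p_def)
  qed
  have f_nonneg: "?f u \<ge> 0" if "u > 0" for u
  proof -
    have "kern ?N u - kern (n + 5) u \<ge> 0" unfolding rewr(2)[OF that, symmetric] using that by simp
    then show ?thesis using c by (simp add: det_sq_nonneg kern_nonneg)
  qed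
  have i1: "set_integrable lborel {0<..} (kern ?N)" and i2: "set_integrable lborel {0<..} (kern (n + 5))"
    by (simp_all add: set_integrable_kern)
  have int: "set_integrable lborel {0<..} ?f"
    using i1 i2 by (intro set_integral_add set_integral_diff set_integrable_mult_right)
  have int_eq: "(LBINT u:{0<..}. ?f u) = det_sq n * kern_int ?N + ?c * (kern_int ?N - kern_int (n + 5))"
    unfolding kern_int_def using i1 i2
    by (simp add: set_integral_add(2) set_integral_diff set_integrable_mult_right)
  have "ennreal (Gamma (real ?N / 2)) * (\<integral>\<^sup>+x. ennreal \<bar>Determinant.det (sym_of_coords ?N x)\<bar> \<partial>gauss_coords ?N)
    = (\<integral>\<^sup>+u. ennreal (indicator {0<..} u *\<^sub>R ?f u) \<partial>lborel)"
    unfolding Gamma_mult_nn_integral_abs_det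
  proof (rule nn_integral_cong)
    fix u :: real
    show "ennreal (indicator {0<..} u * u powr (real ?N / 2 - 1))
        * (ennreal ((1 + 2 * u) powr (- 3 / 2) * (1 + u) powr (- real n / 2)) * det_sq_mean n
    + ennreal (real n * (real n + 2) / 4 * ((1 + 2 * u) powr (- 1 / 2) * (1 + u) powr (- real n / 2 - 2))) * det_sq_mean (n - 1))
      = ennreal (indicator {0<..} u *\<^sub>R ?f u)"
    proof (cases "u > 0")
      case False
      then show ?thesis by simp
    next
      case True
      let ?A = "(1 + 2 * u) powr (- 3 / 2) * (1 + u) powr (- real n / 2)"
      let ?B = "(1 + 2 * u) powr (- 1 / 2) * (1 + u) powr (- real n / 2 - 2)"
      let ?p = "u powr (real ?N / 2 - 1)"
      have "ennreal ?p * (ennreal ?A * ennreal (det_sq n) + ennreal (real n * (real n + 2) / 4 * ?B) * ennreal (det_sq (n - 1)))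
        = ennreal (?p * (?A * det_sq n + real n * (real n + 2) / 4 * ?B * det_sq (n - 1)))"
        by (simp add: det_sq_nonneg ennreal_mult[symmetric] ennreal_plus[symmetric] del: ennreal_plus)
      also have "?p * (?A * det_sq n + real n * (real n + 2) / 4 * ?B * det_sq (n - 1))
        = det_sq n * (?p * ?A) + ?c * (?p * ?B)"
        by (simp only: distrib_left mult_ac)
      finally show ?thesis
        unfolding rewr[OF True] det_sq_mean_eq using True by simp
    qed
  qed
  also have "\<dots> = ennreal (LBINT u:{0<..}. ?f u)"
    unfolding set_lebesgue_integral_def using int[unfolded set_integrable_def]
    by (rule nn_integral_eq_integral) (use f_nonneg in \<open>auto simp: indicator_def\<close>)
  finally have "enn2real (ennreal (Gamma (real ?N / 2)) * (\<integral>\<^sup>+x. ennreal \<bar>Determinant.det (sym_of_coords ?N x)\<bar> \<partial>gauss_coords ?N))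
    = (LBINT u:{0<..}. ?f u)"
    using f_nonneg
    by (simp only: enn2real_ennreal set_lebesgue_integral_def)
       (rule enn2real_ennreal, rule Bochner_Integration.integral_nonneg, auto simp: indicator_def)
  then have "Gamma (real ?N / 2) * e_R ?N = det_sq n * kern_int ?N + ?c * (kern_int ?N - kern_int (n + 5))"
    unfolding int_eq e_R_eq_nn_integral enn2real_mult by (simp add: enn2real_ennreal Gamma_real_pos less_imp_le)
  moreover have "det_sq ?N = det_sq n + ?c"
    by (cases n) (simp_all add: algebra_simps)
  moreover have "e * G = D * k - c * k'" if "G * e = d * k + c * (k - k')" "D = d + c" for G e D d c k k' :: real
    using that by (simp add: algebra_simps)
  ultimately have "e_R ?N * Gamma (real ?N / 2) = det_sq ?N * kern_int ?N - ?c * kern_int (n + 5)" by metis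
  then show ?thesis by (cases "n = 0") simp_all
qed

section \<open>Closed forms and asymptotics\<close>

lemma Gamma_plus1_pos: "x > 0 \<Longrightarrow> Gamma (x + 1) = x * Gamma (x :: real)"
  by (rule Gamma_plus1) (auto dest: nonpos_Ints_nonpos)

lemma Gamma_three_halves: "Gamma (3 / 2 :: real) = sqrt pi / 2"
  using Gamma_plus1_pos[of "1 / 2"] by (simp add: Gamma_one_half_real)

lemma Gamma_half_mult: "Gamma (real j + 1 / 2) * Gamma (real j + 3 / 2) = 2 * pi * gamma_coeff j"
proof (induction j)
  case 0
  show ?case by (simp add: Gamma_three_halves Gamma_one_half_real)
next
  case (Suc j)
  have "Gamma (real (Suc j) + 1 / 2) = (real j + 1 / 2) * Gamma (real j + 1 / 2)"
    using Gamma_plus1_pos[of "real j + 1 / 2"] by (simp add: add_ac)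
  moreover have "Gamma (real (Suc j) + 3 / 2) = (real j + 3 / 2) * Gamma (real j + 3 / 2)"
    using Gamma_plus1_pos[of "real j + 3 / 2"] by (simp add: add_ac)
  ultimately have "Gamma (real (Suc j) + 1 / 2) * Gamma (real (Suc j) + 3 / 2)
      = (real j + 1 / 2) * (real j + 3 / 2) * (Gamma (real j + 1 / 2) * Gamma (real j + 3 / 2))"
    by (simp only: mult_ac)
  also have "\<dots> = 2 * pi * gamma_coeff (Suc j)"
    unfolding Suc.IH by (simp add: algebra_simps)
  finally show ?case .
qed

text \<open>
The recurrence of \<open>kern_int\<close>, applied at \<open>n + 3\<close> and at \<open>n + 1\<close>, expresses \<open>kern_int (n + 5)\<close> by
\<open>kern_int (n + 1)\<close>.
\<close>
lemma e_R_reduced: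
  assumes "n \<ge> 1"
  shows "e_R (n + 1) * Gamma (real (n + 1) / 2)
    = kern_int (n + 1) * (det_sq (n + 1) - (real n + 1) * (real n + 3) / 4 * det_sq (n - 1)) + 3 * sqrt 2 / 4 * det_sq (n - 1)"
proof -
  have r1: "(real n + 1) * kern_int (n + 1) + real n * kern_int (n + 3) = sqrt 2"
    using kern_int_recurrence[of "n + 1"] by (simp add: add_ac numeral_3_eq_3)
  have r2: "(real n + 3) * kern_int (n + 3) + (real n + 2) * kern_int (n + 5) = sqrt 2"
    using kern_int_recurrence[of "n + 3"] by (simp add: add_ac)
  have "real n * ((real n + 2) * kern_int (n + 5)) = real n * sqrt 2 - (real n + 3) * (real n * kern_int (n + 3))"
    unfolding r2[symmetric] by (simp add: algebra_simps)
  also have "real n * kern_int (n + 3) = sqrt 2 - (real n + 1) * kern_int (n + 1)"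
    using r1 by simp
  \<comment> \<open>by both recurrences the indices above \<open>n + 1\<close> are gone\<close>
  finally have k5: "real n * (real n + 2) * kern_int (n + 5) = (real n + 1) * (real n + 3) * kern_int (n + 1) - 3 * sqrt 2"
    by (simp add: algebra_simps)
  have "e_R (n + 1) * Gamma (real (n + 1) / 2) = det_sq (n + 1) * kern_int (n + 1) - (real n * (real n + 2) * kern_int (n + 5)) / 4 * det_sq (n - 1)"
    using e_R_kernel[of n] assms by (simp add: mult_ac)
  then show ?thesis unfolding k5 by (simp add: field_simps)
qed

text \<open>
In odd size \<open>n \<ge> 3\<close> the closed form of the second moments makes the coefficient of \<open>kern_int n\<close> vanish. In
size 1 the value is \<open>kern_int 1\<close>, which the recurrence determines.
\<close>
lemma e_R_odd_Gamma: "e_R (2 * j + 1) * Gamma (real j + 1 / 2) = 4 * sqrt 2 * gamma_coeff j"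
proof (cases j)
  case 0
  then show ?thesis
    using e_R_kernel[of 0] kern_int_recurrence[of 1] by simp
next
  case (Suc i)
  have "e_R (2 * i + 2 + 1) * Gamma (real (2 * i + 2 + 1) / 2)
     = kern_int (2 * i + 3) * (det_sq (2 * Suc i + 1) - (2 * real i + 3) * (2 * real i + 5) / 4 * det_sq (2 * i + 1)) + 3 * sqrt 2 / 4 * det_sq (2 * i + 1)"
    using e_R_reduced[of "2 * i + 2"] by (simp add: add_ac numeral_3_eq_3)
  also have "det_sq (2 * i + 1) = 16 / 3 * gamma_coeff (Suc i)"
    using det_sq_closed[of i] by blast
  also have "det_sq (2 * Suc i + 1) = (2 * real i + 3) * (2 * real i + 5) / 4 * (16 / 3 * gamma_coeff (Suc i))"
    using det_sq_closed[of "Suc i"] unfolding gamma_coeff.simps(2)[of "Suc i"] by (simp add: add_ac)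
  finally have "e_R (2 * i + 2 + 1) * Gamma (real (2 * i + 2 + 1) / 2) = 4 * sqrt 2 * gamma_coeff (Suc i)"
    by (simp del: gamma_coeff.simps)
  moreover have "real (2 * i + 2 + 1) / 2 = real j + 1 / 2" "2 * i + 2 + 1 = 2 * j + 1"
    by (simp_all add: Suc field_simps)
  ultimately show ?thesis unfolding Suc by metis
qed

lemma e_R_even_fact: "e_R (2 * j + 2) * fact j = gamma_coeff j * (sqrt 2 * (4 * real j + 3) - kern_int (2 * j + 2))"
proof -
  have G: "Gamma (real (2 * j + 1 + 1) / 2) = fact j"
  proof -
    have half: "real (2 * j + 1 + 1) / 2 = 1 + real j" by (simp add: field_simps)
    show ?thesis unfolding half by (rule Gamma_fact)
  qed
  have "e_R (2 * j + 2) * fact j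
    = kern_int (2 * j + 2) * (det_sq (2 * Suc j) - (2 * real j + 2) * (2 * real j + 4) / 4 * det_sq (2 * j)) + 3 * sqrt 2 / 4 * det_sq (2 * j)"
    using e_R_reduced[of "2 * j + 1"] unfolding G by (simp add: add_ac)
  also have "det_sq (2 * j) = 4 / 3 * (4 * real j + 3) * gamma_coeff j"
    using det_sq_closed[of j] by blast
  also have "det_sq (2 * Suc j) = 4 / 3 * (4 * real j + 7) * (gamma_coeff j * ((2 * real j + 1) * (2 * real j + 3) / 4))"
    using det_sq_closed[of "Suc j"] by (simp add: add_ac)
  also have "4 / 3 * (4 * real j + 7) * (gamma_coeff j * ((2 * real j + 1) * (2 * real j + 3) / 4))
      - (2 * real j + 2) * (2 * real j + 4) / 4 * (4 / 3 * (4 * real j + 3) * gamma_coeff j) = - gamma_coeff j"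
    by (simp add: algebra_simps add_divide_distrib)
  finally show ?thesis by (simp add: algebra_simps)
qed

text \<open>
Eliminating \<open>kern_int\<close> between two consecutive even sizes. The inhomogeneous term is what accumulates to
the alternating sum.
\<close>
lemma e_R_even_step:
  "e_R (2 * Suc j + 2) = - (real j + 3 / 2) * e_R (2 * j + 2)
     + 4 * sqrt 2 / pi * (Gamma (real j + 5 / 2))\<^sup>2 / fact (Suc j)"
proof -
  let ?j = "real j"
  \<comment> \<open>the recurrence trades size \<open>2 j + 4\<close> for size \<open>2 j + 2\<close>\<close>
  have Krec: "(2 * ?j + 1) * kern_int (2 * Suc j + 2) = sqrt 2 - (2 * ?j + 2) * kern_int (2 * j + 2)"
    using kern_int_recurrence[of "2 * j + 2"] by (simp add: add_ac)
  have hS: "gamma_coeff (Suc j) = gamma_coeff j * (2 * ?j + 1) * (2 * ?j + 3) / 4" by simp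
  have "e_R (2 * Suc j + 2) * fact (Suc j) = gamma_coeff (Suc j) * (sqrt 2 * (4 * ?j + 7) - kern_int (2 * Suc j + 2))"
    using e_R_even_fact[of "Suc j"] by (simp add: add_ac del: gamma_coeff.simps fact_Suc)
  also have "\<dots> = gamma_coeff j * (2 * ?j + 3) / 4 * (sqrt 2 * (4 * ?j + 7) * (2 * ?j + 1) - (2 * ?j + 1) * kern_int (2 * Suc j + 2))"
  proof -
    have "a * b * c / 4 * (s - k) = a * c / 4 * (s * b - b * k)" for a b c s k :: real
      by (simp add: field_simps)
    then show ?thesis unfolding hS .
  qed
  also have "\<dots> = gamma_coeff j * (2 * ?j + 3) / 4 * (- (2 * ?j + 2) * (sqrt 2 * (4 * ?j + 3) - kern_int (2 * j + 2)) + 4 * sqrt 2 * (2 * ?j + 3) * (2 * ?j + 1))"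
    unfolding Krec by (simp add: algebra_simps)
  also have "\<dots> = - (?j + 3 / 2) * ((?j + 1) * (gamma_coeff j * (sqrt 2 * (4 * ?j + 3) - kern_int (2 * j + 2)))) + 4 * sqrt 2 * (2 * ?j + 3) * gamma_coeff (Suc j)"
    unfolding hS by (simp add: field_simps)
  also have "(?j + 1) * (gamma_coeff j * (sqrt 2 * (4 * ?j + 3) - kern_int (2 * j + 2))) = e_R (2 * j + 2) * fact (Suc j)"
    unfolding e_R_even_fact[symmetric] by (simp add: algebra_simps)
  also have "4 * sqrt 2 * (2 * ?j + 3) * gamma_coeff (Suc j) = 4 * sqrt 2 / pi * (Gamma (?j + 5 / 2))\<^sup>2"
  proof -
    have "Gamma (?j + 5 / 2) = (?j + 3 / 2) * Gamma (?j + 3 / 2)"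
      using Gamma_plus1_pos[of "?j + 3 / 2"] by (simp add: add_ac)
    then have "(Gamma (?j + 5 / 2))\<^sup>2 = (?j + 3 / 2) * (Gamma (?j + 3 / 2) * Gamma (?j + 5 / 2))"
      by (simp add: power2_eq_square)
    also have "Gamma (?j + 3 / 2) * Gamma (?j + 5 / 2) = 2 * pi * gamma_coeff (Suc j)"
      using Gamma_half_mult[of "Suc j"] by (simp add: add_ac del: gamma_coeff.simps)
    finally have sq: "(Gamma (?j + 5 / 2))\<^sup>2 = (?j + 3 / 2) * (2 * pi * gamma_coeff (Suc j))" .
    show ?thesis unfolding sq by (simp add: field_simps del: gamma_coeff.simps)
  qed
  finally have "e_R (2 * Suc j + 2) * fact (Suc j)
    = - (?j + 3 / 2) * (e_R (2 * j + 2) * fact (Suc j)) + 4 * sqrt 2 / pi * (Gamma (?j + 5 / 2))\<^sup>2" .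
  moreover have "fact (Suc j) \<noteq> (0 :: real)" by simp
  ultimately show ?thesis by (simp add: field_simps del: fact_Suc)
qed

lemma Gamma_nat_plus_half: "Gamma (real m + 1 / 2) = sqrt pi * (fact (2 * m) / (fact m * 2 ^ (2 * m)))"
proof (induction m)
  case 0
  show ?case by (simp add: Gamma_one_half_real)
next
  case (Suc m)
  have "Gamma (real (Suc m) + 1 / 2) = (real m + 1 / 2) * Gamma (real m + 1 / 2)"
    using Gamma_plus1_pos[of "real m + 1 / 2"] by (simp add: add_ac)
  also have "\<dots> = sqrt pi * (fact (2 * Suc m) / (fact (Suc m) * 2 ^ (2 * Suc m)))"
  proof -
    have F2: "fact (2 * Suc m) = 2 * (real m + 1) * (2 * real m + 1) * fact (2 * m)"
      by (simp add: algebra_simps)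
    have F1: "fact (Suc m) = (real m + 1) * fact m" by simp
    have P: "2 ^ (2 * Suc m) = 2 ^ (2 * m) * (4 :: real)" by simp
    have alg: "(x + 1 / 2) * (s * (F / (f * p))) = s * (2 * (x + 1) * (2 * x + 1) * F / ((x + 1) * f * (p * 4)))"
      if "f \<noteq> 0" "p \<noteq> 0" "x + 1 \<noteq> 0" for x s F f p :: real
      using that by (simp add: divide_simps) (simp add: algebra_simps)
    show ?thesis unfolding Suc.IH F1 F2 P by (rule alg) simp_all
  qed
  finally show ?case .
qed

lemma e_R_even_formula:
  "e_R (2 * j + 2) = (-1) ^ Suc j * (Gamma (real (Suc j) + 1 / 2) / sqrt pi)
      * (1 - 4 * sqrt 2 / sqrt pi * (\<Sum>k = 0..j. (-1) ^ k * (Gamma (real k + 3 / 2) / fact k)))"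
proof (induction j)
  case 0
  have "e_R 2 = 1 / 4 * (sqrt 2 * 3 - kern_int 2)"
    using e_R_even_fact[of 0] by (simp add: numeral_2_eq_2)
  also have "\<dots> = sqrt 2 - 1 / 2"
    unfolding kern_int_2 by (simp add: field_simps)
  finally show ?case
    by (simp add: Gamma_three_halves numeral_2_eq_2 diff_divide_distrib)
next
  case (Suc j)
  let ?S = "\<lambda>j. \<Sum>k = 0..j. (-1) ^ k * (Gamma (real k + 3 / 2) / fact k)"
  let ?G = "Gamma (real j + 5 / 2)"
  have G: "Gamma (real (Suc (Suc j)) + 1 / 2) = ?G" "Gamma (real (Suc j) + 3 / 2) = ?G"
    by (simp_all add: add_ac)
  have G': "(real j + 3 / 2) * Gamma (real (Suc j) + 1 / 2) = ?G"
    using Gamma_plus1_pos[of "real j + 3 / 2"] by (simp add: add_ac)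
  have S: "?S (Suc j) = ?S j + (-1) ^ Suc j * (?G / fact (Suc j))"
    using G(2) by (simp del: fact_Suc)
  have one: "(-1) ^ Suc j * (-1) ^ Suc j = (1 :: real)" by (simp flip: power_mult_distrib)
  have "e_R (2 * Suc j + 2) = - ((-1) ^ Suc j * (((real j + 3 / 2) * Gamma (real (Suc j) + 1 / 2)) / sqrt pi)
      * (1 - 4 * sqrt 2 / sqrt pi * ?S j)) + 4 * sqrt 2 / pi * ?G\<^sup>2 / fact (Suc j)"
    unfolding e_R_even_step Suc.IH by (simp only: mult_ac minus_mult_left times_divide_eq_right times_divide_eq_left)
  also have "\<dots> = (-1) ^ Suc (Suc j) * (?G / sqrt pi) * (1 - 4 * sqrt 2 / sqrt pi * ?S j)
      - (-1) ^ Suc (Suc j) * (-1) ^ Suc j * (4 * sqrt 2 / pi * ?G\<^sup>2 / fact (Suc j))"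
    unfolding G' using one by simp
  also have "4 * sqrt 2 / pi * ?G\<^sup>2 / fact (Suc j) = ?G / sqrt pi * (4 * sqrt 2 / sqrt pi) * (?G / fact (Suc j))"
    by (simp add: power2_eq_square field_simps del: fact_Suc)
  finally show ?case unfolding G S by (simp only: right_diff_distrib distrib_left mult_ac diff_diff_eq)
qed

lemma Gamma_log_midpoint:
  fixes x y :: real
  assumes "x > 0" "y > 0"
  shows "(Gamma ((x + y) / 2))\<^sup>2 \<le> Gamma x * Gamma y"
proof -
  have "ln (Gamma ((1 - 1 / 2) *\<^sub>R x + (1 / 2) *\<^sub>R y)) \<le> (1 - 1 / 2) * ln (Gamma x) + 1 / 2 * ln (Gamma y)"
    using convex_onD[OF log_convex_Gamma_real, of "1 / 2" x y] assms by simp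
  then have "2 * ln (Gamma ((x + y) / 2)) \<le> ln (Gamma x) + ln (Gamma y)"
    by (simp add: add_divide_distrib)
  moreover have p: "Gamma ((x + y) / 2) > 0" "Gamma x > 0" "Gamma y > 0"
    using assms by (simp_all add: Gamma_real_pos)
  ultimately have "ln ((Gamma ((x + y) / 2))\<^sup>2) \<le> ln (Gamma x * Gamma y)"
    by (simp add: ln_mult ln_realpow)
  then show ?thesis using p by (subst (asm) ln_le_cancel_iff) auto
qed

lemma kern_int_le: "n \<ge> 1 \<Longrightarrow> kern_int n \<le> sqrt 2"
proof -
  assume n: "n \<ge> 1"
  have "1 * kern_int n \<le> real n * kern_int n"
    using n kern_int_nonneg[of n] by (intro mult_right_mono) auto
  also have "\<dots> \<le> real n * kern_int n + (real n - 1) * kern_int (n + 2)"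
    using n kern_int_nonneg[of "n + 2"] by simp
  finally show ?thesis using kern_int_recurrence[OF n] by simp
qed

text \<open>
The quotient is \<open>r * t\<close>. Here \<open>r = Gamma (j + 1/2) Gamma (j + 3/2) / Gamma (j + 1)\<^sup>2\<close> lies between 1 and
\<open>(j + 1)/(j + 1/2)\<close> by log-convexity, and \<open>t\<close> differs from 1 only through \<open>kern_int N\<close>, which lies
between 0 and \<open>sqrt 2\<close>, and a shift of the numerator.
\<close>
lemma e_R_even_bounds:
  assumes N: "N = 2 * j + 2"
  defines "g \<equiv> 2 * sqrt 2 / pi * Gamma ((real N + 2) / 2)"
  shows "1 - 1 / real N \<le> e_R N / g" "e_R N / g \<le> real N / (real N - 1)"
proof -
  let ?j = "real j"
  define r where "r = Gamma (?j + 1 / 2) * Gamma (?j + 3 / 2) / (fact j)\<^sup>2"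
  have pos: "Gamma (?j + 1 / 2) > 0" "Gamma (?j + 3 / 2) > 0"
    by (simp_all add: Gamma_real_pos)
  have f1: "Gamma (?j + 1) = fact j" using Gamma_fact[of j, where 'a = real] by (simp add: add.commute)
  have f2: "Gamma (?j + 2) = (?j + 1) * fact j"
    using Gamma_fact[of "Suc j", where 'a = real] by (simp add: add_ac)
  have mid: "(?j + 1 / 2 + (?j + 3 / 2)) / 2 = ?j + 1" "(?j + 1 + (?j + 2)) / 2 = ?j + 3 / 2"
    by (simp_all add: field_simps)
  \<comment> \<open>midpoint of \<open>j + 1/2\<close> and \<open>j + 3/2\<close>\<close>
  have r1: "r \<ge> 1"
    using Gamma_log_midpoint[of "?j + 1 / 2" "?j + 3 / 2"] unfolding r_def mid f1
    by (simp add: le_divide_eq)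
  \<comment> \<open>midpoint of \<open>j + 1\<close> and \<open>j + 2\<close>\<close>
  have r2: "r \<le> (?j + 1) / (?j + 1 / 2)"
  proof -
    have "Gamma (?j + 3 / 2) = (?j + 1 / 2) * Gamma (?j + 1 / 2)"
      using Gamma_plus1_pos[of "?j + 1 / 2"] by (simp add: add_ac)
    then have "(?j + 1 / 2) * (Gamma (?j + 1 / 2) * Gamma (?j + 3 / 2)) = (Gamma (?j + 3 / 2))\<^sup>2"
      by (simp add: power2_eq_square)
    also have "\<dots> \<le> fact j * ((?j + 1) * fact j)"
      using Gamma_log_midpoint[of "?j + 1" "?j + 2"] unfolding mid f1 f2 by simp
    finally show ?thesis
      unfolding r_def by (simp add: divide_simps power2_eq_square mult_ac)
  qed
  have gN: "g = 2 * sqrt 2 / pi * ((?j + 1) * fact j)"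
  proof -
    have half: "(real N + 2) / 2 = ?j + 2" using N by (simp add: field_simps)
    show ?thesis unfolding g_def half f2 ..
  qed
  have hr: "gamma_coeff j = r * (fact j)\<^sup>2 / (2 * pi)"
    using Gamma_half_mult[of j] unfolding r_def by (simp add: field_simps)
  define t where "t = (sqrt 2 * (4 * ?j + 3) - kern_int N) / (sqrt 2 * (4 * ?j + 4))"
  have e: "e_R N * fact j = gamma_coeff j * (sqrt 2 * (4 * ?j + 3) - kern_int N)"
    using e_R_even_fact[of j] N by simp
  have eR: "e_R N = gamma_coeff j * (sqrt 2 * (4 * ?j + 3) - kern_int N) / fact j"
    using e by (simp add: field_simps)
  have alg: "r * f\<^sup>2 / (2 * p) * X / f / (2 * s / p * ((x + 1) * f)) = r * (X / (s * (4 * x + 4)))"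
    if "f > 0" "p > 0" "s > 0" "x + 1 > 0" for f p s x X :: real
    using that by (simp add: divide_simps power2_eq_square)
  have eq: "e_R N / g = r * t"
    unfolding eR gN hr t_def by (rule alg) simp_all
  have "kern_int N \<le> sqrt 2" using N by (intro kern_int_le) simp
  then have "sqrt 2 * (4 * ?j + 2) \<le> sqrt 2 * (4 * ?j + 3) - kern_int N" by (simp add: algebra_simps)
  then have "sqrt 2 * (4 * ?j + 2) / (sqrt 2 * (4 * ?j + 4)) \<le> t"
    unfolding t_def by (intro divide_right_mono) auto
  also have "sqrt 2 * (4 * ?j + 2) / (sqrt 2 * (4 * ?j + 4)) = (4 * ?j + 2) / (4 * ?j + 4)"
    by (rule mult_divide_mult_cancel_left) simp
  also have "(4 * ?j + 2) / (4 * ?j + 4) = 1 - 1 / real N"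
    using N by (simp add: field_simps)
  finally have t1: "1 - 1 / real N \<le> t" .
  have "sqrt 2 * (4 * ?j + 3) - kern_int N \<le> sqrt 2 * (4 * ?j + 4)"
    using kern_int_nonneg[of N] by (simp add: algebra_simps)
  then have t2: "t \<le> 1" unfolding t_def by (simp add: divide_le_eq)
  have t0: "0 \<le> 1 - 1 / real N" using N by simp
  have "1 * (1 - 1 / real N) \<le> r * t"
    using r1 t1 t0 by (intro mult_mono) auto
  then show "1 - 1 / real N \<le> e_R N / g" unfolding eq by simp
  have "r * t \<le> (?j + 1) / (?j + 1 / 2) * 1"
    using r1 r2 t1 t0 t2 by (intro mult_mono) auto
  also have "\<dots> = real N / (real N - 1)" using N by (simp add: field_simps)
  finally show "e_R N / g \<le> real N / (real N - 1)" unfolding eq .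
qed

lemma e_R_odd_formula:
  assumes "odd n"
  shows "e_R n = 2 * sqrt 2 / pi * Gamma ((real n + 2) / 2)"
proof -
  obtain j where n: "n = 2 * j + 1" using assms by (elim oddE)
  have half: "(real n + 2) / 2 = real j + 3 / 2" using n by (simp add: field_simps)
  have "2 * sqrt 2 / pi * Gamma (real j + 3 / 2) * Gamma (real j + 1 / 2)
      = 2 * sqrt 2 / pi * (Gamma (real j + 1 / 2) * Gamma (real j + 3 / 2))"
    by (simp only: mult_ac)
  also have "\<dots> = e_R n * Gamma (real j + 1 / 2)"
    unfolding Gamma_half_mult n e_R_odd_Gamma by simp
  finally have "2 * sqrt 2 / pi * Gamma (real j + 3 / 2) * Gamma (real j + 1 / 2) = e_R n * Gamma (real j + 1 / 2)" .
  moreover have "Gamma (real j + 1 / 2) > 0"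
    by (rule Gamma_real_pos) simp
  ultimately show ?thesis unfolding half by (metis mult_right_cancel less_irrefl)
qed

theorem theorem3:
  shows "(\<forall>n::nat. n > 0 \<and> odd n \<longrightarrow>
            e_R n = 2 * sqrt 2 / pi * Gamma ((real n + 2) / 2)) \<and>
         (\<forall>n m::nat. n > 0 \<and> n = 2 * m \<longrightarrow>
            e_R n = (-1) ^ m * (fact n / (fact m * 2 ^ n))
                    + (-1) ^ (m - 1) * (4 * sqrt 2 * fact n / (sqrt pi * fact m * 2 ^ n))
                      * (\<Sum>k = 0..m - 1. (-1) ^ k * (Gamma (real k + 3 / 2) / fact k))) \<and>
         e_R \<sim>[at_top] (\<lambda>n. 2 * sqrt 2 / pi * Gamma ((real n + 2) / 2))"
proof (intro conjI allI impI)
  fix n :: nat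
  assume "n > 0 \<and> odd n"
  then show "e_R n = 2 * sqrt 2 / pi * Gamma ((real n + 2) / 2)"
    by (simp add: e_R_odd_formula)
next
  fix n m :: nat
  assume nm: "n > 0 \<and> n = 2 * m"
  then obtain j where m: "m = Suc j" by (cases m) auto
  let ?S = "\<Sum>k = 0..j. (-1) ^ k * (Gamma (real k + 3 / 2) / fact k)"
  define c :: real where "c = fact n / (fact m * 2 ^ n)"
  have "Gamma (real (Suc j) + 1 / 2) / sqrt pi = c"
    using Gamma_nat_plus_half[of m] nm by (simp only: m c_def) simp
  then have "e_R n = (-1) ^ Suc j * c * (1 - 4 * sqrt 2 / sqrt pi * ?S)"
    using e_R_even_formula[of j] nm m by simp
  also have "\<dots> = (-1) ^ Suc j * c + (-1) ^ j * (4 * sqrt 2 / sqrt pi * c) * ?S"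
    by (simp add: algebra_simps)
  also have "4 * sqrt 2 / sqrt pi * c = 4 * sqrt 2 * fact n / (sqrt pi * fact m * 2 ^ n)"
    by (simp add: c_def)
  finally show "e_R n = (-1) ^ m * (fact n / (fact m * 2 ^ n))
                    + (-1) ^ (m - 1) * (4 * sqrt 2 * fact n / (sqrt pi * fact m * 2 ^ n))
                      * (\<Sum>k = 0..m - 1. (-1) ^ k * (Gamma (real k + 3 / 2) / fact k))"
    unfolding c_def m by simp
next
  let ?g = "\<lambda>n. 2 * sqrt 2 / pi * Gamma ((real n + 2) / 2)"
  have bounds: "1 - 1 / real n \<le> e_R n / ?g n \<and> e_R n / ?g n \<le> real n / (real n - 1)" if n: "n \<ge> 2" for n
  proof (cases "odd n")
    case True
    have "Gamma ((real n + 2) / 2) > 0"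
      by (rule Gamma_real_pos) simp
    then have "Gamma ((real n + 2) / 2) \<noteq> 0" by (metis less_irrefl)
    then have "?g n \<noteq> 0" by simp
    then have one: "e_R n / ?g n = 1" unfolding e_R_odd_formula[OF True] by (rule divide_self)
    show ?thesis unfolding one using n by (simp add: field_simps)
  next
    case False
    then have "even n" by simp
    then obtain i where "n = 2 * i" by (elim evenE)
    with n obtain j where "n = 2 * j + 2" by (cases i) auto
    then show ?thesis using e_R_even_bounds by blast
  qed
  have "((\<lambda>n. e_R n / ?g n) \<longlongrightarrow> 1) at_top"
  proof (rule tendsto_sandwich)
    show "\<forall>\<^sub>F n in at_top. 1 - 1 / real n \<le> e_R n / ?g n" "\<forall>\<^sub>F n in at_top. e_R n / ?g n \<le> real n / (real n - 1)"
      using bounds by (auto simp: eventually_at_top_linorder)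
    show "((\<lambda>n. 1 - 1 / real n) \<longlongrightarrow> 1) at_top" by real_asymp
    show "((\<lambda>n. real n / (real n - 1)) \<longlongrightarrow> 1) at_top" by real_asymp
  qed
  then show "e_R \<sim>[at_top] ?g" by (rule asymp_equivI')
qed

end
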